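(* Let $d_1,d_2\ge 1$ and let $(\mathbf X_i,\mathbf Y_i)$, $i=1,2,\ldots$, be independent copies of a random vector $(\mathbf X,\mathbf Y)$, where $\mathbf X=(X^{(1)},\ldots,X^{(d_1)})$ takes values in $[0,1]^{d_1}$ and $\mathbf Y$ takes values in $\mathbb R^{d_2}$ (row vectors). Assume that the distribution function $C(\mathbf u)=\mathbf P(\mathbf X\le\mathbf u)$ of $\mathbf X$ is a copula with a density $c$, i.e. $C(\mathbf u)=\int_{\mathbf 0}^{\mathbf u}c(\mathbf v)\,d\mathbf v$ for $\mathbf u\in[0,1]^{d_1}$. Let $\mathbf m(\mathbf u)=\mathbf E(\mathbf Y\mid\mathbf X=\mathbf u)$ and $\sigma^2(\mathbf u)=\mathbf E\{(\mathbf Y-\mathbf m(\mathbf X))^T(\mathbf Y-\mathbf m(\mathbf X))\mid\mathbf X=\mathbf u\}$. For $1\le k\le d_1$ let $\mathbf Y^{(k)}_{n,1},\ldots,\mathbf Y^{(k)}_{n,n}$ be the vectors $\mathbf Y_1,\ldots,\mathbf Y_n$ rearranged in ascending order of the $k$-th coordinates $X_1^{(k)},\ldots,X_n^{(k)}$ (the induced order statistics), and let $$\mathbf Z_n(t)=\left(\sum_{j=1}^{[nt]}\mathbf Y^{(1)}_{n,j},\ \sum_{j=1}^{[nt]}\mathbf Y^{(2)}_{n,j},\ \ldots,\ \sum_{j=1}^{[nt]}\mathbf Y^{(d_1)}_{n,j}\right),\qquad t\in[0,1].$$ If $\mathbf E\|\mathbf Y\|^2<\infty$ and $\mathbf m\equiv\mathbf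 0$, then, as $n\to\infty$, $$\widetilde{\mathbf Z}_n=\frac{\mathbf Z_n}{\sqrt n}\Rightarrow\mathbf Z,$$ where $\mathbf Z$ is a centered Gaussian $(d_1\times d_2)$-dimensional process on $[0,1]$ with covariance matrix function $$\mathbf E\,\mathbf Z^T(t_1)\mathbf Z(t_2)=\bigl(K(\mathbf e_{k_1,t_1},\mathbf e_{k_2,t_2})\bigr)_{k_1,k_2=1}^{d_1},\qquad K(\mathbf e_{k_1,t_1},\mathbf e_{k_2,t_2})=\int_{\mathbf 0}^{\min(\mathbf e_{k_1,t_1},\mathbf e_{k_2,t_2})}\sigma^2(\mathbf v)c(\mathbf v)\,d\mathbf v,$$ where $\mathbf e_{k,t}=(1,\ldots,1,t,1,\ldots,1)\in[0,1]^{d_1}$ is the vector whose $k$-th coordinate is $t$ and whose other coordinates are $1$.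
   Context: Vectors are row vectors; $\|\cdot\|$ is the Euclidean norm; $[x]$ is the integer part. The inequality $\mathbf x\le\mathbf u$ between vectors in $[0,1]^{d_1}$ and $\min(\cdot,\cdot)$ of vectors are taken coordinatewise, and $\int_{\mathbf 0}^{\mathbf u}$ denotes the integral over the box $\{\mathbf v\in[0,1]^{d_1}:\mathbf v\le\mathbf u\}$. A copula is a distribution function on $[0,1]^{d_1}$ with marginals uniform on $[0,1]$; in particular, ties among $X^{(k)}_1,\ldots,X^{(k)}_n$ have probability zero. "$(d_1\times d_2)$-dimensional" means that the process takes values in row vectors of length $d_1d_2$, consisting of $d_1$ consecutive blocks of length $d_2$; accordingly $\mathbf E\,\mathbf Z^T(t_1)\mathbf Z(t_2)$ is a $d_1\times d_1$ block matrix with $d_2\times d_2$ blocks, the $(k_1,k_2)$ block being $K(\mathbf e_{k_1,t_1},\mathbf e_{k_2,t_2})$. The symbol $\Rightarrow$ denotes weak convergence of stochastic processes in the uniform topology, i.e. with respect to the supremum metric on bounded functions $[0,1]\to\mathbb R^{d_1d_2}$: $\mathbf E^*g(\widetilde{\mathbf Z}_n)\to\mathbf E g(\mathbf Z)$ for every bounded functional $g$ that is continuous in the supremum norm ($\mathbf E^*$ is outer expectation, used because of possible non-measurability). The limit process is understood to have almost surely continuous trajectories. *)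

theory Defs
  imports "HOL-Probability.Probability"
begin

section \<open>Copulas\<close>

definition is_copula :: "(real^'k \<Rightarrow> real) \<Rightarrow> bool" where
  "is_copula C \<longleftrightarrow>
     (\<exists>\<mu> :: (real^'k) measure. prob_space \<mu> \<and> sets \<mu> = sets borel \<and> measure \<mu> (cbox 0 1) = 1 \<and>
        (\<forall>u\<in>cbox 0 1. C u = measure \<mu> {v. v \<le> u}) \<and>
        (\<forall>k. distr \<mu> borel (\<lambda>v. v $ k) = uniform_measure lborel {0..1}))"

definition has_density :: "(real^'k \<Rightarrow> real) \<Rightarrow> (real^'k \<Rightarrow> real) \<Rightarrow> bool" where
  "has_density C c \<longleftrightarrow>
     set_integrable lborel (cbox 0 1) c \<and> (\<forall>v\<in>cbox 0 1. 0 \<le> c v) \<and>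
     (\<forall>u\<in>cbox 0 1. C u = (LINT v:cbox 0 u|lborel. c v))"

definition corner :: "'k \<Rightarrow> real \<Rightarrow> real^'k" where
  "corner k t = (\<chi> i. if i = k then t else 1)"

section \<open>Conditional expectation given a random vector, as a function of its value\<close>

text \<open>\<open>g\<close> is a version of \<open>u \<mapsto> E(V | X = u)\<close>, i.e. \<open>g(X)\<close> is a version of the conditional
  expectation of \<open>V\<close> given the sigma-algebra generated by \<open>X\<close>, coordinate by coordinate.\<close>

definition is_cond_exp_given ::
  "'a measure \<Rightarrow> ('a \<Rightarrow> 'x::euclidean_space) \<Rightarrow> ('a \<Rightarrow> 'v::euclidean_space) \<Rightarrow> ('x \<Rightarrow> 'v) \<Rightarrow> bool" where
  "is_cond_exp_given M X V g \<longleftrightarrow>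
     g \<in> borel_measurable borel \<and>
     (\<forall>b\<in>Basis. AE \<omega> in M.
        real_cond_exp M (vimage_algebra (space M) X borel) (\<lambda>\<omega>. V \<omega> \<bullet> b) \<omega> = g (X \<omega>) \<bullet> b)"

text \<open>The matrix \<open>v\<^sup>T w\<close> for row vectors \<open>v\<close>, \<open>w\<close>.\<close>

definition row_outer :: "real^'m \<Rightarrow> real^'m \<Rightarrow> real^'m^'m" where
  "row_outer v w = transpose (rowvector v :: real^'m^1) ** (rowvector w :: real^'m^1)"

section \<open>Induced order statistics\<close>

text \<open>For \<open>1 \<le> j \<le> n\<close>: the \<open>j\<close>-th term of \<open>y 1, \<dots>, y n\<close> rearranged in ascending order of
  \<open>x 1, \<dots>, x n\<close>. Sorting is stable, so ties among the \<open>x i\<close> are broken by the index.\<close>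

definition induced_order_stat :: "(nat \<Rightarrow> real) \<Rightarrow> (nat \<Rightarrow> 'v) \<Rightarrow> nat \<Rightarrow> nat \<Rightarrow> 'v" where
  "induced_order_stat x y n j = y (sort_key x [1..<Suc n] ! (j - 1))"

text \<open>A row vector consisting of \<open>d1\<close> blocks of length \<open>d2\<close> is an element of
  \<^typ>\<open>real^'d2^'d1\<close>, whose library norm is the Euclidean norm of all \<open>d1 d2\<close> coordinates.\<close>

definition induced_sum_process ::
  "(nat \<Rightarrow> 'a \<Rightarrow> real^'d1) \<Rightarrow> (nat \<Rightarrow> 'a \<Rightarrow> real^'d2) \<Rightarrow> nat \<Rightarrow> 'a \<Rightarrow> real \<Rightarrow> real^'d2^'d1" where
  "induced_sum_process X Y n \<omega> t =
     (\<chi> k. \<Sum>j = 1..nat \<lfloor>real n * t\<rfloor>. induced_order_stat (\<lambda>i. X i \<omega> $ k) (\<lambda>i. Y i \<omega>) n j)"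

section \<open>Gaussian processes\<close>

text \<open>Point masses count as normal distributions.\<close>

definition normal_rv :: "'a measure \<Rightarrow> ('a \<Rightarrow> real) \<Rightarrow> bool" where
  "normal_rv M V \<longleftrightarrow> V \<in> borel_measurable M \<and>
     (\<exists>\<mu>. (AE \<omega> in M. V \<omega> = \<mu>) \<or> (\<exists>\<sigma>>0. distributed M lborel V (normal_density \<mu> \<sigma>)))"

definition gaussian_process ::
  "'a measure \<Rightarrow> real set \<Rightarrow> ('a \<Rightarrow> real \<Rightarrow> 'v::euclidean_space) \<Rightarrow> bool" where
  "gaussian_process M T Z \<longleftrightarrow>
     (\<forall>F a. finite F \<and> F \<subseteq> T \<longrightarrow> normal_rv M (\<lambda>\<omega>. \<Sum>t\<in>F. a t \<bullet> Z \<omega> t))"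

definition centered_process ::
  "'a measure \<Rightarrow> real set \<Rightarrow> ('a \<Rightarrow> real \<Rightarrow> 'v::euclidean_space) \<Rightarrow> bool" where
  "centered_process M T Z \<longleftrightarrow>
     (\<forall>t\<in>T. integrable M (\<lambda>\<omega>. Z \<omega> t) \<and> (LINT \<omega>|M. Z \<omega> t) = 0)"

section \<open>Weak convergence in the uniform topology\<close>

text \<open>The infimum of the expectations of the integrable majorants. This agrees with the usual
  outer expectation for bounded \<open>f\<close>, which is the only case used.\<close>

definition outer_expectation :: "'a measure \<Rightarrow> ('a \<Rightarrow> real) \<Rightarrow> real" where
  "outer_expectation M f =
     Inf {integral\<^sup>L M U | U. integrable M U \<and> (\<forall>\<omega>\<in>space M. f \<omega> \<le> U \<omega>)}"

text \<open>Paths are restricted to \<open>T\<close> because the elements of \<^const>\<open>funspace\<close> are extensional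
  functions. The limit is required to be a Borel random element in the sense that all its bounded
  continuous functionals are measurable, so that their expectations make sense.\<close>

definition weakly_converges_uniformly ::
  "real set \<Rightarrow> 'a measure \<Rightarrow> (nat \<Rightarrow> 'a \<Rightarrow> real \<Rightarrow> 'v::euclidean_space) \<Rightarrow>
   'b measure \<Rightarrow> ('b \<Rightarrow> real \<Rightarrow> 'v) \<Rightarrow> bool" where
  "weakly_converges_uniformly T M Zn P Z \<longleftrightarrow>
     (let L = funspace T (euclidean_metric :: 'v metric) in
       (\<forall>n. \<forall>\<omega>\<in>space M. restrict (Zn n \<omega>) T \<in> mspace L) \<and>
       (\<forall>\<omega>\<in>space P. restrict (Z \<omega>) T \<in> mspace L) \<and>
       (\<forall>g. continuous_map (mtopology_of L) euclideanreal g \<and> bounded (g ` mspace L) \<longrightarrow>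
          (\<lambda>\<omega>. g (restrict (Z \<omega>) T)) \<in> borel_measurable P \<and>
          (\<lambda>n. outer_expectation M (\<lambda>\<omega>. g (restrict (Zn n \<omega>) T)))
             \<longlonglongrightarrow> (LINT \<omega>|P. g (restrict (Z \<omega>) T))))"

end

theory Submission
  imports Defs
begin

text \<open>
  Write \<open>W n t\<close> for \<open>1 / sqrt n\<close> times the sum of the rows \<open>Y\<^sub>i\<close> placed in those blocks \<open>k\<close> with
  \<open>X\<^sub>i\<^sup>(\<^sup>k\<^sup>) \<le> t\<close>. Almost surely there are no ties, and then the \<open>k\<close>-th block of the induced process at
  time \<open>t\<close> is that of \<open>W n\<close> at the \<open>[n t]\<close>-th order statistic of the \<open>k\<close>-th coordinates, which is
  close to \<open>t\<close> because the marginals are uniform. So it suffices to control \<open>W n\<close>.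

  For fixed times \<open>W n\<close> is a normalized sum of i.i.d. centered vectors, so its characteristic
  functions converge. In one coordinate \<open>t \<mapsto> W n t\<close> has martingale increments, since a summand
  that enters after time \<open>s\<close> is independent of the sum of the others up to time \<open>s\<close>. Doob's inequality
  for the convex function \<open>x\<^sup>2 / 2 - 1 + cos x\<close> bounds the probability of an oscillation over a
  dyadic cell by an expectation whose limit, \<open>v / 2 - 1 + exp (- v / 2) \<le> v\<^sup>2 / 8\<close> with \<open>v\<close> the
  variance over the cell, is again read off a characteristic function; these bounds
  are summable over the cells with a small sum.

  The limit is built on the dyadic times from i.i.d. normal variables by the Gram-Schmidt process in
  \<open>L\<^sup>2\<close> of the law of \<open>(X, Y)\<close>. It inherits the oscillation bounds from \<open>W n\<close>, hence extends
  continuously to \<open>[0, 1]\<close>. Lipschitz functionals of the paths are compared through dyadic step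
  functions, and a bounded continuous functional is a monotone limit of Lipschitz ones from below.
\<close>

section \<open>Convergence of characteristic functions and of Lipschitz functionals\<close>

text \<open>Only second moments are available, so a fourth-moment tightness criterion cannot be
  used, and a bound of the order of the variance per cell would not become small when summed over
  the cells. The gauge gives the order of the squared variance, and the cell variances are uniformly
  small because the marginals are uniform. The order of limits is fixed by this: \<open>n\<close>
  tends to infinity at a fixed dyadic level \<open>p\<close>, then \<open>p\<close> does;
  \<open>bad_limit p e\<close> is what survives the first limit.

  Bounded paths with the supremum metric form a nonseparable space, so no sigma-algebra on it is
  used. A sample path is a step function of finitely many random vectors and a limit path is a
  uniform limit of such steps; hence continuous functionals are measurable and the outer
  expectations are ordinary ones.

  Characteristic functions are turned into expectations by normal smoothing: a kernel is an average
  of exponentials, so the smoothed densities converge pointwise, and by Scheffe's lemma in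
  mean.\<close>

definition normal_kernel :: "'i set \<Rightarrow> real \<Rightarrow> ('i \<Rightarrow> real) \<Rightarrow> ('i \<Rightarrow> real) \<Rightarrow> real" where
  "normal_kernel I h x m = (\<Prod>i\<in>I. normal_density (x i) h (m i))"

lemma normal_kernel_nonneg: "0 \<le> normal_kernel I h x m"
  by (simp add: normal_kernel_def prod_nonneg)

text \<open>Up to its constant, the normal density is the characteristic function of the standard
  normal law at \<open>(x - m) / h\<close>. A kernel factor thus becomes an average of
  exponentials.\<close>

lemma complex_normal_density_eq_iexp_integral:
  assumes "h > 0"
  shows "complex_of_real (normal_density x h m) =
    complex_of_real (1 / sqrt (2 * pi * h\<^sup>2)) * (CLINT s|std_normal_distribution. iexp ((x - m) / h * s))"
proof -
  have "(CLINT s|std_normal_distribution. iexp ((x - m) / h * s)) = char std_normal_distribution ((x - m) / h)"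
    by (simp add: char_def)
  also have "\<dots> = complex_of_real (exp (- (((x - m) / h)^2) / 2))"
    by (simp add: char_std_normal_distribution)
  also have "- (((x - m) / h)^2) / 2 = -(m - x)\<^sup>2 / (2 * h\<^sup>2)"
    by (simp add: power_divide power2_commute)
  finally show ?thesis
    by (simp add: normal_density_def)
qed

abbreviation kernel_char :: "'a measure \<Rightarrow> ('a \<Rightarrow> 'i \<Rightarrow> real) \<Rightarrow> 'i set \<Rightarrow> 'i set \<Rightarrow> real \<Rightarrow> ('i \<Rightarrow> real) \<Rightarrow> ('i \<Rightarrow> real) \<Rightarrow> complex" where
  "kernel_char M V I J h m a \<equiv>
     (CLINT \<omega>|M. complex_of_real (normal_kernel J h (V \<omega>) m) * iexp (\<Sum>i\<in>I. a i * V \<omega> i))"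

text \<open>Kernel factors are added one coordinate at a time. By Fubini, a new factor averages the
  previous expression over shifted frequencies \<open>a\<close>, and dominated convergence carries
  the limit through the average.\<close>

lemma char_convergence_imp_mixed_convergence:
  fixes V :: "nat \<Rightarrow> 'a \<Rightarrow> 'i \<Rightarrow> real" and U :: "'b \<Rightarrow> 'i \<Rightarrow> real"
  assumes "prob_space M" and "prob_space P" and I: "finite I"
    and V[measurable]: "\<And>n i. i \<in> I \<Longrightarrow> (\<lambda>\<omega>. V n \<omega> i) \<in> borel_measurable M"
    and U[measurable]: "\<And>i. i \<in> I \<Longrightarrow> (\<lambda>\<omega>. U \<omega> i) \<in> borel_measurable P"
    and char: "\<And>a. (\<lambda>n. CLINT \<omega>|M. iexp (\<Sum>i\<in>I. a i * V n \<omega> i))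
                 \<longlonglongrightarrow> (CLINT \<omega>|P. iexp (\<Sum>i\<in>I. a i * U \<omega> i))"
    and h: "h > 0" and J: "J \<subseteq> I"
  shows "(\<lambda>n. kernel_char M (V n) I J h m a)
     \<longlonglongrightarrow> kernel_char P U I J h m a"
  using finite_subset[OF J I] J
proof (induction J arbitrary: a)
  case empty
  then show ?case using char by (simp add: normal_kernel_def)
next
  case (insert r J)
  let ?\<gamma> = "std_normal_distribution"
  interpret M: prob_space M by fact
  interpret PP: prob_space P by fact
  interpret S: prob_space ?\<gamma>
    by (rule prob_space_normal_density) simp
  define c where "c = 1 / sqrt (2 * pi * h\<^sup>2)"
  have c0: "0 \<le> c" by (simp add: c_def)
  have rI: "r \<in> I" "J \<subseteq> I" using insert by auto
  \<comment> \<open>The exponential that represents the factor at \<open>r\<close> only moves the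
    frequency of coordinate \<open>r\<close>, so the induction hypothesis must hold for all
    \<open>a\<close>.\<close>
  define a' where "a' s = a(r := a r + s / h)" for s
  let ?e = "\<lambda>s. complex_of_real c * iexp (- (m r / h * s))"
  have nd_le: "normal_density x h y \<le> c" for x y
    by (auto simp: normal_density_def c_def intro!: divide_right_mono)
  have kernel_le: "norm (complex_of_real (normal_kernel J h x m)) \<le> c ^ card J" for x
    using prod_mono[of J "\<lambda>i. normal_density (x i) h (m i)" "\<lambda>_. c"]
    by (simp add: normal_kernel_def prod_nonneg nd_le flip: of_real_prod)
  have key: "kernel_char Q W I (insert r J) h m a =
     (CLINT s|?\<gamma>. ?e s * kernel_char Q W I J h m (a' s))"
      "(\<lambda>s. ?e s * kernel_char Q W I J h m (a' s)) \<in> borel_measurable ?\<gamma>"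
    if "prob_space Q" and W[measurable]: "\<And>i. i \<in> I \<Longrightarrow> (\<lambda>\<omega>. W \<omega> i) \<in> borel_measurable Q"
    for Q :: "'z measure" and W
  proof -
    interpret Q: prob_space Q by fact
    interpret pair_prob_space ?\<gamma> Q ..
    have sum_a': "(\<Sum>i\<in>I. a' s i * w i) = (\<Sum>i\<in>I. a i * w i) + s / h * w r" for s w
      using I rI by (simp add: a'_def sum.remove[of I r] algebra_simps)
    let ?F = "\<lambda>s \<omega>. ?e s *
        (complex_of_real (normal_kernel J h (W \<omega>) m) * iexp (\<Sum>i\<in>I. a' s i * W \<omega> i))"
    have [measurable]: "\<And>i. i \<in> J \<Longrightarrow> (\<lambda>\<omega>. W \<omega> i) \<in> borel_measurable Q"
      using rI by auto
    have [measurable]: "(\<lambda>\<omega>. normal_density (W \<omega> i) h (m i)) \<in> borel_measurable Q" if "i \<in> J" for i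
      using that unfolding normal_density_def by measurable
    have [measurable]: "(\<lambda>\<omega>. W \<omega> r) \<in> borel_measurable Q" using rI by auto
    have "integrable (?\<gamma> \<Otimes>\<^sub>M Q) (\<lambda>(s, \<omega>). ?F s \<omega>)"
    proof (rule P.integrable_const_bound[where B="c * c ^ card J"])
      show "AE x in ?\<gamma> \<Otimes>\<^sub>M Q. norm (case x of (s, \<omega>) \<Rightarrow> ?F s \<omega>) \<le> c * c ^ card J"
        using kernel_le c0 by (auto simp: norm_mult mult_left_mono)
      show "(\<lambda>(s, \<omega>). ?F s \<omega>) \<in> borel_measurable (?\<gamma> \<Otimes>\<^sub>M Q)"
        unfolding sum_a' normal_kernel_def by measurable
    qed
    note int = this
    from borel_measurable_integrable[OF integrable_fst'[OF int]]
    show "(\<lambda>s. ?e s * kernel_char Q W I J h m (a' s)) \<in> borel_measurable ?\<gamma>"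
      by (simp only: integral_mult_right_zero prod.case)
    from int have "(CLINT s|?\<gamma>. CLINT \<omega>|Q. ?F s \<omega>) =
      (CLINT \<omega>|Q. CLINT s|?\<gamma>. ?F s \<omega>)"
      by (rule Fubini_integral[symmetric])
    also have "(CLINT \<omega>|Q. CLINT s|?\<gamma>. ?F s \<omega>) =
       kernel_char Q W I (insert r J) h m a"
    proof (rule Bochner_Integration.integral_cong[OF refl])
      fix \<omega>
      have "?F s \<omega> = (complex_of_real (normal_kernel J h (W \<omega>) m) * iexp (\<Sum>i\<in>I. a i * W \<omega> i)) *
           (complex_of_real c * iexp ((W \<omega> r - m r) / h * s))" for s
        unfolding sum_a' by (simp add: algebra_simps exp_add[symmetric] diff_divide_distrib)
      then have "(CLINT s|?\<gamma>. ?F s \<omega>) =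
         (complex_of_real (normal_kernel J h (W \<omega>) m) * iexp (\<Sum>i\<in>I. a i * W \<omega> i)) *
           (complex_of_real c * (CLINT s|?\<gamma>. iexp ((W \<omega> r - m r) / h * s)))"
        by (simp only: integral_mult_right_zero)
      also have "(complex_of_real c * (CLINT s|?\<gamma>. iexp ((W \<omega> r - m r) / h * s)))
         = complex_of_real (normal_density (W \<omega> r) h (m r))"
        unfolding c_def by (rule complex_normal_density_eq_iexp_integral[OF h, symmetric])
      finally show "(CLINT s|?\<gamma>. ?F s \<omega>) =
          complex_of_real (normal_kernel (insert r J) h (W \<omega>) m) * iexp (\<Sum>i\<in>I. a i * W \<omega> i)"
        using insert by (simp add: normal_kernel_def)
    qed
    finally show "kernel_char Q W I (insert r J) h m a =
     (CLINT s|?\<gamma>. ?e s * kernel_char Q W I J h m (a' s))"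
      by (simp only: integral_mult_right_zero)
  qed
  have bound: "norm (kernel_char Q W I J h m b) \<le> c ^ card J"
    if "prob_space Q" for Q :: "'z measure" and W b
  proof -
    interpret Q: prob_space Q by fact
    have "norm (kernel_char Q W I J h m b)
      \<le> (LINT \<omega>|Q. norm (complex_of_real (normal_kernel J h (W \<omega>) m) * iexp (\<Sum>i\<in>I. b i * W \<omega> i)))"
      by (rule integral_norm_bound)
    also have "\<dots> \<le> (LINT \<omega>|Q. c ^ card J)"
      using kernel_le c0 by (intro integral_mono') (auto simp: norm_mult)
    finally show ?thesis by (simp add: Q.prob_space)
  qed
  have keyV: "kernel_char M (V n) I (insert r J) h m a =
     (CLINT s|?\<gamma>. ?e s * kernel_char M (V n) I J h m (a' s))" for n
    using V by (intro key(1) \<open>prob_space M\<close>)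
  have keyU: "kernel_char P U I (insert r J) h m a =
     (CLINT s|?\<gamma>. ?e s * kernel_char P U I J h m (a' s))"
    using U by (intro key(1) \<open>prob_space P\<close>)
  show ?case
    unfolding keyV keyU
  proof (rule integral_dominated_convergence[where w="\<lambda>_. c * c ^ card J"])
    show "(\<lambda>s. ?e s * kernel_char P U I J h m (a' s)) \<in> borel_measurable ?\<gamma>"
      using U by (intro key(2) \<open>prob_space P\<close>)
    show "(\<lambda>s. ?e s * kernel_char M (V n) I J h m (a' s)) \<in> borel_measurable ?\<gamma>" for n
      using V by (intro key(2) \<open>prob_space M\<close>)
    show "AE s in ?\<gamma>. (\<lambda>n. ?e s * kernel_char M (V n) I J h m (a' s))
       \<longlonglongrightarrow> ?e s * kernel_char P U I J h m (a' s)"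
      using insert.IH[OF rI(2)] by (intro AE_I2 tendsto_intros)
    show "AE s in ?\<gamma>. norm (?e s * kernel_char M (V n) I J h m (a' s)) \<le> c * c ^ card J" for n
      using bound[OF \<open>prob_space M\<close>] c0 by (auto simp: norm_mult mult_left_mono)
  qed simp
qed

text \<open>The bound makes \<open>f\<close> continuous in the product topology, whose Borel sets
  are the product sigma-algebra because the index type is countable. It also makes \<open>f\<close>
  blind to coordinates outside \<open>I\<close>, which gives measurability on the finite product
  used for integration.\<close>

lemma lipschitz_coordinates_imp_borel_measurable:
  fixes f :: "('i::countable \<Rightarrow> real) \<Rightarrow> real"
  assumes "finite I" and lip: "\<And>x y. \<bar>f x - f y\<bar> \<le> L * (\<Sum>i\<in>I. \<bar>x i - y i\<bar>)"
  shows "f \<in> borel_measurable (\<Pi>\<^sub>M i\<in>UNIV. borel)" and "f \<in> borel_measurable (\<Pi>\<^sub>M i\<in>I. lborel)"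
proof -
  have "isCont f x" for x
    unfolding isCont_def
  proof (rule LIM_zero_cancel, rule Lim_null_comparison)
    show "\<forall>\<^sub>F y in at x. norm (f y - f x) \<le> L * (\<Sum>i\<in>I. \<bar>y i - x i\<bar>)"
      using lip by (auto intro!: always_eventually)
    have "((\<lambda>y. y i) \<longlongrightarrow> x i) (at x)" for i
      using continuous_on_product_coordinates[of i] by (auto simp: continuous_on_def)
    then have "((\<lambda>y. L * (\<Sum>i\<in>I. \<bar>y i - x i\<bar>)) \<longlongrightarrow> L * (\<Sum>i\<in>I. \<bar>x i - x i\<bar>)) (at x)"
      by (intro tendsto_intros)
    then show "((\<lambda>y. L * (\<Sum>i\<in>I. \<bar>y i - x i\<bar>)) \<longlongrightarrow> 0) (at x)" by simp
  qed
  then have "f \<in> borel_measurable borel"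
    by (intro borel_measurable_continuous_onI continuous_at_imp_continuous_on) auto
  then show f: "f \<in> borel_measurable (\<Pi>\<^sub>M i\<in>UNIV. borel)"
    using measurable_cong_sets[OF sets_PiM_equal_borel refl] by auto
  have "(\<lambda>m. \<lambda>i\<in>UNIV. if i \<in> I then m i else 0) \<in> (\<Pi>\<^sub>M i\<in>I. lborel) \<rightarrow>\<^sub>M (\<Pi>\<^sub>M i\<in>UNIV. borel :: real measure)"
  proof (rule measurable_restrict)
    show "(\<lambda>m. if i \<in> I then m i else 0) \<in> borel_measurable (\<Pi>\<^sub>M i\<in>I. lborel)" for i :: 'i
      using measurable_component_singleton[of i I "\<lambda>_. lborel :: real measure"] by (cases "i \<in> I") simp_all
  qed
  from measurable_compose[OF this f]
  have "(\<lambda>m. f (\<lambda>i. if i \<in> I then m i else 0)) \<in> borel_measurable (\<Pi>\<^sub>M i\<in>I. lborel)"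
    by (simp only: restrict_UNIV)
  moreover have "f (\<lambda>i. if i \<in> I then m i else 0) = f m" for m
    using lip[of "\<lambda>i. if i \<in> I then m i else 0" m] by simp
  ultimately show "f \<in> borel_measurable (\<Pi>\<^sub>M i\<in>I. lborel)" by simp
qed

section \<open>Smoothing by a product of normal kernels\<close>

lemma has_bochner_integral_normal_kernel:
  assumes "finite I" and "h > 0"
  shows "has_bochner_integral (\<Pi>\<^sub>M i\<in>I. lborel) (normal_kernel I h x) 1"
proof -
  interpret product_sigma_finite "\<lambda>_::'a. lborel :: real measure" ..
  have "integrable (\<Pi>\<^sub>M i\<in>I. lborel) (\<lambda>m. \<Prod>i\<in>I. normal_density (x i) h (m i))"
    using assms by (intro product_integrable_prod integrable_normal_density)
  moreover have "(LINT m|(\<Pi>\<^sub>M i\<in>I. lborel). (\<Prod>i\<in>I. normal_density (x i) h (m i))) = 1"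
    using assms by (subst product_integral_prod) auto
  ultimately show ?thesis
    by (simp add: has_bochner_integral_iff normal_kernel_def[abs_def])
qed

text \<open>The constant is the mean absolute value of a centered normal variable with standard
  deviation \<open>h\<close>; the other coordinates integrate to 1.\<close>

lemma has_bochner_integral_normal_kernel_abs_diff:
  assumes "finite I" and "h > 0" and "j \<in> I"
  shows "has_bochner_integral (\<Pi>\<^sub>M i\<in>I. lborel) (\<lambda>m. normal_kernel I h x m * \<bar>m j - x j\<bar>) (h * sqrt (2 / pi))"
proof -
  interpret product_sigma_finite "\<lambda>_::'a. lborel :: real measure" ..
  define g where "g i y = normal_density (x i) h y * (if i = j then \<bar>y - x j\<bar> else 1)" for i y
  have 1: "has_bochner_integral lborel (g j) (h * sqrt (2 / pi))"
    using normal_moment_abs_odd[OF \<open>h > 0\<close>, of "x j" 0] by (simp add: g_def[abs_def])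
  have 2: "has_bochner_integral lborel (g i) 1" if "i \<noteq> j" for i
    using that assms by (simp add: g_def[abs_def] has_bochner_integral_iff)
  have int: "integrable lborel (g i)" for i
    using 1 2 by (cases "i = j") (auto simp: has_bochner_integral_iff)
  have eq: "normal_kernel I h x m * \<bar>m j - x j\<bar> = (\<Prod>i\<in>I. g i (m i))" for m
    using assms by (simp add: normal_kernel_def g_def prod.distrib prod.delta)
  have "integrable (\<Pi>\<^sub>M i\<in>I. lborel) (\<lambda>m. \<Prod>i\<in>I. g i (m i))"
    using assms int by (intro product_integrable_prod)
  moreover have "(LINT m|(\<Pi>\<^sub>M i\<in>I. lborel). (\<Prod>i\<in>I. g i (m i))) = (\<Prod>i\<in>I. integral\<^sup>L lborel (g i))"
    using assms int by (intro product_integral_prod)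
  moreover have "(\<Prod>i\<in>I. integral\<^sup>L lborel (g i)) = h * sqrt (2 / pi)"
    using 1 2 assms by (simp add: prod.remove[of I j] has_bochner_integral_iff)
  ultimately show ?thesis
    by (simp add: has_bochner_integral_iff eq)
qed

text \<open>The kernel has mass 1, so the error is the average of \<open>f m - f x\<close>, at most
  \<open>L\<close> times the sum of the mean absolute deviations of the coordinates.\<close>

lemma normal_kernel_smoothing_error:
  fixes f :: "('i::countable \<Rightarrow> real) \<Rightarrow> real"
  assumes I: "finite I" and h: "h > 0"
    and lip: "\<And>x y. \<bar>f x - f y\<bar> \<le> L * (\<Sum>i\<in>I. \<bar>x i - y i\<bar>)" and bdd: "\<And>x. \<bar>f x\<bar> \<le> B"
  shows "\<bar>(LINT m|(\<Pi>\<^sub>M i\<in>I. lborel). f m * normal_kernel I h x m) - f x\<bar> \<le> L * (card I * (h * sqrt (2 / pi)))"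
proof -
  note [measurable] = lipschitz_coordinates_imp_borel_measurable[OF I lip]
  note K = has_bochner_integral_normal_kernel[OF I h, of x, THEN has_bochner_integral_iff[THEN iffD1]]
  have D: "has_bochner_integral (\<Pi>\<^sub>M i\<in>I. lborel) (\<lambda>m. L * (\<Sum>j\<in>I. normal_kernel I h x m * \<bar>m j - x j\<bar>))
     (L * (\<Sum>j\<in>I. h * sqrt (2 / pi)))"
    using I h
    by (intro has_bochner_integral_mult_right has_bochner_integral_sum has_bochner_integral_normal_kernel_abs_diff)
  have Kf: "integrable (\<Pi>\<^sub>M i\<in>I. lborel) (\<lambda>m. f m * normal_kernel I h x m)"
  proof (rule Bochner_Integration.integrable_bound)
    show "integrable (\<Pi>\<^sub>M i\<in>I. lborel) (\<lambda>m. B * normal_kernel I h x m)" using K by auto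
    show "AE m in \<Pi>\<^sub>M i\<in>I. lborel. norm (f m * normal_kernel I h x m) \<le> norm (B * normal_kernel I h x m)"
    proof (rule AE_I2)
      fix m show "norm (f m * normal_kernel I h x m) \<le> norm (B * normal_kernel I h x m)"
        using bdd[of m] normal_kernel_nonneg[of I h x m] by (auto simp: abs_mult intro!: mult_right_mono)
    qed
  qed (use K in \<open>auto intro!: borel_measurable_times\<close>)
  have "\<bar>(LINT m|(\<Pi>\<^sub>M i\<in>I. lborel). f m * normal_kernel I h x m) - f x\<bar>
     = \<bar>(LINT m|(\<Pi>\<^sub>M i\<in>I. lborel). f m * normal_kernel I h x m - f x * normal_kernel I h x m)\<bar>"
    using K Kf by (subst Bochner_Integration.integral_diff) auto
  also have "\<dots> \<le> (LINT m|(\<Pi>\<^sub>M i\<in>I. lborel). \<bar>f m * normal_kernel I h x m - f x * normal_kernel I h x m\<bar>)"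
    by (rule integral_abs_bound)
  also have "\<dots> \<le> (LINT m|(\<Pi>\<^sub>M i\<in>I. lborel). L * (\<Sum>j\<in>I. normal_kernel I h x m * \<bar>m j - x j\<bar>))"
  proof (rule integral_mono')
    show "integrable (\<Pi>\<^sub>M i\<in>I. lborel) (\<lambda>m. L * (\<Sum>j\<in>I. normal_kernel I h x m * \<bar>m j - x j\<bar>))"
      using D by (simp only: has_bochner_integral_iff)
    show "0 \<le> L * (\<Sum>j\<in>I. normal_kernel I h x m * \<bar>m j - x j\<bar>)" for m
    proof -
      \<comment> \<open>The sign of \<open>L\<close> is not given, but the product bounds an
        absolute value.\<close>
      have "0 \<le> L * (\<Sum>j\<in>I. \<bar>m j - x j\<bar>)" using lip[of m x] by linarith
      then show ?thesis
        using mult_nonneg_nonneg[OF normal_kernel_nonneg[of I h x m], of "L * (\<Sum>j\<in>I. \<bar>m j - x j\<bar>)"]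
        by (simp add: sum_distrib_left mult_ac)
    qed
    fix m
    have "\<bar>f m * normal_kernel I h x m - f x * normal_kernel I h x m\<bar> = \<bar>f m - f x\<bar> * normal_kernel I h x m"
      using normal_kernel_nonneg[of I h x m] by (simp add: abs_mult flip: left_diff_distrib)
    also have "\<dots> \<le> L * (\<Sum>j\<in>I. \<bar>m j - x j\<bar>) * normal_kernel I h x m"
      using lip normal_kernel_nonneg by (intro mult_right_mono)
    finally show "\<bar>f m * normal_kernel I h x m - f x * normal_kernel I h x m\<bar> \<le> L * (\<Sum>j\<in>I. normal_kernel I h x m * \<bar>m j - x j\<bar>)"
      by (simp add: sum_distrib_left mult_ac)
  qed
  also have "\<dots> = L * (card I * (h * sqrt (2 / pi)))"
    using D by (simp add: has_bochner_integral_iff)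
  finally show ?thesis .
qed

text \<open>The density of \<open>W\<close> plus independent normal noise of standard deviation
  \<open>h\<close> in each coordinate.\<close>

definition smoothed_density :: "'i set \<Rightarrow> real \<Rightarrow> 'a measure \<Rightarrow> ('a \<Rightarrow> 'i \<Rightarrow> real) \<Rightarrow> ('i \<Rightarrow> real) \<Rightarrow> real" where
  "smoothed_density I h M W m = (LINT \<omega>|M. normal_kernel I h (W \<omega>) m)"

text \<open>For fixed \<open>h\<close> the smoothed densities converge in mean, so the smoothed
  expectations of the bounded \<open>f\<close> converge. Smoothing costs at most
  \<open>C * h\<close>, uniformly in \<open>n\<close>, and \<open>h\<close> is arbitrary.\<close>

theorem char_convergence_imp_lipschitz_convergence:
  fixes V :: "nat \<Rightarrow> 'a \<Rightarrow> 'i::countable \<Rightarrow> real" and U :: "'b \<Rightarrow> 'i \<Rightarrow> real"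
  assumes "prob_space M" and "prob_space P" and I: "finite I"
    and V: "\<And>n i. (\<lambda>\<omega>. V n \<omega> i) \<in> borel_measurable M"
    and U: "\<And>i. (\<lambda>\<omega>. U \<omega> i) \<in> borel_measurable P"
    and char: "\<And>a. (\<lambda>n. CLINT \<omega>|M. iexp (\<Sum>i\<in>I. a i * V n \<omega> i))
                 \<longlonglongrightarrow> (CLINT \<omega>|P. iexp (\<Sum>i\<in>I. a i * U \<omega> i))"
    and lip: "\<And>x y. \<bar>f x - f y\<bar> \<le> L * (\<Sum>i\<in>I. \<bar>x i - y i\<bar>)" and bdd: "\<And>x. \<bar>f x\<bar> \<le> B"
  shows "(\<lambda>n. LINT \<omega>|M. f (V n \<omega>)) \<longlonglongrightarrow> (LINT \<omega>|P. f (U \<omega>))"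
proof -
  note [measurable] = V U
  interpret M: prob_space M by fact
  interpret PP: prob_space P by fact
  interpret product_sigma_finite "\<lambda>_::'i. lborel :: real measure" ..
  let ?X = "\<Pi>\<^sub>M i\<in>I. (lborel :: real measure)"
  interpret X: sigma_finite_measure ?X
    using I by (rule sigma_finite)
  note f[measurable] = lipschitz_coordinates_imp_borel_measurable[OF I lip]
  have B: "0 \<le> B" using bdd[of undefined] by linarith
  have fW[measurable]: "(\<lambda>\<omega>. f (W \<omega>)) \<in> borel_measurable Q" if "\<And>i. (\<lambda>\<omega>. W \<omega> i) \<in> borel_measurable Q" for W and Q :: "'z measure"
  proof -
    have "(\<lambda>\<omega>. \<lambda>i\<in>UNIV. W \<omega> i) \<in> Q \<rightarrow>\<^sub>M (\<Pi>\<^sub>M i\<in>UNIV. borel)"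
      using that by (intro measurable_restrict)
    from measurable_compose[OF this f(1)] show ?thesis by simp
  qed
  have fint: "integrable Q (\<lambda>\<omega>. f (W \<omega>))" if "\<And>i. (\<lambda>\<omega>. W \<omega> i) \<in> borel_measurable Q" "prob_space Q" for W and Q :: "'z measure"
  proof -
    interpret Q: prob_space Q by fact
    show ?thesis by (rule Q.integrable_const_bound[where B=B]) (use bdd fW[OF that(1)] in auto)
  qed
  have joint: "(\<lambda>(\<omega>, m). normal_kernel I h (W \<omega>) m) \<in> borel_measurable (Q \<Otimes>\<^sub>M ?X)"
    if [measurable]: "\<And>i. (\<lambda>\<omega>. W \<omega> i) \<in> borel_measurable Q" for W h and Q :: "'z measure"
    unfolding normal_kernel_def normal_density_def by measurable
  have jint: "integrable (Q \<Otimes>\<^sub>M ?X) (\<lambda>(\<omega>, m). normal_kernel I h (W \<omega>) m)"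
    if W: "\<And>i. (\<lambda>\<omega>. W \<omega> i) \<in> borel_measurable Q" and "prob_space Q" and h: "h > 0" for W h and Q :: "'z measure"
  proof -
    interpret Q: prob_space Q by fact
    interpret QX: pair_sigma_finite Q ?X ..
    show ?thesis
    proof (rule QX.Fubini_integrable[OF joint[OF W]], goal_cases)
      case 1
      then show ?case using has_bochner_integral_normal_kernel[OF I h]
        by (simp add: has_bochner_integral_iff normal_kernel_nonneg)
    next
      case 2
      then show ?case using has_bochner_integral_normal_kernel[OF I h]
        by (simp add: has_bochner_integral_iff)
    qed
  qed
  have p: "integrable ?X (smoothed_density I h Q W)" "integral\<^sup>L ?X (smoothed_density I h Q W) = 1"
       "(LINT m|?X. f m * smoothed_density I h Q W m) = (LINT \<omega>|Q. LINT m|?X. f m * normal_kernel I h (W \<omega>) m)"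
       "integrable Q (\<lambda>\<omega>. LINT m|?X. f m * normal_kernel I h (W \<omega>) m)"
    if W: "\<And>i. (\<lambda>\<omega>. W \<omega> i) \<in> borel_measurable Q" and "prob_space Q" and h: "h > 0" for W h and Q :: "'z measure"
  proof -
    interpret Q: prob_space Q by fact
    interpret QX: pair_sigma_finite Q ?X ..
    note j = jint[OF that]
    show "integrable ?X (smoothed_density I h Q W)"
      using QX.integrable_snd[OF j] by (simp add: smoothed_density_def[abs_def])
    have "integral\<^sup>L ?X (smoothed_density I h Q W) = (LINT \<omega>|Q. LINT m|?X. normal_kernel I h (W \<omega>) m)"
      using QX.Fubini_integral[OF j] by (simp add: smoothed_density_def[abs_def])
    also have "\<dots> = 1"
      using has_bochner_integral_normal_kernel[OF I h]
      by (simp add: has_bochner_integral_iff Q.prob_space)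
    finally show "integral\<^sup>L ?X (smoothed_density I h Q W) = 1" .
    have j2: "integrable (Q \<Otimes>\<^sub>M ?X) (\<lambda>(\<omega>, m). f m * normal_kernel I h (W \<omega>) m)"
    proof (rule Bochner_Integration.integrable_bound)
      show "integrable (Q \<Otimes>\<^sub>M ?X) (\<lambda>x. B * (case x of (\<omega>, m) \<Rightarrow> normal_kernel I h (W \<omega>) m))"
        using j by simp
      show "(\<lambda>(\<omega>, m). f m * normal_kernel I h (W \<omega>) m) \<in> borel_measurable (Q \<Otimes>\<^sub>M ?X)"
        using joint[OF W, measurable] by measurable
      show "AE x in Q \<Otimes>\<^sub>M ?X. norm (case x of (\<omega>, m) \<Rightarrow> f m * normal_kernel I h (W \<omega>) m)
          \<le> norm (B * (case x of (\<omega>, m) \<Rightarrow> normal_kernel I h (W \<omega>) m))"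
        using bdd B by (intro AE_I2) (auto simp: abs_mult split_beta intro!: mult_right_mono)
    qed
    show "(LINT m|?X. f m * smoothed_density I h Q W m) = (LINT \<omega>|Q. LINT m|?X. f m * normal_kernel I h (W \<omega>) m)"
      using QX.Fubini_integral[OF j2] by (simp add: smoothed_density_def)
    show "integrable Q (\<lambda>\<omega>. LINT m|?X. f m * normal_kernel I h (W \<omega>) m)"
      using QX.integrable_fst'[OF j2] by simp
  qed
  have smooth: "(\<lambda>n. LINT m|?X. f m * smoothed_density I h M (V n) m) \<longlonglongrightarrow> (LINT m|?X. f m * smoothed_density I h P U m)" if h: "h > 0" for h
  proof -
    note pV = p[of "V n" M for n, OF V \<open>prob_space M\<close> h] and pU = p[of U P, OF U \<open>prob_space P\<close> h]
    let ?p = "\<lambda>n. smoothed_density I h M (V n)" and ?q = "smoothed_density I h P U"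
    have conv: "(\<lambda>n. ?p n m) \<longlonglongrightarrow> ?q m" for m
    proof -
      have "(\<lambda>n. kernel_char M (V n) I I h m (\<lambda>_. 0))
         \<longlonglongrightarrow> kernel_char P U I I h m (\<lambda>_. 0)"
        using assms h by (intro char_convergence_imp_mixed_convergence[where a="\<lambda>_. 0"]) auto
      then have "(\<lambda>n. complex_of_real (?p n m)) \<longlonglongrightarrow> complex_of_real (?q m)"
        by (simp add: smoothed_density_def)
      then show ?thesis by (simp only: tendsto_of_real_iff)
    qed
    have nnM: "0 \<le> smoothed_density I h M W m" for W m unfolding smoothed_density_def by (intro Bochner_Integration.integral_nonneg normal_kernel_nonneg)
    have nnP: "0 \<le> smoothed_density I h P W m" for W m unfolding smoothed_density_def by (intro Bochner_Integration.integral_nonneg normal_kernel_nonneg)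
    have nnoneM: "(\<integral>\<^sup>+ m. norm (?p n m) \<partial>?X) = 1" for n
      using nn_integral_eq_integral[OF integrable_norm[OF pV(1)[of n]]] pV(2)[of n] nnM[of "V n"] by simp
    have nnoneP: "(\<integral>\<^sup>+ m. norm (?q m) \<partial>?X) = 1"
      using nn_integral_eq_integral[OF integrable_norm[OF pU(1)]] pU(2) nnP[of U] by simp
    \<comment> \<open>All these densities have integral 1, so pointwise convergence improves to
      convergence in mean.\<close>
    have "(\<lambda>n. \<integral>\<^sup>+ m. norm (?p n m - ?q m) \<partial>?X) \<longlonglongrightarrow> 0"
      proof (rule Scheffe_lemma2)
      show "?p n \<in> borel_measurable ?X" for n
        using pV(1)[of n] by (rule borel_measurable_integrable)
      show "integrable ?X (?q)" by (rule pU(1))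
      show "AE m in ?X. (\<lambda>n. ?p n m) \<longlonglongrightarrow> ?q m"
        by (rule AE_I2) (rule conv)
      show "(\<integral>\<^sup>+ m. norm (?p n m) \<partial>?X) \<le> (\<integral>\<^sup>+ m. norm (?q m) \<partial>?X)" for n
        unfolding nnoneM nnoneP by (rule order_refl)
    qed
    moreover have "(\<integral>\<^sup>+ m. norm (?p n m - ?q m) \<partial>?X) = ennreal (LINT m|?X. norm (?p n m - ?q m))" for n
      using pV(1) pU(1) by (intro nn_integral_eq_integral integrable_norm Bochner_Integration.integrable_diff AE_I2 norm_ge_zero)
    ultimately have L1: "(\<lambda>n. LINT m|?X. norm (?p n m - ?q m)) \<longlonglongrightarrow> 0"
      by (simp add: tendsto_ennreal_iff flip: ennreal_0)
    have fp: "integrable ?X (\<lambda>m. f m * q m)" if q: "integrable ?X q" for q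
    proof (rule Bochner_Integration.integrable_bound)
      show "integrable ?X (\<lambda>m. B * q m)" using q by (rule integrable_mult_right)
      show "(\<lambda>m. f m * q m) \<in> borel_measurable ?X"
        using f(2) borel_measurable_integrable[OF q] by (rule borel_measurable_times)
      show "AE m in ?X. norm (f m * q m) \<le> norm (B * q m)"
      proof (rule AE_I2)
        fix m show "norm (f m * q m) \<le> norm (B * q m)"
          unfolding norm_mult using bdd[of m] B by (intro mult_right_mono) simp_all
      qed
    qed
    show ?thesis
    proof (rule LIM_zero_cancel, rule Lim_null_comparison)
      show "\<forall>\<^sub>F n in sequentially. norm ((LINT m|?X. f m * ?p n m) - (LINT m|?X. f m * ?q m))
          \<le> B * (LINT m|?X. norm (?p n m - ?q m))"
      proof (intro always_eventually allI)
        fix n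
        have "norm ((LINT m|?X. f m * ?p n m) - (LINT m|?X. f m * ?q m))
          = norm (LINT m|?X. f m * (?p n m - ?q m))"
          using fp[OF pU(1)] fp[OF pV(1)[of n]] by (simp only: right_diff_distrib Bochner_Integration.integral_diff)
        also have "\<dots> \<le> (LINT m|?X. norm (f m * (?p n m - ?q m)))"
          by (rule integral_norm_bound)
        also have "\<dots> \<le> (LINT m|?X. B * norm (?p n m - ?q m))"
          proof (rule integral_mono')
          show "integrable ?X (\<lambda>m. B * norm (?p n m - ?q m))"
            using pU(1) pV(1)[of n]
            by (intro integrable_mult_right integrable_norm Bochner_Integration.integrable_diff)
          show "0 \<le> B * norm (?p n m - ?q m)" for m
            using B by simp
          show "norm (f m * (?p n m - ?q m))
            \<le> B * norm (?p n m - ?q m)" for m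
            unfolding norm_mult using bdd[of m] by (intro mult_right_mono) simp_all
        qed
        finally show "norm ((LINT m|?X. f m * ?p n m) - (LINT m|?X. f m * ?q m))
          \<le> B * (LINT m|?X. norm (?p n m - ?q m))" by simp
      qed
      show "(\<lambda>n. B * (LINT m|?X. norm (?p n m - ?q m))) \<longlonglongrightarrow> 0"
        using tendsto_mult_right_zero[OF L1] by simp
    qed
  qed
  \<comment> \<open>The summand 1 keeps \<open>C\<close> positive when \<open>I\<close> is empty or
    \<open>L\<close> is 0, so that \<open>h = r / (4 * C)\<close> is positive.\<close>
  define C where "C = \<bar>L\<bar> * (card I * sqrt (2 / pi)) + 1"
  have C: "C > 0" by (simp add: C_def add_nonneg_pos)
  have err: "\<bar>(LINT m|?X. f m * smoothed_density I h Q W m) - (LINT \<omega>|Q. f (W \<omega>))\<bar> \<le> C * h"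
    if W: "\<And>i. (\<lambda>\<omega>. W \<omega> i) \<in> borel_measurable Q" and "prob_space Q" and h: "h > 0" for W h and Q :: "'z measure"
  proof -
    interpret Q: prob_space Q by fact
    note pp = p[OF that]
    note fi = fint[OF that(1,2)]
    have "\<bar>(LINT m|?X. f m * smoothed_density I h Q W m) - (LINT \<omega>|Q. f (W \<omega>))\<bar>
      = \<bar>LINT \<omega>|Q. (LINT m|?X. f m * normal_kernel I h (W \<omega>) m) - f (W \<omega>)\<bar>"
      by (simp only: pp(3) Bochner_Integration.integral_diff[OF pp(4) fi])
    also have "\<dots> \<le> (LINT \<omega>|Q. \<bar>(LINT m|?X. f m * normal_kernel I h (W \<omega>) m) - f (W \<omega>)\<bar>)"
      by (rule integral_abs_bound)
    also have "\<dots> \<le> (LINT \<omega>|Q. C * h)"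
    proof (rule integral_mono')
      fix \<omega>
      have "\<bar>(LINT m|?X. f m * normal_kernel I h (W \<omega>) m) - f (W \<omega>)\<bar> \<le> L * (card I * (h * sqrt (2 / pi)))"
        using I h lip bdd by (rule normal_kernel_smoothing_error)
      also have "\<dots> \<le> \<bar>L\<bar> * (card I * (h * sqrt (2 / pi)))"
        using h by (intro mult_right_mono) auto
      also have "\<dots> \<le> C * h" using h by (simp add: C_def algebra_simps)
      finally show "\<bar>(LINT m|?X. f m * normal_kernel I h (W \<omega>) m) - f (W \<omega>)\<bar> \<le> C * h" .
    qed (use C h in auto)
    finally show ?thesis by (simp add: Q.prob_space)
  qed
  show ?thesis
  proof (rule LIMSEQ_I)
    fix r :: real assume r: "0 < r"
    define h where "h = r / (4 * C)"
    have h: "h > 0" "C * h = r / 4" using r C by (auto simp: h_def)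
    obtain n0 where n0: "\<And>n. n \<ge> n0 \<Longrightarrow> \<bar>(LINT m|?X. f m * smoothed_density I h M (V n) m) - (LINT m|?X. f m * smoothed_density I h P U m)\<bar> < r / 2"
      using LIMSEQ_D[OF smooth[OF h(1)], of "r / 2"] r by auto
    show "\<exists>no. \<forall>n\<ge>no. norm ((LINT \<omega>|M. f (V n \<omega>)) - (LINT \<omega>|P. f (U \<omega>))) < r"
    proof (intro exI allI impI)
      fix n assume "n0 \<le> n"
      from n0[OF this] err[of "V n" M, OF V \<open>prob_space M\<close> h(1)] err[of U P, OF U \<open>prob_space P\<close> h(1)]
      show "norm ((LINT \<omega>|M. f (V n \<omega>)) - (LINT \<omega>|P. f (U \<omega>))) < r"
        unfolding h(2) real_norm_def by linarith
    qed
  qed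
qed

section \<open>A maximal inequality\<close>

text \<open>The central limit theorem, restated so as to include variance 0, where all the sums
  vanish almost surely.\<close>

lemma (in prob_space) iid_char_convergence:
  fixes \<zeta> :: "nat \<Rightarrow> 'a \<Rightarrow> real"
  assumes indep: "indep_vars (\<lambda>_. borel) \<zeta> UNIV"
    and mean: "\<And>n. expectation (\<zeta> n) = 0"
    and sq: "\<And>n. integrable M (\<lambda>\<omega>. (\<zeta> n \<omega>)\<^sup>2)"
    and distrib: "\<And>n. distr M borel (\<zeta> n) = \<mu>"
  shows "(\<lambda>n. CLINT \<omega>|M. iexp ((\<Sum>i<n. \<zeta> i \<omega>) / sqrt n))
           \<longlonglongrightarrow> complex_of_real (exp (- (LINT x|\<mu>. x\<^sup>2) / 2))"
proof -
  have [measurable]: "random_variable borel (\<zeta> n)" for n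
    using indep by (simp add: indep_vars_def2)
  have var: "expectation (\<lambda>\<omega>. (\<zeta> n \<omega>)\<^sup>2) = (LINT x|\<mu>. x\<^sup>2)" for n
    unfolding distrib[of n, symmetric] by (simp add: integral_distr)
  define Q where "Q = (LINT x|\<mu>. x\<^sup>2)"
  have "Q \<ge> 0" unfolding Q_def by simp
  then consider "Q = 0" | "Q > 0" by linarith
  then show ?thesis
  proof cases
    case 1
    have "AE \<omega> in M. (\<zeta> n \<omega>)\<^sup>2 = 0" for n
      using integral_nonneg_eq_0_iff_AE[OF sq[of n]] var[of n] 1 by (simp add: Q_def)
    then have "AE \<omega> in M. \<forall>n. (\<zeta> n \<omega>)\<^sup>2 = 0" by (simp add: AE_all_countable)
    then have "AE \<omega> in M. iexp ((\<Sum>i<n. \<zeta> i \<omega>) / sqrt n) = 1" for n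
      by eventually_elim simp
    then have "(CLINT \<omega>|M. iexp ((\<Sum>i<n. \<zeta> i \<omega>) / sqrt n)) = (CLINT \<omega>|M. 1)" for n
      by (intro integral_cong_AE) auto
    then show ?thesis using 1 by (simp add: Q_def prob_space)
  next
    case 2
    define \<sigma> where "\<sigma> = sqrt Q"
    have \<sigma>: "\<sigma> > 0" "\<sigma>\<^sup>2 = Q" using 2 by (auto simp: \<sigma>_def)
    have "weak_conv_m (\<lambda>n. distr M borel (\<lambda>\<omega>. (\<Sum>i<n. \<zeta> i \<omega>) / sqrt (n * \<sigma>\<^sup>2))) std_normal_distribution"
      using \<sigma> var by (intro central_limit_theorem_zero_mean[OF indep mean \<sigma>(1) sq _ distrib])
        (simp add: mean Q_def)
    then have "(\<lambda>n. char (distr M borel (\<lambda>\<omega>. (\<Sum>i<n. \<zeta> i \<omega>) / sqrt (n * \<sigma>\<^sup>2))) \<sigma>)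
        \<longlonglongrightarrow> char std_normal_distribution \<sigma>"
      by (rule levy_continuity1[rotated 2]) (auto intro!: real_dist_normal_dist)
    moreover have "char (distr M borel (\<lambda>\<omega>. (\<Sum>i<n. \<zeta> i \<omega>) / sqrt (n * \<sigma>\<^sup>2))) \<sigma> =
        (CLINT \<omega>|M. iexp ((\<Sum>i<n. \<zeta> i \<omega>) / sqrt n))" for n
    proof -
      \<comment> \<open>Evaluating the characteristic function at \<sigma> cancels the standard
        deviation in the normalization of the central limit theorem.\<close>
      have "\<sigma> * (s / sqrt (n * \<sigma>\<^sup>2)) = s / sqrt n" for s
        using \<sigma>(1) by (simp add: real_sqrt_mult)
      moreover have "char (distr M borel (\<lambda>\<omega>. (\<Sum>i<n. \<zeta> i \<omega>) / sqrt (n * \<sigma>\<^sup>2))) \<sigma> =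
          (CLINT \<omega>|M. iexp (\<sigma> * ((\<Sum>i<n. \<zeta> i \<omega>) / sqrt (n * \<sigma>\<^sup>2))))"
        unfolding char_def by (subst integral_distr) simp_all
      ultimately show ?thesis by (simp only:)
    qed
    ultimately show ?thesis
      using \<sigma> by (simp add: char_std_normal_distribution Q_def)
  qed
qed

text \<open>The convex function \<open>x\<^sup>2 / 2 - 1 + cos x\<close> is quartic near 0, and its expectation
  is determined by a variance and a characteristic function. With it the Doob inequality
  bounds the oscillation on a small interval by the square of the variance, so the bounds can be
  summed over a partition although only second moments are available.\<close>

definition cosine_gauge :: "real \<Rightarrow> real" where
  "cosine_gauge x = x\<^sup>2 / 2 - 1 + cos x"

text \<open>The second derivative \<open>1 - cos x\<close> is nonnegative. The tangent at the first
  passage value takes the place of the conditional Jensen inequality in Doob's argument.\<close>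

lemma cosine_gauge_tangent: "cosine_gauge x \<ge> cosine_gauge a + (a - sin a) * (x - a)"
proof -
  have "convex_on UNIV cosine_gauge"
  proof (rule f''_ge0_imp_convex)
    show "DERIV cosine_gauge x :> x - sin x" for x
      unfolding cosine_gauge_def[abs_def] by (auto intro!: derivative_eq_intros)
    show "DERIV (\<lambda>x. x - sin x) x :> 1 - cos x" for x :: real
      by (auto intro!: derivative_eq_intros)
  qed auto
  moreover have "(cosine_gauge has_field_derivative (a - sin a)) (at a within UNIV)"
    unfolding cosine_gauge_def[abs_def] by (auto intro!: derivative_eq_intros)
  ultimately have "cosine_gauge x - cosine_gauge a \<ge> (a - sin a) * (x - a)"
    by (intro convex_on_imp_above_tangent) auto
  then show ?thesis by simp
qed

lemma cosine_gauge_nonneg: "0 \<le> cosine_gauge x"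
  using cosine_gauge_tangent[of 0 x] by (simp add: cosine_gauge_def)

lemma cosine_gauge_le: "cosine_gauge x \<le> x\<^sup>2 / 2"
  by (simp add: cosine_gauge_def)

lemma cosine_gauge_mono:
  assumes "0 \<le> e" "e \<le> \<bar>x\<bar>"
  shows "cosine_gauge e \<le> cosine_gauge x"
proof -
  have "0 \<le> (e - sin e) * (\<bar>x\<bar> - e)"
    using assms by (intro mult_nonneg_nonneg) (auto simp: sin_x_le_x)
  then have "cosine_gauge e \<le> cosine_gauge \<bar>x\<bar>"
    using cosine_gauge_tangent[of e "\<bar>x\<bar>"] by linarith
  then show ?thesis by (simp add: cosine_gauge_def)
qed

text \<open>On \<open>(0, 1]\<close> the cosine is below 1; two applications of the mean value
  theorem carry this to \<open>sin z < z\<close> and then to the gauge. Larger arguments follow by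
  monotonicity.\<close>

lemma cosine_gauge_pos:
  assumes "0 < e"
  shows "0 < cosine_gauge e"
proof -
  define d where "d = min e 1"
  have d: "0 < d" "d \<le> 1" "d \<le> e" using assms by (auto simp: d_def)
  have *: "sin z < z" if "0 < z" "z \<le> 1" for z :: real
  proof -
    have "\<exists>w>0. w < z \<and> (z - sin z) - (0 - sin 0) = (z - 0) * (1 - cos w)"
      using that by (intro MVT2) (auto intro!: derivative_eq_intros)
    then obtain w where w: "0 < w" "w < z" "(z - sin z) - (0 - sin 0) = (z - 0) * (1 - cos w)" by blast
    have "cos w < cos 0" using w that pi_gt3 by (intro cos_monotone_0_pi) auto
    then have "0 < z * (1 - cos w)" using that by simp
    then show ?thesis using w by simp
  qed
  have "\<exists>z>0. z < d \<and> cosine_gauge d - cosine_gauge 0 = (d - 0) * (z - sin z)"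
    using d unfolding cosine_gauge_def[abs_def] by (intro MVT2) (auto intro!: derivative_eq_intros)
  then obtain z where z: "0 < z" "z < d" "cosine_gauge d - cosine_gauge 0 = (d - 0) * (z - sin z)" by blast
  have "0 < d * (z - sin z)" using d *[of z] z by simp
  then have "0 < cosine_gauge d" using z by (simp add: cosine_gauge_def)
  then show ?thesis using cosine_gauge_mono[of d e] d by linarith
qed

lemma measurable_cosine_gauge[measurable]: "cosine_gauge \<in> borel_measurable borel"
  unfolding cosine_gauge_def[abs_def] by measurable

text \<open>A pair is a position and a mark. The interval is open on the left, so that adjacent
  strips add up without overlap.\<close>

definition strip :: "real \<Rightarrow> real \<Rightarrow> real \<times> real \<Rightarrow> real" where
  "strip a b p = (if a < fst p \<and> fst p \<le> b then snd p else 0)"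

lemma measurable_strip[measurable]: "strip a b \<in> borel_measurable borel"
  unfolding strip_def[abs_def] borel_prod[symmetric] by measurable

section \<open>Sums of independent marks over a strip of positions, and their Doob
  inequality\<close>

lemma (in prob_space) integrable_square_sum:
  fixes D :: "'i \<Rightarrow> 'a \<Rightarrow> real"
  assumes "finite I" and [measurable]: "\<And>i. i \<in> I \<Longrightarrow> D i \<in> borel_measurable M"
    and "\<And>i. i \<in> I \<Longrightarrow> integrable M (\<lambda>\<omega>. (D i \<omega>)\<^sup>2)"
  shows "integrable M (\<lambda>\<omega>. (\<Sum>i\<in>I. D i \<omega>)\<^sup>2)"
  using assms
proof (induction I rule: finite_induct)
  case (insert i I)
  show ?case
  proof (rule Bochner_Integration.integrable_bound)
    show "integrable M (\<lambda>\<omega>. 2 * (D i \<omega>)\<^sup>2 + 2 * (\<Sum>i\<in>I. D i \<omega>)\<^sup>2)"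
      using insert by auto
    show "(\<lambda>\<omega>. (\<Sum>i\<in>insert i I. D i \<omega>)\<^sup>2) \<in> borel_measurable M"
      using insert by (intro borel_measurable_power borel_measurable_sum) auto
    have "(a + b)\<^sup>2 \<le> 2 * a\<^sup>2 + 2 * b\<^sup>2" for a b :: real
      using sum_squares_bound[of a b] by (simp add: power2_sum)
    then show "AE \<omega> in M. norm ((\<Sum>i\<in>insert i I. D i \<omega>)\<^sup>2) \<le> norm (2 * (D i \<omega>)\<^sup>2 + 2 * (\<Sum>i\<in>I. D i \<omega>)\<^sup>2)"
      using insert(1,2) by simp
  qed
qed simp

lemma borel_measurable_fst[measurable]: "(fst :: 'a::second_countable_topology \<times> 'b::second_countable_topology \<Rightarrow> 'a) \<in> borel_measurable borel"
  by (intro borel_measurable_continuous_onI continuous_on_fst continuous_on_id)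

lemma borel_measurable_snd[measurable]: "(snd :: 'a::second_countable_topology \<times> 'b::second_countable_topology \<Rightarrow> 'b) \<in> borel_measurable borel"
  by (intro borel_measurable_continuous_onI continuous_on_snd continuous_on_id)

text \<open>The condition \<open>zero\<close> says that the mark has conditional mean 0 given the
  position, tested on half-lines only.\<close>

locale strip_sums = prob_space +
  fixes I :: "'i set" and p :: "'i \<Rightarrow> 'a \<Rightarrow> real \<times> real"
  assumes fin: "finite I"
    and indep: "indep_vars (\<lambda>_. borel) p I"
    and sq: "\<And>i. i \<in> I \<Longrightarrow> integrable M (\<lambda>\<omega>. (snd (p i \<omega>))\<^sup>2)"
    and zero: "\<And>i s. i \<in> I \<Longrightarrow> expectation (\<lambda>\<omega>. if fst (p i \<omega>) \<le> s then snd (p i \<omega>) else 0) = 0"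
begin

lemma rv[measurable]: "i \<in> I \<Longrightarrow> random_variable borel (p i)"
  using indep by (simp add: indep_vars_def2)

lemma rv_snd[measurable]: "i \<in> I \<Longrightarrow> random_variable borel (\<lambda>\<omega>. snd (p i \<omega>))"
  by (rule measurable_compose[OF rv borel_measurable_snd])

lemma rv_strip[measurable]: "i \<in> I \<Longrightarrow> random_variable borel (\<lambda>\<omega>. strip a b (p i \<omega>))"
  by (rule measurable_compose[OF rv measurable_strip])

lemma int_snd: "i \<in> I \<Longrightarrow> integrable M (\<lambda>\<omega>. snd (p i \<omega>))"
  by (rule square_integrable_imp_integrable[OF rv_snd sq])

lemma int_strip: "i \<in> I \<Longrightarrow> integrable M (\<lambda>\<omega>. strip a b (p i \<omega>))"
  by (rule Bochner_Integration.integrable_bound[OF int_snd rv_strip]) (auto simp: strip_def)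

lemma sq_strip: "i \<in> I \<Longrightarrow> integrable M (\<lambda>\<omega>. (strip a b (p i \<omega>))\<^sup>2)"
  by (rule Bochner_Integration.integrable_bound[OF sq]) (auto simp: strip_def)

lemma exp_strip:
  assumes "i \<in> I" "a \<le> b"
  shows "expectation (\<lambda>\<omega>. strip a b (p i \<omega>)) = 0"
proof -
  have int: "integrable M (\<lambda>\<omega>. if fst (p i \<omega>) \<le> s then snd (p i \<omega>) else 0)" for s
    using assms by (intro Bochner_Integration.integrable_bound[OF int_snd[OF assms(1)]]) auto
  have "strip a b (p i \<omega>) = (if fst (p i \<omega>) \<le> b then snd (p i \<omega>) else 0) - (if fst (p i \<omega>) \<le> a then snd (p i \<omega>) else 0)" for \<omega>
    using assms by (auto simp: strip_def)
  then show ?thesis using int zero assms by simp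
qed

definition strip_sum :: "'i set \<Rightarrow> real \<Rightarrow> real \<Rightarrow> ('i \<Rightarrow> real \<times> real) \<Rightarrow> real" where
  "strip_sum J a b q = (\<Sum>i\<in>J. strip a b (q i))"

lemma measurable_strip_sum[measurable]:
  "strip_sum J a b \<in> borel_measurable (\<Pi>\<^sub>M i\<in>J. borel)"
  unfolding strip_sum_def[abs_def] by measurable

text \<open>The derivative of \<open>cosine_gauge\<close> at the running sum, kept only if
  \<open>j\<close> is the first index at which that sum reaches level \<open>e\<close>. The index
  set is a parameter so that one summand can be removed.\<close>

definition first_passage_slope :: "(nat \<Rightarrow> real) \<Rightarrow> real \<Rightarrow> 'i set \<Rightarrow> nat \<Rightarrow> ('i \<Rightarrow> real \<times> real) \<Rightarrow> real" where
  "first_passage_slope t e J j q =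
     (if e \<le> \<bar>strip_sum J (t 0) (t j) q\<bar> \<and> (\<forall>r<j. \<bar>strip_sum J (t 0) (t r) q\<bar> < e)
      then strip_sum J (t 0) (t j) q - sin (strip_sum J (t 0) (t j) q) else 0)"

lemma measurable_first_passage_slope[measurable]:
  "first_passage_slope t e J j \<in> borel_measurable (\<Pi>\<^sub>M i\<in>J. borel)"
  unfolding first_passage_slope_def[abs_def] by measurable

lemma first_passage_slope_le: "\<bar>first_passage_slope t e J j q\<bar> \<le> 2 * (\<Sum>i\<in>J. \<bar>snd (q i)\<bar>)"
proof -
  have "\<bar>strip_sum J (t 0) (t j) q\<bar> \<le> (\<Sum>i\<in>J. \<bar>snd (q i)\<bar>)"
    unfolding strip_sum_def by (rule order_trans[OF sum_abs sum_mono]) (simp add: strip_def)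
  then have "\<bar>strip_sum J (t 0) (t j) q - sin (strip_sum J (t 0) (t j) q)\<bar> \<le> 2 * (\<Sum>i\<in>J. \<bar>snd (q i)\<bar>)"
    using abs_sin_x_le_abs_x[of "strip_sum J (t 0) (t j) q"] by linarith
  then show ?thesis
    unfolding first_passage_slope_def by (auto intro: sum_nonneg)
qed

text \<open>If the \<open>i\<close>-th mark enters after \<open>t j\<close>, it has not contributed
  to the sums up to \<open>t j\<close>, so the slope may be computed without index \<open>i\<close>.
  It is then independent of the increment, whose mean is 0.\<close>

lemma martingale_step:
  assumes t: "mono t" and "j \<le> m" and i: "i \<in> I"
  shows "expectation (\<lambda>\<omega>. first_passage_slope t e I j (\<lambda>i. p i \<omega>) * strip (t j) (t m) (p i \<omega>)) = 0"
    and "integrable M (\<lambda>\<omega>. first_passage_slope t e I j (\<lambda>i. p i \<omega>) * strip (t j) (t m) (p i \<omega>))"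
proof -
  let ?J = "I - {i}"
  let ?H = "\<lambda>\<omega>. first_passage_slope t e ?J j (\<lambda>i. p i \<omega>)"
  let ?D = "\<lambda>\<omega>. strip (t j) (t m) (p i \<omega>)"
  \<comment> \<open>A position beyond \<open>t j\<close> makes the \<open>i\<close>-th summand 0 in
    every sum up to index \<open>j\<close>.\<close>
  have "strip_sum I (t 0) (t r) q = strip_sum ?J (t 0) (t r) q"
    if "fst (q i) > t j" "r \<le> j" for q r
    using fin i that monoD[OF t, of r j] by (simp add: strip_sum_def sum.remove[of I i] strip_def)
  then have eq: "first_passage_slope t e I j (\<lambda>i. p i \<omega>) * ?D \<omega> = ?H \<omega> * ?D \<omega>" for \<omega>
    by (auto simp: first_passage_slope_def strip_def)
  have restrict_eq: "first_passage_slope t e ?J j (restrict q ?J) = first_passage_slope t e ?J j q" for q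
    by (simp add: first_passage_slope_def strip_sum_def cong: if_cong)
  have "indep_var borel (first_passage_slope t e ?J j \<circ> (\<lambda>\<omega>. restrict (\<lambda>i. p i \<omega>) ?J))
         borel ((\<lambda>q. strip (t j) (t m) (q i)) \<circ> (\<lambda>\<omega>. restrict (\<lambda>i. p i \<omega>) {i}))"
    using i by (intro indep_var_compose[OF indep_var_restrict[OF indep]]) auto
  moreover have "first_passage_slope t e ?J j \<circ> (\<lambda>\<omega>. restrict (\<lambda>i. p i \<omega>) ?J) = ?H"
    by (simp add: fun_eq_iff restrict_eq)
  moreover have "(\<lambda>q. strip (t j) (t m) (q i)) \<circ> (\<lambda>\<omega>. restrict (\<lambda>i. p i \<omega>) {i}) = ?D"
    by (simp add: fun_eq_iff)
  ultimately have ind: "indep_var borel ?H borel ?D" by simp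
  have "integrable M ?H"
  proof (rule Bochner_Integration.integrable_bound)
    show "integrable M (\<lambda>\<omega>. 2 * (\<Sum>i\<in>?J. \<bar>snd (p i \<omega>)\<bar>))"
      using int_snd by (intro integrable_mult_right Bochner_Integration.integrable_sum integrable_abs) auto
    show "?H \<in> borel_measurable M" using ind by (rule indep_var_rv1)
    show "AE \<omega> in M. norm (?H \<omega>) \<le> norm (2 * (\<Sum>i\<in>?J. \<bar>snd (p i \<omega>)\<bar>))"
      using first_passage_slope_le[of t e ?J j] by (auto intro!: AE_I2 order_trans[OF _ abs_ge_self])
  qed
  note int = this int_strip[OF i, of "t j" "t m"]
  show "integrable M (\<lambda>\<omega>. first_passage_slope t e I j (\<lambda>i. p i \<omega>) * ?D \<omega>)"
    unfolding eq by (rule indep_var_integrable[OF ind int])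
  show "expectation (\<lambda>\<omega>. first_passage_slope t e I j (\<lambda>i. p i \<omega>) * ?D \<omega>) = 0"
    unfolding eq indep_var_lebesgue_integral[OF ind int]
    using exp_strip[OF i monoD[OF t \<open>j \<le> m\<close>]] by simp
qed

lemma rv_strip_sum[measurable]: "random_variable borel (\<lambda>\<omega>. strip_sum I a b (\<lambda>i. p i \<omega>))"
  unfolding strip_sum_def using rv_strip by (intro borel_measurable_sum)

lemma integrable_cosine_gauge: "integrable M (\<lambda>\<omega>. cosine_gauge (strip_sum I a b (\<lambda>i. p i \<omega>)))"
proof (rule Bochner_Integration.integrable_bound)
  show "integrable M (\<lambda>\<omega>. (strip_sum I a b (\<lambda>i. p i \<omega>))\<^sup>2)"
    unfolding strip_sum_def using fin rv_strip sq_strip by (intro integrable_square_sum)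
  have "\<bar>cosine_gauge x\<bar> \<le> x\<^sup>2" for x
    using cosine_gauge_nonneg[of x] cosine_gauge_le[of x] zero_le_power2[of x] by linarith
  then show "AE \<omega> in M. norm (cosine_gauge (strip_sum I a b (\<lambda>i. p i \<omega>))) \<le> norm ((strip_sum I a b (\<lambda>i. p i \<omega>))\<^sup>2)"
    by simp
qed measurable

lemma strip_sum_diff:
  fixes t :: "nat \<Rightarrow> real"
  assumes "mono t" "j \<le> m"
  shows "strip_sum I (t 0) (t m) q - strip_sum I (t 0) (t j) q = strip_sum I (t j) (t m) q"
  unfolding strip_sum_def sum_subtractf[symmetric]
  using monoD[OF assms] monoD[OF assms(1) le0, of j] by (intro sum.cong) (auto simp: strip_def)

text \<open>On the event, the final gauge is at least the gauge at first passage plus the tangent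
  term there. The tangent terms have expectation 0 by \<open>martingale_step\<close>, so no stopping
  theorem is required.\<close>

theorem maximal_inequality:
  fixes t :: "nat \<Rightarrow> real"
  assumes t: "mono t" and e: "0 < e"
  shows "cosine_gauge e * prob {\<omega>\<in>space M. \<exists>j\<le>m. e \<le> \<bar>strip_sum I (t 0) (t j) (\<lambda>i. p i \<omega>)\<bar>}
     \<le> expectation (\<lambda>\<omega>. cosine_gauge (strip_sum I (t 0) (t m) (\<lambda>i. p i \<omega>)))"
proof -
  define A where "A = {\<omega>\<in>space M. \<exists>j\<le>m. e \<le> \<bar>strip_sum I (t 0) (t j) (\<lambda>i. p i \<omega>)\<bar>}"
  have A[measurable]: "A \<in> events"
  proof -
    have "A = (\<Union>j\<in>{..m}. {\<omega>\<in>space M. e \<le> \<bar>strip_sum I (t 0) (t j) (\<lambda>i. p i \<omega>)\<bar>})"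
      by (auto simp: A_def)
    moreover have "{\<omega>\<in>space M. e \<le> \<bar>strip_sum I (t 0) (t j) (\<lambda>i. p i \<omega>)\<bar>} \<in> events" for j
      by (rule borel_measurable_le[OF borel_measurable_const borel_measurable_abs[OF rv_strip_sum]])
    ultimately show ?thesis by auto
  qed
  let ?q = "\<lambda>\<omega> i. p i \<omega>"
  \<comment> \<open>The tangent term at the first passage, written as a sum over all indices and
    summands; at most one index \<open>j\<close> has a nonzero slope.\<close>
  let ?R = "\<lambda>\<omega>. (\<Sum>j\<le>m. \<Sum>i\<in>I. first_passage_slope t e I j (?q \<omega>) * strip (t j) (t m) (p i \<omega>))"
  have R: "integrable M ?R" "expectation ?R = 0"
    using martingale_step[OF t] by (auto simp: atMost_iff)
  have pointwise: "cosine_gauge e * indicator A \<omega> \<le> cosine_gauge (strip_sum I (t 0) (t m) (?q \<omega>)) - ?R \<omega>"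
    if "\<omega> \<in> space M" for \<omega>
  proof -
    have R_eq: "?R \<omega> = (\<Sum>j\<le>m. first_passage_slope t e I j (?q \<omega>) *
          (strip_sum I (t 0) (t m) (?q \<omega>) - strip_sum I (t 0) (t j) (?q \<omega>)))"
      using strip_sum_diff[OF t] by (simp add: sum_distrib_left[symmetric] strip_sum_def)
    show ?thesis
    proof (cases "\<omega> \<in> A")
      case False
      then have "first_passage_slope t e I j (?q \<omega>) = 0" if "j \<le> m" for j
        using that \<open>\<omega> \<in> space M\<close> by (auto simp: A_def first_passage_slope_def)
      then show ?thesis using False unfolding R_eq by (simp add: cosine_gauge_nonneg)
    next
      case True
      define k where "k = (LEAST j. e \<le> \<bar>strip_sum I (t 0) (t j) (?q \<omega>)\<bar>)"
      obtain j where j: "j \<le> m" "e \<le> \<bar>strip_sum I (t 0) (t j) (?q \<omega>)\<bar>" using True by (auto simp: A_def)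
      have k: "e \<le> \<bar>strip_sum I (t 0) (t k) (?q \<omega>)\<bar>"
        unfolding k_def by (rule LeastI) (rule j(2))
      have "k \<le> m" unfolding k_def using j by (intro order_trans[OF Least_le])
      have less: "\<bar>strip_sum I (t 0) (t r) (?q \<omega>)\<bar> < e" if "r < k" for r
        using not_less_Least[OF that[unfolded k_def]] by simp
      have slope: "first_passage_slope t e I r (?q \<omega>) =
         (if r = k then strip_sum I (t 0) (t k) (?q \<omega>) - sin (strip_sum I (t 0) (t k) (?q \<omega>)) else 0)" for r
      proof (cases r k rule: linorder_cases)
        case less
        then show ?thesis using \<open>\<And>r. r < k \<Longrightarrow> _\<close>[of r] by (simp add: first_passage_slope_def)
      next
        case equal
        then show ?thesis using k less by (simp add: first_passage_slope_def)
      next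
        case greater
        then have "\<not> (\<forall>s<r. \<bar>strip_sum I (t 0) (t s) (?q \<omega>)\<bar> < e)" using k by (meson not_less)
        then show ?thesis using greater by (auto simp: first_passage_slope_def)
      qed
      have R_k: "?R \<omega> = (strip_sum I (t 0) (t k) (?q \<omega>) - sin (strip_sum I (t 0) (t k) (?q \<omega>))) *
          (strip_sum I (t 0) (t m) (?q \<omega>) - strip_sum I (t 0) (t k) (?q \<omega>))"
        unfolding R_eq unfolding slope using \<open>k \<le> m\<close>
        by (simp add: if_distrib[of "\<lambda>x. x * _"] sum.delta cong: if_cong)
      have "cosine_gauge e \<le> cosine_gauge (strip_sum I (t 0) (t k) (?q \<omega>))"
        using e k by (intro cosine_gauge_mono) auto
      also have "\<dots> \<le> cosine_gauge (strip_sum I (t 0) (t m) (?q \<omega>)) - ?R \<omega>"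
        unfolding R_k using cosine_gauge_tangent[of "strip_sum I (t 0) (t k) (?q \<omega>)"  "strip_sum I (t 0) (t m) (?q \<omega>)"] by simp
      finally show ?thesis using True by simp
    qed
  qed
  have "cosine_gauge e * prob A = expectation (\<lambda>\<omega>. cosine_gauge e * indicator A \<omega>)"
    by simp
  also have "\<dots> \<le> expectation (\<lambda>\<omega>. cosine_gauge (strip_sum I (t 0) (t m) (?q \<omega>)) - ?R \<omega>)"
  proof (rule integral_mono)
    show "integrable M (\<lambda>\<omega>. cosine_gauge e * indicator A \<omega>)"
      using A by (intro integrable_mult_right integrable_real_indicator) (auto simp: less_top[symmetric])
    show "integrable M (\<lambda>\<omega>. cosine_gauge (strip_sum I (t 0) (t m) (?q \<omega>)) - ?R \<omega>)"
      using R(1) integrable_cosine_gauge by (intro Bochner_Integration.integrable_diff)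
  qed (rule pointwise)
  also have "\<dots> = expectation (\<lambda>\<omega>. cosine_gauge (strip_sum I (t 0) (t m) (?q \<omega>)))"
    using R integrable_cosine_gauge by (simp only: Bochner_Integration.integral_diff)
  finally show ?thesis by (simp only: A_def)
qed

lemma expectation_strip_sum_square:
  assumes "a \<le> b"
  shows "expectation (\<lambda>\<omega>. (strip_sum I a b (\<lambda>i. p i \<omega>))\<^sup>2) = (\<Sum>i\<in>I. expectation (\<lambda>\<omega>. (strip a b (p i \<omega>))\<^sup>2))"
proof -
  let ?D = "\<lambda>i \<omega>. strip a b (p i \<omega>)"
  have ind: "indep_vars (\<lambda>_. borel) ?D I"
    by (rule indep_vars_compose2[OF indep]) simp
  have prod: "integrable M (\<lambda>\<omega>. ?D i \<omega> * ?D j \<omega>)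
      \<and> expectation (\<lambda>\<omega>. ?D i \<omega> * ?D j \<omega>) = (if i = j then expectation (\<lambda>\<omega>. (?D i \<omega>)\<^sup>2) else 0)"
    if "i \<in> I" "j \<in> I" for i j
  proof (cases "i = j")
    case True
    then show ?thesis using sq_strip[OF that(1), of a b] by (simp add: power2_eq_square)
  next
    case False
    have "indep_var borel (?D i) borel (?D j)"
      using indep_vars_sum[of "{j}" i ?D] indep_vars_subset[OF ind, of "{i, j}"] False that by auto
    note ij = this int_strip[OF that(1)] int_strip[OF that(2)]
    show ?thesis
      using indep_var_integrable[OF ij] indep_var_lebesgue_integral[OF ij] False exp_strip[OF that(1) assms] by simp
  qed
  have "expectation (\<lambda>\<omega>. (strip_sum I a b (\<lambda>i. p i \<omega>))\<^sup>2) = expectation (\<lambda>\<omega>. \<Sum>i\<in>I. \<Sum>j\<in>I. ?D i \<omega> * ?D j \<omega>)"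
    by (simp add: strip_sum_def power2_eq_square sum_product)
  also have "\<dots> = (\<Sum>i\<in>I. \<Sum>j\<in>I. expectation (\<lambda>\<omega>. ?D i \<omega> * ?D j \<omega>))"
    using prod by (subst Bochner_Integration.integral_sum)
      (auto intro!: sum.cong Bochner_Integration.integrable_sum Bochner_Integration.integral_sum)
  also have "\<dots> = (\<Sum>i\<in>I. expectation (\<lambda>\<omega>. (?D i \<omega>)\<^sup>2))"
    using fin prod by (intro sum.cong) (auto simp: sum.delta)
  finally show ?thesis .
qed

text \<open>The real part of the characteristic function at 1 is the expected cosine, and
  independent centered summands are orthogonal. Hence the Doob bound has a limit whenever the
  characteristic function has one.\<close>

lemma expectation_cosine_gauge:
  assumes "a \<le> b"
  shows "expectation (\<lambda>\<omega>. cosine_gauge (strip_sum I a b (\<lambda>i. p i \<omega>))) =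
    (\<Sum>i\<in>I. expectation (\<lambda>\<omega>. (strip a b (p i \<omega>))\<^sup>2)) / 2 - 1 +
     Re (CLINT \<omega>|M. iexp (strip_sum I a b (\<lambda>i. p i \<omega>)))"
proof -
  have cos: "integrable M (\<lambda>\<omega>. cos (strip_sum I a b (\<lambda>i. p i \<omega>)))"
    by (rule integrable_const_bound[where B=1]) auto
  have sqs: "integrable M (\<lambda>\<omega>. (strip_sum I a b (\<lambda>i. p i \<omega>))\<^sup>2)"
    unfolding strip_sum_def using fin rv_strip sq_strip by (intro integrable_square_sum)
  have iexp: "complex_integrable M (\<lambda>\<omega>. iexp (strip_sum I a b (\<lambda>i. p i \<omega>)))"
    by (rule integrable_iexp) auto
  have "Re (CLINT \<omega>|M. iexp (strip_sum I a b (\<lambda>i. p i \<omega>))) = expectation (\<lambda>\<omega>. cos (strip_sum I a b (\<lambda>i. p i \<omega>)))"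
    using integral_Re[OF iexp] by (simp flip: cis_conv_exp)
  moreover have "expectation (\<lambda>\<omega>. cosine_gauge (strip_sum I a b (\<lambda>i. p i \<omega>))) =
     expectation (\<lambda>\<omega>. (strip_sum I a b (\<lambda>i. p i \<omega>))\<^sup>2) / 2 - 1 + expectation (\<lambda>\<omega>. cos (strip_sum I a b (\<lambda>i. p i \<omega>)))"
    unfolding cosine_gauge_def using cos sqs by (simp add: prob_space)
  ultimately show ?thesis using expectation_strip_sum_square[OF assms] by simp
qed

end

section \<open>Order statistics\<close>

text \<open>Here \<xi> is the \<open>m\<close>-th smallest of the \<open>x i\<close>. Without ties
  the first \<open>m\<close> sorted indices are exactly those with \<open>x i\<close> at most
  \<xi>.\<close>

lemma induced_order_stat_sum:
  fixes x :: "nat \<Rightarrow> real" and y :: "nat \<Rightarrow> 'v::comm_monoid_add"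
  assumes inj: "inj_on x {1..n}" and pos: "\<And>i. i \<in> {1..n} \<Longrightarrow> 0 < x i" and m: "m \<le> n"
  shows "\<exists>\<xi>. 0 \<le> \<xi> \<and> (\<xi> = 0 \<or> \<xi> \<in> x ` {1..n}) \<and> card {i\<in>{1..n}. x i \<le> \<xi>} = m \<and>
    (\<Sum>j = 1..m. induced_order_stat x y n j) = (\<Sum>i = 1..n. if x i \<le> \<xi> then y i else 0)"
proof -
  define s where "s = sort_key x [1..<Suc n]"
  have s: "set s = {1..n}" "distinct s" "length s = n" "sorted (map x s)"
    by (auto simp: s_def)
  \<comment> \<open>For \<open>m = 0\<close> the value 0 lies below every \<open>x i\<close>, since
    these are positive.\<close>
  define \<xi> where "\<xi> = (if m = 0 then 0 else x (s ! (m - 1)))"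
  have lower: "set (take m s) = {i\<in>{1..n}. x i \<le> \<xi>}"
  proof (cases "m = 0")
    case True
    then show ?thesis using pos by (force simp: \<xi>_def)
  next
    case False
    show ?thesis
    proof (intro set_eqI iffI)
      fix i assume "i \<in> set (take m s)"
      then obtain j where j: "j < m" "i = s ! j" using m s by (auto simp: in_set_conv_nth)
      then have "map x s ! j \<le> map x s ! (m - 1)"
        using m s by (intro sorted_nth_mono) auto
      then show "i \<in> {i\<in>{1..n}. x i \<le> \<xi>}"
        using j m s False nth_mem[of j s] by (auto simp: \<xi>_def)
    next
      fix i assume i: "i \<in> {i\<in>{1..n}. x i \<le> \<xi>}"
      then obtain j where j: "j < n" "i = s ! j" using s by (metis (no_types, lifting) in_set_conv_nth mem_Collect_eq)
      have "j < m"
      proof (rule ccontr)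
        assume "\<not> j < m"
        then have "map x s ! (m - 1) \<le> map x s ! j"
          using j m s by (intro sorted_nth_mono) auto
        then have "x (s ! j) = x (s ! (m - 1))"
          using i j m s False by (auto simp: \<xi>_def)
        then have "s ! j = s ! (m - 1)"
          using inj_onD[OF inj] j m s False nth_mem[of j s] nth_mem[of "m - 1" s] by auto
        then have "j = m - 1" using s j m False by (simp add: nth_eq_iff_index_eq)
        then show False using \<open>\<not> j < m\<close> False by simp
      qed
      then show "i \<in> set (take m s)" using j m s by (auto simp: in_set_conv_nth)
    qed
  qed
  have "card {i\<in>{1..n}. x i \<le> \<xi>} = m"
    unfolding lower[symmetric] using m s by (simp add: distinct_card)
  moreover have "\<xi> = 0 \<or> \<xi> \<in> x ` {1..n}"
    using m s nth_mem[of "m - 1" s] by (auto simp: \<xi>_def)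
  moreover have "0 \<le> \<xi>" using calculation(2) pos by fastforce
  moreover have "(\<Sum>j = 1..m. induced_order_stat x y n j) = (\<Sum>i = 1..n. if x i \<le> \<xi> then y i else 0)"
  proof -
    have "(\<Sum>j = 1..m. induced_order_stat x y n j) = (\<Sum>j<m. y (s ! j))"
      unfolding induced_order_stat_def s_def[symmetric]
      by (rule sum.reindex_bij_witness[where i=Suc and j="\<lambda>j. j - 1"]) auto
    also have "\<dots> = sum y (set (take m s))"
    proof -
      have "set (take m s) = (!) s ` {..<m}"
        using nth_image[of m s] m s by (simp add: lessThan_atLeast0)
      then have "bij_betw ((!) s) {..<m} (set (take m s))"
        using m s by (intro bij_betw_imageI inj_on_nth) auto
      then show ?thesis by (rule sum.reindex_bij_betw)
    qed
    also have "\<dots> = (\<Sum>i = 1..n. if x i \<le> \<xi> then y i else 0)"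
      unfolding lower by (rule sum.inter_filter) simp
    finally show ?thesis .
  qed
  ultimately show ?thesis by blast
qed

text \<open>If \<xi> were beyond \<open>(l + 2) / N\<close>, the count at that grid point would be
  at least \<open>n * (l + 1) / N\<close>, which exceeds \<open>n * t\<close> and hence the rank.
  The other side is symmetric.\<close>

lemma order_statistic_location:
  fixes N n :: nat and x :: "nat \<Rightarrow> real" and t \<xi> :: real
  assumes N: "0 < N" "N \<le> n" and t: "0 \<le> t" "t \<le> 1" and \<xi>: "0 \<le> \<xi>" "\<xi> \<le> 1"
    and counts: "\<And>l. l \<le> N \<Longrightarrow> \<bar>real (card {i\<in>{1..n}. x i \<le> l / N}) - n * (l / N)\<bar> \<le> n / N"
    and rank: "card {i\<in>{1..n}. x i \<le> \<xi>} = nat \<lfloor>n * t\<rfloor>"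
  defines "l \<equiv> nat \<lfloor>N * t\<rfloor>"
  shows "\<bar>\<xi> - l / N\<bar> \<le> 2 / N"
proof -
  have n: "0 < n" using N by simp
  have l: "real l \<le> N * t" "N * t < real l + 1"
    unfolding l_def using t by (auto simp: of_nat_nat)
  define m where "m = nat \<lfloor>n * t\<rfloor>"
  have m: "real m \<le> n * t" "n * t < real m + 1"
    unfolding m_def using t by (auto simp: of_nat_nat)
  \<comment> \<open>On the left side one unit is lost because the rank is only known to exceed
    \<open>n * t - 1\<close>; the slack \<open>n / N\<close> absorbs it.\<close>
  have nN: "1 \<le> n / N" using N by simp
  have abs_diff: "\<bar>a - b\<bar> \<le> c \<Longrightarrow> b - c \<le> a \<and> a \<le> b + c" for a b c :: real
    by linarith
  have card_mono': "card {i\<in>{1..n}. x i \<le> a} \<le> card {i\<in>{1..n}. x i \<le> b}" if "a \<le> b" for a b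
    using that by (intro card_mono) auto
  have "\<xi> \<le> (l + 2) / N"
  proof (rule ccontr)
    assume "\<not> \<xi> \<le> (l + 2) / N"
    then have less: "real (l + 2) / N < \<xi>" by simp
    then have "real (l + 2) / N < 1" using \<xi> by linarith
    then have lN: "l + 2 \<le> N" using N by (simp add: field_simps)
    have "real (card {i\<in>{1..n}. x i \<le> real (l + 2) / N}) \<le> real m"
      using card_mono'[of "real (l + 2) / N" \<xi>] less rank by (simp add: m_def)
    moreover have "n * (real (l + 2) / N) - n / N \<le> real (card {i\<in>{1..n}. x i \<le> real (l + 2) / N})"
      using abs_diff[OF counts[OF lN]] by (rule conjunct1)
    moreover have "n * (real (l + 2) / N) - n / N = n * ((l + 1) / N)"
      using N by (simp add: field_simps)
    moreover have "t < (l + 1) / N" using l N by (simp add: field_simps)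
    then have "n * t < n * ((l + 1) / N)" using n by (intro mult_strict_left_mono) auto
    ultimately show False using m by linarith
  qed
  moreover have "(real l - 2) / N \<le> \<xi>"
  proof (rule ccontr)
    assume "\<not> (real l - 2) / N \<le> \<xi>"
    then have less: "\<xi> < (real l - 2) / N" by simp
    have "0 < (real l - 2) / N" using less \<xi> by linarith
    then have l2: "2 < l" using N by (simp add: zero_less_divide_iff)
    then have r: "real (l - 2) = real l - 2" by simp
    have "real l \<le> N" using l t N mult_left_mono[of t 1 "real N"] by linarith
    then have lN: "l - 2 \<le> N" by simp
    have "real m \<le> real (card {i\<in>{1..n}. x i \<le> real (l - 2) / N})"
      using card_mono'[of \<xi> "real (l - 2) / N"] less rank by (simp add: m_def r)
    moreover have "real (card {i\<in>{1..n}. x i \<le> real (l - 2) / N}) \<le> n * (real (l - 2) / N) + n / N"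
      using abs_diff[OF counts[OF lN]] by (rule conjunct2)
    moreover have "n * (real (l - 2) / N) + n / N = n * (l / N) - n / N"
      unfolding r using N by (simp add: field_simps)
    moreover have "l / N \<le> t" using l N by (simp add: field_simps)
    then have "n * (l / N) \<le> n * t" using n by (intro mult_left_mono) auto
    ultimately show False using m nN by linarith
  qed
  ultimately show ?thesis by (simp add: abs_le_iff add_divide_distrib diff_divide_distrib)
qed

text \<open>One move from \<xi> to the left end of its cell, then moves along grid points to
  \<open>l / N\<close>.\<close>

lemma oscillation_chain:
  fixes w :: "real \<Rightarrow> 'v::real_normed_vector" and N :: nat
  assumes N: "0 < N" and \<xi>: "0 \<le> \<xi>" "\<xi> \<le> 1" and l: "l \<le> N" "\<bar>\<xi> - l / N\<bar> \<le> 2 / N"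
    and osc: "\<And>j u. j < N \<Longrightarrow> j / N \<le> u \<Longrightarrow> u \<le> (j + 1) / N \<Longrightarrow> norm (w u - w (j / N)) \<le> e"
  shows "norm (w \<xi> - w (l / N)) \<le> 5 * e"
proof -
  have e: "0 \<le> e" using osc[of 0 0] N by auto
  have grid: "norm (w (real (a + k) / N) - w (real a / N)) \<le> real k * e" if "a + k \<le> N" for a k
    using that
  proof (induction k)
    case (Suc k)
    have "norm (w (real (a + Suc k) / N) - w (real (a + k) / N)) \<le> e"
      using osc[of "a + k" "real (a + Suc k) / N"] Suc.prems N by (simp add: divide_right_mono add.commute)
    then have "norm (w (real (a + Suc k) / N) - w (real a / N)) \<le> e + real k * e"
      using Suc by (intro norm_diff_triangle_le[of _ "w (real (a + k) / N)"]) auto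
    then show ?case by (simp add: algebra_simps)
  qed simp
  \<comment> \<open>The minimum puts \<xi> = 1 into the last cell.\<close>
  define j where "j = min (nat \<lfloor>N * \<xi>\<rfloor>) (N - 1)"
  have N\<xi>: "N * \<xi> \<le> N" using \<xi> N by (simp add: mult_left_le)
  have j: "j < N" "real j \<le> N * \<xi>" "N * \<xi> \<le> real j + 1"
  proof -
    show "j < N" using N by (auto simp: j_def)
    have fl: "real (nat \<lfloor>N * \<xi>\<rfloor>) \<le> N * \<xi>" "N * \<xi> < real (nat \<lfloor>N * \<xi>\<rfloor>) + 1"
      using \<xi> by (auto simp: of_nat_nat)
    show "real j \<le> N * \<xi>" using fl(1) by (auto simp: j_def min_def)
    show "N * \<xi> \<le> real j + 1" using fl N\<xi> N by (auto simp: j_def min_def of_nat_diff)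
  qed
  have "norm (w \<xi> - w (j / N)) \<le> e"
    using j N by (intro osc) (auto simp: field_simps)
  moreover have "norm (w (j / N) - w (l / N)) \<le> 4 * e"
  proof -
    \<comment> \<open>The cell of \<xi> starts at most 2 grid points after \<open>l\<close> or 3
      before it, so 4 grid moves are a safe count; with the move inside the cell this gives the
      factor 5.\<close>
    have "\<bar>N * \<xi> - l\<bar> \<le> 2" using l N by (simp add: abs_le_iff field_simps)
    then have near: "real j \<le> real l + 2" "real l \<le> real j + 3" using j by (auto simp: abs_le_iff)
    show ?thesis
    proof (cases "l \<le> j")
      case True
      then have "norm (w (j / N) - w (l / N)) \<le> real (j - l) * e"
        using grid[of l "j - l"] j by simp
      also have "\<dots> \<le> 4 * e" using near True e by (intro mult_right_mono) auto
      finally show ?thesis .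
    next
      case False
      then have "norm (w (l / N) - w (j / N)) \<le> real (l - j) * e"
        using grid[of j "l - j"] l by simp
      also have "\<dots> \<le> 4 * e" using near False e by (intro mult_right_mono) auto
      finally show ?thesis by (simp add: norm_minus_commute)
    qed
  qed
  ultimately show ?thesis using norm_triangle_sub norm_diff_triangle_le by fastforce
qed

section \<open>Weak convergence and Lipschitz functionals\<close>

lemma lipschitz_imp_continuous_map_real:
  fixes g :: "'m \<Rightarrow> real"
  assumes lip: "\<And>x y. x \<in> mspace L \<Longrightarrow> y \<in> mspace L \<Longrightarrow> \<bar>g x - g y\<bar> \<le> K * mdist L x y"
  shows "continuous_map (mtopology_of L) euclideanreal g"
proof -
  have "Lipschitz_continuous_map L euclidean_metric g"
    unfolding Lipschitz_continuous_map_def using lip by (auto simp: dist_real_def)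
  from Lipschitz_continuous_imp_continuous_map[OF this] show ?thesis by simp
qed

lemma continuous_map_real_epsilon:
  fixes g :: "'m \<Rightarrow> real"
  assumes cont: "continuous_map (mtopology_of L) euclideanreal g" and x: "x \<in> mspace L" and e: "0 < e"
  shows "\<exists>d>0. \<forall>y\<in>mspace L. mdist L x y < d \<longrightarrow> \<bar>g y - g x\<bar> < e"
proof -
  interpret Metric_space "mspace L" "mdist L" by (rule Metric_space_mspace_mdist)
  have "openin mtopology {y \<in> topspace mtopology. g y \<in> ball (g x) e}"
    using cont by (intro openin_continuous_map_preimage[where Y=euclideanreal]) (auto simp: mtopology_of_def)
  moreover have "x \<in> {y \<in> topspace mtopology. g y \<in> ball (g x) e}" using x e by simp
  ultimately obtain d where d: "d > 0" "mball x d \<subseteq> {y \<in> topspace mtopology. g y \<in> ball (g x) e}"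
    unfolding openin_mtopology by blast
  have "\<bar>g y - g x\<bar> < e" if "y \<in> mspace L" "mdist L x y < d" for y
  proof -
    have "y \<in> mball x d" using that x by simp
    then have "g y \<in> ball (g x) e" using d(2) by blast
    then show ?thesis by (simp add: dist_real_def abs_minus_commute)
  qed
  then show ?thesis using d(1) by blast
qed

text \<open>The infimal convolution of \<open>g\<close> with \<open>r\<close> times the distance
  (Pasch-Hausdorff envelope).\<close>

definition lipschitz_minorant :: "'m metric \<Rightarrow> ('m \<Rightarrow> real) \<Rightarrow> real \<Rightarrow> 'm \<Rightarrow> real" where
  "lipschitz_minorant L g r x = (INF y\<in>mspace L. g y + r * mdist L x y)"

context
  fixes L :: "'m metric" and g :: "'m \<Rightarrow> real" and B :: real
  assumes bdd: "\<And>x. x \<in> mspace L \<Longrightarrow> \<bar>g x\<bar> \<le> B"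
begin

lemma lipschitz_minorant_bdd_below:
  assumes "0 \<le> r"
  shows "bdd_below ((\<lambda>y. g y + r * mdist L x y) ` mspace L)"
proof (rule bdd_belowI2)
  fix y assume "y \<in> mspace L"
  then show "- B \<le> g y + r * mdist L x y"
    using bdd[of y] mult_nonneg_nonneg[OF assms(1) mdist_nonneg, of L x y] by (auto simp: abs_le_iff)
qed

lemma lipschitz_minorant_le:
  assumes "0 \<le> r" "x \<in> mspace L"
  shows "lipschitz_minorant L g r x \<le> g x"
  unfolding lipschitz_minorant_def
  using cINF_lower[OF lipschitz_minorant_bdd_below[OF assms(1), of x] assms(2)] assms by (simp add: Metric_space.mdist_zero[OF Metric_space_mspace_mdist])

lemma lipschitz_minorant_ge:
  assumes "0 \<le> r" "x \<in> mspace L"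
  shows "- B \<le> lipschitz_minorant L g r x"
  unfolding lipschitz_minorant_def
proof (rule cINF_greatest)
  fix y assume "y \<in> mspace L"
  then show "- B \<le> g y + r * mdist L x y"
    using bdd[of y] mult_nonneg_nonneg[OF assms(1) mdist_nonneg, of L x y] by (auto simp: abs_le_iff)
qed (use assms in auto)

lemma lipschitz_minorant_abs_le:
  assumes "0 \<le> r" "x \<in> mspace L"
  shows "\<bar>lipschitz_minorant L g r x\<bar> \<le> B"
  using lipschitz_minorant_le[OF assms] lipschitz_minorant_ge[OF assms] bdd[of x] assms by (auto simp: abs_le_iff)

lemma lipschitz_minorant_lipschitz:
  assumes r: "0 \<le> r" and x: "x \<in> mspace L" and y: "y \<in> mspace L"
  shows "\<bar>lipschitz_minorant L g r x - lipschitz_minorant L g r y\<bar> \<le> r * mdist L x y"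
proof -
  have *: "lipschitz_minorant L g r x \<le> lipschitz_minorant L g r y + r * mdist L x y"
    if x: "x \<in> mspace L" and y: "y \<in> mspace L" for x y
  proof -
    have "lipschitz_minorant L g r x - r * mdist L x y \<le> lipschitz_minorant L g r y"
      unfolding lipschitz_minorant_def[of _ _ _ y]
    proof (rule cINF_greatest)
      fix z assume z: "z \<in> mspace L"
      have "lipschitz_minorant L g r x \<le> g z + r * mdist L x z"
        unfolding lipschitz_minorant_def by (rule cINF_lower[OF lipschitz_minorant_bdd_below[OF r] z])
      also have "\<dots> \<le> g z + r * (mdist L x y + mdist L y z)"
        using x y z r by (intro add_left_mono mult_left_mono mdist_triangle) auto
      finally show "lipschitz_minorant L g r x - r * mdist L x y \<le> g z + r * mdist L y z"
        by (simp add: algebra_simps)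
    qed (use y in auto)
    then show ?thesis by simp
  qed
  show ?thesis using *[OF x y] *[OF y x] mdist_commute[of L x y] by (auto simp: abs_le_iff)
qed

text \<open>Points at distance \<open>d\<close> or more pay a penalty of at least
  \<open>2 * B\<close> once \<open>r\<close> is large, so only points where \<open>g\<close> is
  close to \<open>g x\<close> can lower the infimum.\<close>

lemma lipschitz_minorant_tendsto:
  assumes cont: "continuous_map (mtopology_of L) euclideanreal g" and x: "x \<in> mspace L"
  shows "(\<lambda>r. lipschitz_minorant L g (real r) x) \<longlonglongrightarrow> g x"
proof (rule LIMSEQ_I)
  fix e :: real assume e: "0 < e"
  obtain d where d: "d > 0" "\<And>y. y \<in> mspace L \<Longrightarrow> mdist L x y < d \<Longrightarrow> \<bar>g y - g x\<bar> < e / 2"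
    using continuous_map_real_epsilon[OF cont x, of "e / 2"] e by auto
  obtain r0 :: nat where r0: "2 * B / d < real r0" using reals_Archimedean2 by blast
  show "\<exists>no. \<forall>r\<ge>no. norm (lipschitz_minorant L g (real r) x - g x) < e"
  proof (intro exI allI impI)
    fix r assume "r0 \<le> r"
    then have "2 * B / d < real r" using r0 by linarith
    then have rd: "2 * B \<le> real r * d" using d by (simp add: field_simps)
    have "g x - e / 2 \<le> lipschitz_minorant L g (real r) x"
      unfolding lipschitz_minorant_def
    proof (rule cINF_greatest)
      fix y assume y: "y \<in> mspace L"
      show "g x - e / 2 \<le> g y + real r * mdist L x y"
      proof (cases "mdist L x y < d")
        case True
        then have "\<bar>g y - g x\<bar> < e / 2" using d(2) y by blast
        moreover have "0 \<le> real r * mdist L x y" by simp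
        ultimately show ?thesis by linarith
      next
        case False
        then have "real r * d \<le> real r * mdist L x y" by (intro mult_left_mono) auto
        then show ?thesis using rd bdd[OF x] bdd[OF y] e by linarith
      qed
    qed (use x in auto)
    then show "norm (lipschitz_minorant L g (real r) x - g x) < e"
      using lipschitz_minorant_le[of "real r" x] x e by (auto simp: abs_less_iff)
  qed
qed

end

context
  fixes L :: "'m metric" and M :: "'a measure" and P :: "'b measure"
    and V :: "nat \<Rightarrow> 'a \<Rightarrow> 'm" and U :: "'b \<Rightarrow> 'm"
  assumes M: "prob_space M" and P: "prob_space P"
    and V: "\<And>n \<omega>. \<omega> \<in> space M \<Longrightarrow> V n \<omega> \<in> mspace L"
    and U: "\<And>\<omega>. \<omega> \<in> space P \<Longrightarrow> U \<omega> \<in> mspace L"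
    and V_meas: "\<And>n g. continuous_map (mtopology_of L) euclideanreal g \<Longrightarrow> (\<lambda>\<omega>. g (V n \<omega>)) \<in> borel_measurable M"
    and U_meas: "\<And>g. continuous_map (mtopology_of L) euclideanreal g \<Longrightarrow> (\<lambda>\<omega>. g (U \<omega>)) \<in> borel_measurable P"
    and lip: "\<And>g K B. (\<And>x y. x \<in> mspace L \<Longrightarrow> y \<in> mspace L \<Longrightarrow> \<bar>g x - g y\<bar> \<le> K * mdist L x y) \<Longrightarrow>
       (\<And>x. x \<in> mspace L \<Longrightarrow> \<bar>g x\<bar> \<le> B) \<Longrightarrow> 0 \<le> K \<Longrightarrow>
       (\<lambda>n. LINT \<omega>|M. g (V n \<omega>)) \<longlonglongrightarrow> (LINT \<omega>|P. g (U \<omega>))"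
begin

text \<open>A Lipschitz minorant whose limit expectation is within \<open>e / 2\<close> of that of
  \<open>g\<close> converges by hypothesis and stays below \<open>g\<close> along the
  sequence.\<close>

lemma eventually_lower_bound_of_lipschitz:
  assumes cont: "continuous_map (mtopology_of L) euclideanreal g" and bdd: "\<And>x. x \<in> mspace L \<Longrightarrow> \<bar>g x\<bar> \<le> B"
    and e: "0 < e"
  shows "\<forall>\<^sub>F n in sequentially. (LINT \<omega>|P. g (U \<omega>)) - e < (LINT \<omega>|M. g (V n \<omega>))"
proof -
  interpret M: prob_space M by fact
  interpret PP: prob_space P by fact
  let ?h = "\<lambda>r. lipschitz_minorant L g (real r)"
  have hl: "\<bar>?h r x - ?h r y\<bar> \<le> real r * mdist L x y" if "x \<in> mspace L" "y \<in> mspace L" for r x y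
    using that by (intro lipschitz_minorant_lipschitz[where B=B] bdd) auto
  have hb: "\<bar>?h r x\<bar> \<le> B" if "x \<in> mspace L" for r x
    using that by (intro lipschitz_minorant_abs_le bdd) auto
  have hc: "continuous_map (mtopology_of L) euclideanreal (?h r)" for r
    using hl by (rule lipschitz_imp_continuous_map_real)
  have "(\<lambda>r. LINT \<omega>|P. ?h r (U \<omega>)) \<longlonglongrightarrow> (LINT \<omega>|P. g (U \<omega>))"
  proof (rule integral_dominated_convergence[where w="\<lambda>_. B"])
    show "AE \<omega> in P. (\<lambda>r. ?h r (U \<omega>)) \<longlonglongrightarrow> g (U \<omega>)"
      by (intro AE_I2 lipschitz_minorant_tendsto[where B=B] bdd cont U)
    show "AE \<omega> in P. norm (?h r (U \<omega>)) \<le> B" for r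
      using hb U by (intro AE_I2) simp
  qed (use U_meas cont hc in auto)
  then have "\<forall>\<^sub>F r in sequentially. (LINT \<omega>|P. g (U \<omega>)) - e / 2 < (LINT \<omega>|P. ?h r (U \<omega>))"
    using e by (intro order_tendstoD) auto
  then obtain r where r: "(LINT \<omega>|P. g (U \<omega>)) - e / 2 < (LINT \<omega>|P. ?h r (U \<omega>))"
    by (auto simp: eventually_sequentially)
  have "(\<lambda>n. LINT \<omega>|M. ?h r (V n \<omega>)) \<longlonglongrightarrow> (LINT \<omega>|P. ?h r (U \<omega>))"
    using hl hb by (intro lip[where K="real r" and B=B]) auto
  then have "\<forall>\<^sub>F n in sequentially. (LINT \<omega>|P. ?h r (U \<omega>)) - e / 2 < (LINT \<omega>|M. ?h r (V n \<omega>))"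
    using e by (intro order_tendstoD) auto
  then show ?thesis
  proof eventually_elim
    case (elim n)
    have "(LINT \<omega>|M. ?h r (V n \<omega>)) \<le> (LINT \<omega>|M. g (V n \<omega>))"
    proof (rule integral_mono)
      show "integrable M (\<lambda>\<omega>. ?h r (V n \<omega>))"
        using hb V by (intro M.integrable_const_bound[where B=B] V_meas hc AE_I2) simp
      show "integrable M (\<lambda>\<omega>. g (V n \<omega>))"
        using bdd V by (intro M.integrable_const_bound[where B=B] V_meas cont AE_I2) simp
      show "?h r (V n \<omega>) \<le> g (V n \<omega>)" if "\<omega> \<in> space M" for \<omega>
        using V that by (intro lipschitz_minorant_le[where B=B] bdd) auto
    qed
    then show ?case using elim r by linarith
  qed
qed

text \<open>The lower bound is applied to \<open>g\<close> and to \<open>- g\<close>.\<close>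

theorem convergence_of_lipschitz:
  assumes cont: "continuous_map (mtopology_of L) euclideanreal g" and bdd: "\<And>x. x \<in> mspace L \<Longrightarrow> \<bar>g x\<bar> \<le> B"
  shows "(\<lambda>n. LINT \<omega>|M. g (V n \<omega>)) \<longlonglongrightarrow> (LINT \<omega>|P. g (U \<omega>))"
proof (rule LIMSEQ_I)
  fix e :: real assume e: "0 < e"
  have "continuous_map (mtopology_of L) euclideanreal (\<lambda>x. - g x)"
    using cont by (rule continuous_map_minus)
  then have "\<forall>\<^sub>F n in sequentially. (LINT \<omega>|P. - g (U \<omega>)) - e < (LINT \<omega>|M. - g (V n \<omega>))"
    using bdd e by (intro eventually_lower_bound_of_lipschitz) auto
  moreover have "\<forall>\<^sub>F n in sequentially. (LINT \<omega>|P. g (U \<omega>)) - e < (LINT \<omega>|M. g (V n \<omega>))"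
    using assms e by (intro eventually_lower_bound_of_lipschitz)
  ultimately have "\<forall>\<^sub>F n in sequentially. norm ((LINT \<omega>|M. g (V n \<omega>)) - (LINT \<omega>|P. g (U \<omega>))) < e"
    by eventually_elim (auto simp: abs_less_iff)
  then show "\<exists>no. \<forall>n\<ge>no. norm ((LINT \<omega>|M. g (V n \<omega>)) - (LINT \<omega>|P. g (U \<omega>))) < e"
    by (simp add: eventually_sequentially)
qed

end

text \<open>An integrable function is its own least majorant.\<close>

lemma (in prob_space) outer_expectation_eq:
  assumes "integrable M f"
  shows "outer_expectation M f = expectation f"
  unfolding outer_expectation_def
proof (rule cInf_eq_minimum)
  show "expectation f \<in> {integral\<^sup>L M U |U. integrable M U \<and> (\<forall>\<omega>\<in>space M. f \<omega> \<le> U \<omega>)}"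
    using assms by auto
  show "expectation f \<le> z" if "z \<in> {integral\<^sup>L M U |U. integrable M U \<and> (\<forall>\<omega>\<in>space M. f \<omega> \<le> U \<omega>)}" for z
    using that assms by (auto intro!: integral_mono)
qed

section \<open>The empirical process\<close>

lemma borel_measurable_vec_lambda[measurable (raw)]:
  fixes f :: "'z \<Rightarrow> 'n::finite \<Rightarrow> 'v::euclidean_space"
  assumes "\<And>k. (\<lambda>z. f z k) \<in> borel_measurable N"
  shows "(\<lambda>z. \<chi> k. f z k) \<in> borel_measurable N"
proof -
  have "(\<chi> k. f z k) = (\<Sum>k\<in>UNIV. axis k (f z k))" for z
    by (simp add: vec_eq_iff axis_def sum.delta)
  moreover have "continuous_on UNIV (\<lambda>x. axis k x :: 'v^'n)" for k
    unfolding axis_def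
  proof (rule continuous_on_vec_lambda)
    show "continuous_on UNIV (\<lambda>x::'v. if i = k then x else 0)" for i by (cases "i = k") auto
  qed
  then have "(\<lambda>z. axis k (f z k) :: 'v^'n) \<in> borel_measurable N" for k
    using assms by (intro measurable_compose[OF assms borel_measurable_continuous_onI])
  ultimately show ?thesis by simp
qed

lemma borel_measurable_vec_nth'[measurable (raw)]:
  fixes f :: "'z \<Rightarrow> 'v::euclidean_space^'n"
  assumes "f \<in> borel_measurable N"
  shows "(\<lambda>z. f z $ k) \<in> borel_measurable N"
  by (rule measurable_compose[OF assms borel_measurable_continuous_onI]) (intro continuous_intros)

lemma norm_le_sum_entries:
  fixes x :: "real^'n^'m"
  shows "norm x \<le> (\<Sum>k\<in>UNIV. \<Sum>a\<in>UNIV. \<bar>x $ k $ a\<bar>)"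
proof -
  have "norm x \<le> (\<Sum>k\<in>UNIV. norm (x $ k))"
    unfolding norm_vec_def by (rule L2_set_le_sum) simp
  also have "\<dots> \<le> (\<Sum>k\<in>UNIV. \<Sum>a\<in>UNIV. \<bar>x $ k $ a\<bar>)"
    by (intro sum_mono norm_le_l1_cart)
  finally show ?thesis .
qed

definition Phi :: "real \<Rightarrow> (real^'d1) \<times> (real^'d2) \<Rightarrow> real^'d2^'d1" where
  "Phi t z = (\<chi> k. if fst z $ k \<le> t then snd z else 0)"

lemma measurable_Phi[measurable]: "Phi t \<in> borel_measurable borel"
  unfolding Phi_def[abs_def] by measurable

lemma norm_Phi_le: "norm (Phi t z :: real^'d2^'d1) \<le> CARD('d1) * norm (snd z)"
proof -
  have "norm (Phi t z :: real^'d2^'d1) \<le> (\<Sum>k\<in>UNIV. norm (Phi t z $ k :: real^'d2))"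
    unfolding norm_vec_def by (rule L2_set_le_sum) simp
  also have "\<dots> \<le> (\<Sum>k\<in>(UNIV::'d1 set). norm (snd z))"
    by (intro sum_mono) (simp add: Phi_def)
  finally show ?thesis by simp
qed

lemma inner_entries: "(x :: real^'n^'m) \<bullet> y = (\<Sum>k\<in>UNIV. \<Sum>a\<in>UNIV. x $ k $ a * y $ k $ a)"
  by (simp add: inner_vec_def)

lemma Phi_entry: "Phi t z $ k $ a = (if fst z $ k \<le> t then snd z $ a else 0)"
  by (simp add: Phi_def)

section \<open>The law of one observation: linear functionals and band variances\<close>

locale mean_zero_law = prob_space \<nu> for \<nu> :: "((real^'d1) \<times> (real^'d2)) measure" +
  assumes sets_law[measurable_cong]: "sets \<nu> = sets borel"
    and square_law: "integrable \<nu> (\<lambda>z. (norm (snd z))\<^sup>2)"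
    and marginal_law: "\<And>k t. 0 \<le> t \<Longrightarrow> t \<le> 1 \<Longrightarrow> measure \<nu> {z. fst z $ k \<le> t} = t"
    and zero_law: "\<And>k a s. (LINT z|\<nu>. (if fst z $ k \<le> s then snd z $ a else 0)) = 0"
begin

lemma measurable_law_fst[measurable]: "(\<lambda>z. fst z $ k) \<in> borel_measurable \<nu>"
  and measurable_law_snd[measurable]: "(\<lambda>z. snd z $ a) \<in> borel_measurable \<nu>"
proof -
  show "(\<lambda>z. fst z $ k) \<in> borel_measurable \<nu>" by measurable
  show "(\<lambda>z. snd z $ a) \<in> borel_measurable \<nu>" by measurable
qed

text \<open>The contribution of one observation to a linear functional of the process at the times
  \<tau>. Its second moment is the variance in the limit.\<close>

definition weighted :: "('i \<Rightarrow> real^'d2^'d1) \<Rightarrow> ('i \<Rightarrow> real) \<Rightarrow> 'i set \<Rightarrow> (real^'d1) \<times> (real^'d2) \<Rightarrow> real" where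
  "weighted a \<tau> F z = (\<Sum>i\<in>F. a i \<bullet> Phi (\<tau> i) z)"

lemma measurable_weighted: "weighted a \<tau> F \<in> borel_measurable borel"
  unfolding weighted_def[abs_def] by measurable

lemma measurable_law_weighted[measurable]: "weighted a \<tau> F \<in> borel_measurable \<nu>"
  using measurable_weighted by measurable

lemma weighted_le: "\<bar>weighted a \<tau> F z\<bar> \<le> (\<Sum>i\<in>F. norm (a i) * CARD('d1)) * norm (snd z)"
proof -
  have "\<bar>weighted a \<tau> F z\<bar> \<le> (\<Sum>i\<in>F. \<bar>a i \<bullet> Phi (\<tau> i) z\<bar>)"
    unfolding weighted_def by (rule sum_abs)
  also have "\<dots> \<le> (\<Sum>i\<in>F. norm (a i) * (CARD('d1) * norm (snd z)))"
    by (intro sum_mono order_trans[OF Cauchy_Schwarz_ineq2] mult_left_mono norm_Phi_le) simp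
  finally show ?thesis by (simp add: sum_distrib_right mult.assoc)
qed

lemma weighted_square_le: "(weighted a \<tau> F z)\<^sup>2 \<le> (\<Sum>i\<in>F. norm (a i) * CARD('d1))\<^sup>2 * (norm (snd z))\<^sup>2"
  using power_mono[OF weighted_le abs_ge_zero, of a \<tau> F z 2] by (simp add: power_mult_distrib)

lemma integrable_weighted_square: "integrable \<nu> (\<lambda>z. (weighted a \<tau> F z)\<^sup>2)"
proof (rule Bochner_Integration.integrable_bound)
  show "integrable \<nu> (\<lambda>z. (\<Sum>i\<in>F. norm (a i) * CARD('d1))\<^sup>2 * (norm (snd z))\<^sup>2)"
    using square_law by simp
  show "AE z in \<nu>. norm ((weighted a \<tau> F z)\<^sup>2) \<le> norm ((\<Sum>i\<in>F. norm (a i) * CARD('d1))\<^sup>2 * (norm (snd z))\<^sup>2)"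
    using weighted_square_le by (intro AE_I2) (simp add: abs_mult)
qed measurable

lemma integrable_entry_square: "integrable \<nu> (\<lambda>z. (snd z $ a)\<^sup>2)"
proof (rule Bochner_Integration.integrable_bound[OF square_law])
  show "AE z in \<nu>. norm ((snd z $ a)\<^sup>2) \<le> norm ((norm (snd z))\<^sup>2)"
    using power_mono[OF component_le_norm_cart abs_ge_zero, of _ a 2] by (intro AE_I2) simp
qed measurable

lemma integrable_entry: "integrable \<nu> (\<lambda>z. snd z $ a)"
  by (rule square_integrable_imp_integrable[OF measurable_law_snd integrable_entry_square])

lemma integrable_entry_le: "integrable \<nu> (\<lambda>z. if fst z $ k \<le> s then snd z $ a else 0)"
  by (rule Bochner_Integration.integrable_bound[OF integrable_entry[of a]]) auto

lemma expectation_weighted: "expectation (weighted a \<tau> F) = 0"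
proof -
  have "expectation (weighted a \<tau> F) = (\<Sum>i\<in>F. \<Sum>k\<in>UNIV. \<Sum>b\<in>UNIV. a i $ k $ b * (LINT z|\<nu>. Phi (\<tau> i) z $ k $ b))"
    unfolding weighted_def[abs_def] inner_entries Phi_entry
    by (subst Bochner_Integration.integral_sum)
       (auto intro!: sum.cong Bochner_Integration.integrable_sum integrable_entry_le integrable_mult_right
         simp: Bochner_Integration.integral_sum integrable_entry_le)
  then show ?thesis by (simp add: Phi_entry zero_law)
qed

definition band_variance :: "'d1 \<Rightarrow> 'd2 \<Rightarrow> real \<Rightarrow> real \<Rightarrow> real" where
  "band_variance k a u v = (LINT z|\<nu>. (strip u v (fst z $ k, snd z $ a))\<^sup>2)"

lemma integrable_band: "integrable \<nu> (\<lambda>z. (strip u v (fst z $ k, snd z $ a))\<^sup>2)"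
  by (rule Bochner_Integration.integrable_bound[OF integrable_entry_square[of a]])
     (auto simp: strip_def)

lemma band_variance_nonneg: "0 \<le> band_variance k a u v"
  unfolding band_variance_def by (rule Bochner_Integration.integral_nonneg) simp

lemma band_variance_sum:
  assumes "mono t"
  shows "(\<Sum>l<n. band_variance k a (t l) (t (Suc l))) = band_variance k a (t 0) (t n)"
proof (induction n)
  case 0
  have "strip (t 0) (t 0) p = 0" for p by (simp add: strip_def)
  then show ?case by (simp add: band_variance_def)
next
  case (Suc n)
  have "(strip (t 0) (t (Suc n)) p)\<^sup>2 = (strip (t 0) (t n) p)\<^sup>2 + (strip (t n) (t (Suc n)) p)\<^sup>2" for p
    using monoD[OF assms, of 0 n] monoD[OF assms, of n "Suc n"] by (auto simp: strip_def)
  then have "band_variance k a (t 0) (t (Suc n)) = band_variance k a (t 0) (t n) + band_variance k a (t n) (t (Suc n))"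
    unfolding band_variance_def using integrable_band by simp
  then show ?case using Suc by simp
qed

lemma AE_law_bounds: "AE z in \<nu>. 0 < fst z $ k \<and> fst z $ k \<le> 1"
proof -
  have sp: "space \<nu> = UNIV" using sets_eq_imp_space_eq[OF sets_law] by simp
  have "prob {z \<in> space \<nu>. fst z $ k \<le> 0} = 0" "prob {z \<in> space \<nu>. fst z $ k \<le> 1} = 1"
    using marginal_law[of 0 k] marginal_law[of 1 k] by (simp_all add: sp)
  then have "AE z in \<nu>. \<not> fst z $ k \<le> 0" "AE z in \<nu>. fst z $ k \<le> 1"
    by (auto simp: prob_Collect_eq_0 prob_Collect_eq_1)
  then show ?thesis by eventually_elim auto
qed

lemma measure_band:
  assumes "0 \<le> u" "u \<le> v" "v \<le> 1"
  shows "prob {z \<in> space \<nu>. u < fst z $ k \<and> fst z $ k \<le> v} = v - u"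
proof -
  have sp: "space \<nu> = UNIV" using sets_eq_imp_space_eq[OF sets_law] by simp
  have "prob ({z \<in> space \<nu>. fst z $ k \<le> v} - {z \<in> space \<nu>. fst z $ k \<le> u}) = v - u"
    using assms marginal_law[of u k] marginal_law[of v k] by (subst finite_measure_Diff) (auto simp: sp)
  moreover have "{z \<in> space \<nu>. fst z $ k \<le> v} - {z \<in> space \<nu>. fst z $ k \<le> u} = {z \<in> space \<nu>. u < fst z $ k \<and> fst z $ k \<le> v}"
    by auto
  ultimately show ?thesis by simp
qed

text \<open>Truncating the square of the response at level \<open>K\<close> bounds the variance of a band of width
  \<open>h\<close> by \<open>K h\<close> plus a tail that does not depend on the band.\<close>

lemma band_variance_uniformly_small:
  assumes "0 < e"
  obtains h where "0 < h" "\<And>u v. 0 \<le> u \<Longrightarrow> u \<le> v \<Longrightarrow> v \<le> 1 \<Longrightarrow> v - u \<le> h \<Longrightarrow> band_variance k a u v < e"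
proof -
  let ?f = "\<lambda>K z. max 0 ((snd z $ a)\<^sup>2 - real K)"
  have "(\<lambda>K. LINT z|\<nu>. ?f K z) \<longlonglongrightarrow> (LINT z|\<nu>. 0)"
  proof (rule integral_dominated_convergence[OF _ _ integrable_entry_square[of a]])
    show "AE z in \<nu>. (\<lambda>K. ?f K z) \<longlonglongrightarrow> 0"
    proof (rule AE_I2, rule tendsto_eventually)
      fix z :: "(real^'d1) \<times> (real^'d2)"
      obtain K :: nat where "(snd z $ a)\<^sup>2 \<le> real K" using real_arch_simple by blast
      then show "\<forall>\<^sub>F K in sequentially. ?f K z = 0"
        unfolding eventually_sequentially by (intro exI[of _ K]) auto
    qed
    show "AE z in \<nu>. norm (?f K z) \<le> (snd z $ a)\<^sup>2" for K by (rule AE_I2) auto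
  qed measurable
  then have "\<forall>\<^sub>F K in sequentially. (LINT z|\<nu>. ?f K z) < e / 2"
    using assms by (intro order_tendstoD) auto
  then obtain K where K: "(LINT z|\<nu>. ?f K z) < e / 2" by (auto simp: eventually_sequentially)
  have fint: "integrable \<nu> (?f K)"
    by (rule Bochner_Integration.integrable_bound[OF integrable_entry_square[of a]]) auto
  define h where "h = e / (2 * (real K + 1))"
  have "0 < h" using assms by (simp add: h_def)
  moreover have "band_variance k a u v < e" if "0 \<le> u" "u \<le> v" "v \<le> 1" "v - u \<le> h" for u v
  proof -
    let ?A = "{z \<in> space \<nu>. u < fst z $ k \<and> fst z $ k \<le> v}"
    have A: "?A \<in> sets \<nu>" by measurable
    have "band_variance k a u v \<le> (LINT z|\<nu>. real K * indicator ?A z + ?f K z)"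
      unfolding band_variance_def
    proof (rule integral_mono[OF integrable_band])
      show "integrable \<nu> (\<lambda>z. real K * indicator ?A z + ?f K z)"
        using A fint by (intro Bochner_Integration.integrable_add integrable_mult_right integrable_real_indicator)
          (auto simp: less_top[symmetric])
      show "(strip u v (fst z $ k, snd z $ a))\<^sup>2 \<le> real K * indicator ?A z + ?f K z" if "z \<in> space \<nu>" for z
        using that by (auto simp: strip_def indicator_def)
    qed
    also have "\<dots> = real K * prob ?A + (LINT z|\<nu>. ?f K z)"
      using A fint by (subst Bochner_Integration.integral_add) (auto simp: less_top[symmetric])
    also have "\<dots> < real K * h + e / 2"
      using measure_band[of u v k] that K by (intro add_le_less_mono mult_left_mono) auto
    also have "\<dots> \<le> e"
      using assms by (simp add: h_def field_simps)
    finally show ?thesis .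
  qed
  ultimately show ?thesis by (rule that)
qed

text \<open>A bound for the limit in \<open>n\<close> of the gauge expectations summed over the
  cells of level \<open>p\<close>; each term comes from
  \<open>half_minus_one_plus_exp_le\<close>.\<close>

definition gauge_bound :: "nat \<Rightarrow> 'd1 \<Rightarrow> 'd2 \<Rightarrow> real" where
  "gauge_bound p k a = (\<Sum>l<2^p. (band_variance k a (l / 2^p) (Suc l / 2^p))\<^sup>2 / 8)"

text \<open>A sum of squares is at most the largest term times the sum. The sum is the total
  variance, and the largest cell variance tends to 0.\<close>

lemma gauge_bound_tendsto: "(\<lambda>p. gauge_bound p k a) \<longlonglongrightarrow> 0"
proof (rule LIMSEQ_I)
  fix e :: real assume e: "0 < e"
  \<comment> \<open>Adding 1 avoids dividing by a total variance of 0.\<close>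
  define V where "V = band_variance k a 0 1 + 1"
  have V: "V > 0" using band_variance_nonneg[of k a 0 1] by (simp add: V_def)
  obtain h where h: "0 < h" "\<And>u v. 0 \<le> u \<Longrightarrow> u \<le> v \<Longrightarrow> v \<le> 1 \<Longrightarrow> v - u \<le> h \<Longrightarrow> band_variance k a u v < e / V"
    using band_variance_uniformly_small[of "e / V" k a] e V by auto
  obtain p0 where p0: "(1/2)^p0 < h" using real_arch_pow_inv[OF h(1), of "1/2"] by auto
  have "norm (gauge_bound p k a - 0) < e" if "p \<ge> p0" for p
  proof -
    let ?t = "\<lambda>l::nat. real l / 2^p"
    have mono: "mono ?t" by (auto intro!: monoI divide_right_mono)
    have "(1/2::real)^p \<le> (1/2)^p0" using that by (intro power_decreasing) auto
    then have width: "1 / 2^p \<le> h" using p0 by (simp add: power_divide)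
    have small: "band_variance k a (?t l) (?t (Suc l)) \<le> e / V" if "l < 2^p" for l
    proof (rule less_imp_le, rule h(2))
      have "Suc l \<le> 2^p" using that by simp
      then have "real (Suc l) \<le> 2^p" using of_nat_mono[of "Suc l" "2^p", where 'a=real] by simp
      then show "?t (Suc l) \<le> 1" by simp
      show "?t (Suc l) - ?t l \<le> h" using width by (simp add: field_simps)
    qed (auto simp: divide_right_mono)
    have "gauge_bound p k a \<le> (\<Sum>l<2^p. e / V * band_variance k a (?t l) (?t (Suc l)))"
      unfolding gauge_bound_def
    proof (rule sum_mono)
      fix l :: nat assume "l \<in> {..<2^p}"
      then have "(band_variance k a (?t l) (?t (Suc l)))\<^sup>2 \<le> e / V * band_variance k a (?t l) (?t (Suc l))"
        unfolding power2_eq_square using small[of l] by (intro mult_right_mono band_variance_nonneg) auto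
      then show "(band_variance k a (?t l) (?t (Suc l)))\<^sup>2 / 8 \<le> e / V * band_variance k a (?t l) (?t (Suc l))"
        using zero_le_power2[of "band_variance k a (?t l) (?t (Suc l))"] by linarith
    qed
    also have "\<dots> = e / V * band_variance k a (?t 0) (?t (2^p))"
      unfolding sum_distrib_left[symmetric] by (subst band_variance_sum[OF mono]) simp
    also have "\<dots> = e / V * band_variance k a 0 1" by simp
    also have "\<dots> < e / V * V" using e V by (intro mult_strict_left_mono) (auto simp: V_def)
    also have "\<dots> = e" using V by simp
    finally show ?thesis
      by (simp add: gauge_bound_def sum_nonneg)
  qed
  then show "\<exists>no. \<forall>p\<ge>no. norm (gauge_bound p k a - 0) < e" by blast
qed

end

section \<open>Independent observations and the normalized sums \<open>W n\<close>\<close>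

lemma (in prob_space) indep_vars_reindex_inj:
  assumes "inj_on f I" and indep: "indep_vars N V (f ` I)"
  shows "indep_vars (\<lambda>i. N (f i)) (\<lambda>i. V (f i)) I"
  unfolding indep_vars_def2
proof (intro conjI ballI)
  show "random_variable (N (f i)) (V (f i))" if "i \<in> I" for i
    using indep that by (auto simp: indep_vars_def2)
  show "indep_sets (\<lambda>i. {V (f i) -` A \<inter> space M |A. A \<in> sets (N (f i))}) I"
  proof (rule indep_setsI)
    show "{V (f i) -` A \<inter> space M |A. A \<in> sets (N (f i))} \<subseteq> events" if "i \<in> I" for i
      using indep that by (auto simp: indep_vars_def2 indep_sets_def)
    fix A J assume J: "J \<noteq> {}" "J \<subseteq> I" "finite J" and A: "\<forall>j\<in>J. A j \<in> {V (f j) -` A \<inter> space M |A. A \<in> sets (N (f j))}"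
    have inj: "inj_on f J" using assms(1) J(2) by (rule inj_on_subset)
    define B where "B j = A (the_inv_into J f j)" for j
    have B: "B (f j) = A j" if "j \<in> J" for j
      using that inj by (simp add: B_def the_inv_into_f_f)
    have "prob (\<Inter>j\<in>f ` J. B j) = (\<Prod>j\<in>f ` J. prob (B j))"
      using indep J A B unfolding indep_vars_def2 by (intro indep_setsD[of _ "f ` I"]) auto
    then show "prob (\<Inter>j\<in>J. A j) = (\<Prod>j\<in>J. prob (A j))"
      using inj B by (simp add: prod.reindex)
  qed
qed

locale copula_sample = prob_space M + law: mean_zero_law \<nu>
  for M :: "'a measure" and \<nu> :: "((real^'d1) \<times> (real^'d2)) measure" +
  fixes X :: "nat \<Rightarrow> 'a \<Rightarrow> real^'d1" and Y :: "nat \<Rightarrow> 'a \<Rightarrow> real^'d2"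
  assumes indep: "indep_vars (\<lambda>_. borel) (\<lambda>i \<omega>. (X i \<omega>, Y i \<omega>)) {1..}"
    and distr_law: "\<And>i. 1 \<le> i \<Longrightarrow> distr M borel (\<lambda>\<omega>. (X i \<omega>, Y i \<omega>)) = \<nu>"
    and rv_X[measurable]: "\<And>i. X i \<in> borel_measurable M"
    and rv_Y[measurable]: "\<And>i. Y i \<in> borel_measurable M"
begin

lemma rv_pair[measurable]: "(\<lambda>\<omega>. (X i \<omega>, Y i \<omega>)) \<in> borel_measurable M"
  by (rule borel_measurable_Pair) measurable

lemma law_transfer:
  fixes f :: "(real^'d1) \<times> (real^'d2) \<Rightarrow> 'c::{banach, second_countable_topology}"
  assumes "1 \<le> i" and "f \<in> borel_measurable borel"
  shows "expectation (\<lambda>\<omega>. f (X i \<omega>, Y i \<omega>)) = (LINT z|\<nu>. f z)"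
    and "integrable \<nu> f \<longleftrightarrow> integrable M (\<lambda>\<omega>. f (X i \<omega>, Y i \<omega>))"
proof -
  show "expectation (\<lambda>\<omega>. f (X i \<omega>, Y i \<omega>)) = (LINT z|\<nu>. f z)"
    unfolding distr_law[OF assms(1), symmetric] using assms(2) by (intro integral_distr[symmetric]) auto
  show "integrable \<nu> f \<longleftrightarrow> integrable M (\<lambda>\<omega>. f (X i \<omega>, Y i \<omega>))"
    unfolding distr_law[OF assms(1), symmetric] using assms(2) by (intro integrable_distr_eq) auto
qed

definition W :: "nat \<Rightarrow> real \<Rightarrow> 'a \<Rightarrow> real^'d2^'d1" where
  "W n t \<omega> = (1 / sqrt n) *\<^sub>R (\<Sum>i = 1..n. Phi t (X i \<omega>, Y i \<omega>))"

lemma rv_W[measurable]: "W n t \<in> borel_measurable M"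
proof -
  have "(\<lambda>\<omega>. Phi t (X i \<omega>, Y i \<omega>) :: real^'d2^'d1) \<in> borel_measurable M" for i
    by (rule measurable_compose[OF rv_pair measurable_Phi])
  then show ?thesis unfolding W_def[abs_def]
    by (intro borel_measurable_scaleR borel_measurable_sum) auto
qed

text \<open>A linear functional of \<open>W n\<close> is a normalized sum of independent copies of
  \<open>weighted a \<tau> F\<close>. The index is shifted by \<open>Suc\<close> because the sample
  starts at 1.\<close>

theorem W_char_convergence:
  "(\<lambda>n. CLINT \<omega>|M. iexp (\<Sum>i\<in>F. a i \<bullet> W n (\<tau> i) \<omega>))
     \<longlonglongrightarrow> complex_of_real (exp (- (LINT z|\<nu>. (law.weighted a \<tau> F z)\<^sup>2) / 2))"
proof -
  define h where "h = law.weighted a \<tau> F"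
  have h[measurable]: "h \<in> borel_measurable borel" unfolding h_def by (rule law.measurable_weighted)
  define \<zeta> where "\<zeta> i \<omega> = h (X (Suc i) \<omega>, Y (Suc i) \<omega>)" for i \<omega>
  have "indep_vars (\<lambda>_. borel) (\<lambda>i \<omega>. (X i \<omega>, Y i \<omega>)) (range Suc)"
    by (rule indep_vars_subset[OF indep]) auto
  then have "indep_vars (\<lambda>_. borel) (\<lambda>i \<omega>. (X (Suc i) \<omega>, Y (Suc i) \<omega>)) UNIV"
    by (rule indep_vars_reindex_inj[rotated]) simp
  then have ind: "indep_vars (\<lambda>_. borel) \<zeta> UNIV"
    unfolding \<zeta>_def[abs_def] by (rule indep_vars_compose2) (rule h)
  have mean: "expectation (\<zeta> i) = 0" for i
    unfolding \<zeta>_def using law_transfer(1)[of "Suc i" h] law.expectation_weighted h by (simp add: h_def)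
  have sq: "integrable M (\<lambda>\<omega>. (\<zeta> i \<omega>)\<^sup>2)" for i
    unfolding \<zeta>_def
  proof (rule law_transfer(2)[THEN iffD1, of "Suc i" "\<lambda>z. (h z)\<^sup>2"])
    show "(\<lambda>z. (h z)\<^sup>2) \<in> borel_measurable borel" by measurable
    show "integrable \<nu> (\<lambda>z. (h z)\<^sup>2)" unfolding h_def by (rule law.integrable_weighted_square)
  qed simp
  have dist: "distr M borel (\<zeta> i) = distr \<nu> borel h" for i
    unfolding \<zeta>_def distr_law[of "Suc i", symmetric, simplified] by (subst distr_distr) (auto simp: o_def)
  have "(LINT x|distr \<nu> borel h. x\<^sup>2) = (LINT z|\<nu>. (h z)\<^sup>2)"
    unfolding h_def by (subst integral_distr) auto
  moreover have "(\<Sum>i<n. \<zeta> i \<omega>) / sqrt n = (\<Sum>i\<in>F. a i \<bullet> W n (\<tau> i) \<omega>)" for n \<omega>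
  proof -
    have "(\<Sum>i<n. \<zeta> i \<omega>) = (\<Sum>i = 1..n. h (X i \<omega>, Y i \<omega>))"
      unfolding \<zeta>_def by (rule sum.reindex_bij_witness[where i="\<lambda>j. j - 1" and j=Suc]) auto
    also have "\<dots> = (\<Sum>i\<in>F. a i \<bullet> (\<Sum>j = 1..n. Phi (\<tau> i) (X j \<omega>, Y j \<omega>)))"
      unfolding h_def law.weighted_def by (subst sum.swap) (simp add: inner_sum_right)
    finally show ?thesis by (simp add: W_def sum_divide_distrib)
  qed
  ultimately show ?thesis
    using iid_char_convergence[OF ind mean sq dist] by (simp add: h_def)
qed

text \<open>Positions are the \<open>k\<close>-th coordinates. Dividing the marks by
  \<open>sqrt n\<close> makes the strip sums the increments of one entry of
  \<open>W n\<close>.\<close>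

lemma entry_strip_sums:
  "strip_sums M {1..n} (\<lambda>i \<omega>. (X i \<omega> $ k, Y i \<omega> $ a / sqrt n))"
proof
  show "finite {1..n}" by simp
  let ?g = "\<lambda>z :: (real^'d1) \<times> (real^'d2). (fst z $ k, snd z $ a / sqrt n)"
  have g: "?g \<in> borel_measurable borel"
    by (rule borel_measurable_continuous_onI) (auto intro!: continuous_intros simp: divide_inverse)
  have "indep_vars (\<lambda>_. borel) (\<lambda>i \<omega>. (X i \<omega>, Y i \<omega>)) {1..n}"
    by (rule indep_vars_subset[OF indep]) auto
  from indep_vars_compose2[OF this, of "\<lambda>_. ?g"] g
  show "indep_vars (\<lambda>_. borel) (\<lambda>i \<omega>. (X i \<omega> $ k, Y i \<omega> $ a / sqrt n)) {1..n}" by simp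
  fix i assume i: "i \<in> {1..n}"
  have snd_meas: "(\<lambda>z :: (real^'d1) \<times> (real^'d2). (snd z $ a)\<^sup>2) \<in> borel_measurable borel"
    by (rule borel_measurable_continuous_onI) (auto intro!: continuous_intros)
  show "integrable M (\<lambda>\<omega>. (snd (X i \<omega> $ k, Y i \<omega> $ a / sqrt n))\<^sup>2)"
    using law_transfer(2)[OF _ snd_meas, of i] law.integrable_entry_square[of a] i
    by (simp add: power_divide)
  fix s
  have meas: "(\<lambda>z :: (real^'d1) \<times> (real^'d2). if fst z $ k \<le> s then snd z $ a else 0) \<in> borel_measurable borel"
    by measurable
  have "expectation (\<lambda>\<omega>. if X i \<omega> $ k \<le> s then Y i \<omega> $ a / sqrt n else 0)
     = expectation (\<lambda>\<omega>. (if X i \<omega> $ k \<le> s then Y i \<omega> $ a else 0) / sqrt n)"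
    by (intro Bochner_Integration.integral_cong) auto
  then show "expectation (\<lambda>\<omega>. if fst (X i \<omega> $ k, Y i \<omega> $ a / sqrt n) \<le> s then snd (X i \<omega> $ k, Y i \<omega> $ a / sqrt n) else 0) = 0"
    using law_transfer(1)[OF _ meas, of i] law.zero_law[of k s a] i by (simp cong: if_cong)
qed

lemma W_entry_diff:
  assumes "u \<le> v"
  shows "W n v \<omega> $ k $ a - W n u \<omega> $ k $ a = (\<Sum>i = 1..n. strip u v (X i \<omega> $ k, Y i \<omega> $ a / sqrt n))"
  using assms unfolding W_def
  by (auto simp: sum_subtractf[symmetric] sum_divide_distrib Phi_entry strip_def intro!: sum.cong)

definition band_gauge :: "nat \<Rightarrow> 'd1 \<Rightarrow> 'd2 \<Rightarrow> real \<Rightarrow> real \<Rightarrow> real" where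
  "band_gauge n k a u v = expectation (\<lambda>\<omega>. cosine_gauge (W n v \<omega> $ k $ a - W n u \<omega> $ k $ a))"

lemma W_maximal_inequality:
  fixes t :: "nat \<Rightarrow> real"
  assumes t: "mono t" and e: "0 < e"
  shows "prob {\<omega>\<in>space M. \<exists>j\<le>m. e \<le> \<bar>W n (t j) \<omega> $ k $ a - W n (t 0) \<omega> $ k $ a\<bar>}
     \<le> band_gauge n k a (t 0) (t m) / cosine_gauge e"
proof -
  interpret S: strip_sums M "{1..n}" "\<lambda>i \<omega>. (X i \<omega> $ k, Y i \<omega> $ a / sqrt n)"
    by (rule entry_strip_sums)
  have eq: "S.strip_sum {1..n} (t 0) (t j) (\<lambda>i. (X i \<omega> $ k, Y i \<omega> $ a / sqrt n)) = W n (t j) \<omega> $ k $ a - W n (t 0) \<omega> $ k $ a" for j \<omega>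
    using W_entry_diff[OF monoD[OF t, of 0 j]] by (simp add: S.strip_sum_def)
  show ?thesis
    using S.maximal_inequality[OF t e, of m] cosine_gauge_pos[OF e]
    unfolding eq band_gauge_def by (simp add: field_simps)
qed

text \<open>The increment of an entry is a linear functional with weight 1 at \<open>v\<close> and
  -1 at \<open>u\<close>, so \<open>W_char_convergence\<close> gives the limit of the expected
  cosine; the variance part does not depend on \<open>n\<close> for positive
  \<open>n\<close>.\<close>

lemma band_gauge_tendsto:
  assumes uv: "u \<le> v"
  shows "(\<lambda>n. band_gauge n k a u v) \<longlonglongrightarrow>
     law.band_variance k a u v / 2 - 1 + exp (- law.band_variance k a u v / 2)"
proof -
  let ?V = "law.band_variance k a u v"
  let ?F = "{True, False}"
  let ?a = "\<lambda>b. if b then axis k (axis a 1) else - axis k (axis a 1) :: real^'d2^'d1"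
  let ?\<tau> = "\<lambda>b. if b then v else u"
  have w: "law.weighted ?a ?\<tau> ?F z = strip u v (fst z $ k, snd z $ a)" for z
    using uv by (auto simp: law.weighted_def inner_axis' Phi_entry strip_def)
  have "(\<lambda>n. CLINT \<omega>|M. iexp (\<Sum>b\<in>?F. ?a b \<bullet> W n (?\<tau> b) \<omega>)) \<longlonglongrightarrow> complex_of_real (exp (- ?V / 2))"
    using W_char_convergence[of ?a ?\<tau> ?F] unfolding w law.band_variance_def .
  moreover have "(\<Sum>b\<in>?F. ?a b \<bullet> W n (?\<tau> b) \<omega>) = W n v \<omega> $ k $ a - W n u \<omega> $ k $ a" for n \<omega>
    by (simp add: inner_axis')
  ultimately have "(\<lambda>n. CLINT \<omega>|M. iexp (W n v \<omega> $ k $ a - W n u \<omega> $ k $ a)) \<longlonglongrightarrow> complex_of_real (exp (- ?V / 2))"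
    by (simp only:)
  then have "(\<lambda>n. Re (CLINT \<omega>|M. iexp (W n v \<omega> $ k $ a - W n u \<omega> $ k $ a))) \<longlonglongrightarrow> Re (complex_of_real (exp (- ?V / 2)))"
    by (rule tendsto_Re)
  then have lim: "(\<lambda>n. ?V / 2 - 1 + Re (CLINT \<omega>|M. iexp (W n v \<omega> $ k $ a - W n u \<omega> $ k $ a))) \<longlonglongrightarrow> ?V / 2 - 1 + exp (- ?V / 2)"
    by (intro tendsto_add tendsto_const) (simp only: Re_complex_of_real)
  have "band_gauge n k a u v = ?V / 2 - 1 + Re (CLINT \<omega>|M. iexp (W n v \<omega> $ k $ a - W n u \<omega> $ k $ a))" if "0 < n" for n
  proof -
    interpret S: strip_sums M "{1..n}" "\<lambda>i \<omega>. (X i \<omega> $ k, Y i \<omega> $ a / sqrt n)"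
      by (rule entry_strip_sums)
    have eq: "S.strip_sum {1..n} u v (\<lambda>i. (X i \<omega> $ k, Y i \<omega> $ a / sqrt n)) = W n v \<omega> $ k $ a - W n u \<omega> $ k $ a" for \<omega>
      using W_entry_diff[OF uv] by (simp add: S.strip_sum_def)
    have meas: "(\<lambda>z :: (real^'d1) \<times> (real^'d2). (strip u v (fst z $ k, snd z $ a))\<^sup>2) \<in> borel_measurable borel"
      unfolding strip_def by measurable
    have "expectation (\<lambda>\<omega>. (strip u v (X i \<omega> $ k, Y i \<omega> $ a / sqrt n))\<^sup>2) = ?V / n" if "1 \<le> i" for i
    proof -
      have "(strip u v (X i \<omega> $ k, Y i \<omega> $ a / sqrt n))\<^sup>2 = (strip u v (X i \<omega> $ k, Y i \<omega> $ a))\<^sup>2 / n" for \<omega>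
        by (simp add: strip_def power_divide)
      then show ?thesis
        using law_transfer(1)[OF that meas] by (simp add: law.band_variance_def)
    qed
    then have "(\<Sum>i = 1..n. expectation (\<lambda>\<omega>. (strip u v (X i \<omega> $ k, Y i \<omega> $ a / sqrt n))\<^sup>2)) = ?V"
      using that by simp
    then show ?thesis
      using S.expectation_cosine_gauge[OF uv] unfolding eq band_gauge_def by simp
  qed
  then have "\<forall>\<^sub>F n in sequentially. ?V / 2 - 1 + Re (CLINT \<omega>|M. iexp (W n v \<omega> $ k $ a - W n u \<omega> $ k $ a)) = band_gauge n k a u v"
    unfolding eventually_sequentially by (intro exI[of _ 1]) auto
  with lim show ?thesis by (rule Lim_transform_eventually)
qed

text \<open>The second-order Taylor bound for the exponential at \<open>- x / 2\<close>. The linear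
  terms cancel, which leaves the squared variance.\<close>

lemma half_minus_one_plus_exp_le:
  fixes x :: real
  assumes "0 \<le> x"
  shows "x / 2 - 1 + exp (- x / 2) \<le> x\<^sup>2 / 8"
proof -
  define f where "f y = 1 + y + y\<^sup>2 / 2 - exp y" for y :: real
  have "f 0 \<le> f (- x / 2)"
  proof (rule DERIV_nonpos_imp_nonincreasing[of "- x / 2" 0 f])
    show "\<exists>d. DERIV f y :> d \<and> d \<le> 0" for y
    proof (intro exI conjI)
      show "DERIV f y :> 1 + y - exp y"
        unfolding f_def[abs_def] by (auto intro!: derivative_eq_intros)
      show "1 + y - exp y \<le> 0" using exp_ge_add_one_self[of y] by simp
    qed
  qed (use assms in simp)
  then show ?thesis by (simp add: f_def power_divide)
qed

text \<open>Only the dyadic subdivision points of the interval are tested, which keeps the event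
  measurable; right-continuity of \<open>W n\<close> recovers the other times.\<close>

definition osc_bad :: "nat \<Rightarrow> 'd1 \<Rightarrow> 'd2 \<Rightarrow> real \<Rightarrow> real \<Rightarrow> real \<Rightarrow> 'a set" where
  "osc_bad n k a u v e = {\<omega>\<in>space M. \<exists>q. \<exists>j\<le>2^q.
     e \<le> \<bar>W n (u + (v - u) * (real j / 2^q)) \<omega> $ k $ a - W n u \<omega> $ k $ a\<bar>}"

text \<open>For each subdivision the maximal inequality gives the same bound, and the events
  increase with the subdivision.\<close>

lemma osc_bad:
  assumes uv: "u \<le> v" and e: "0 < e"
  shows osc_bad_sets[measurable]: "osc_bad n k a u v e \<in> events"
    and prob_osc_bad: "prob (osc_bad n k a u v e) \<le> band_gauge n k a u v / cosine_gauge e"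
proof -
  define A where "A q = {\<omega>\<in>space M. \<exists>j\<le>2^q.
     e \<le> \<bar>W n (u + (v - u) * (real j / 2^q)) \<omega> $ k $ a - W n u \<omega> $ k $ a\<bar>}" for q :: nat
  have A_sets: "A q \<in> events" for q
  proof -
    have "A q = (\<Union>j\<in>{..2^q}. {\<omega>\<in>space M. e \<le> \<bar>W n (u + (v - u) * (real j / 2^q)) \<omega> $ k $ a - W n u \<omega> $ k $ a\<bar>})"
      by (auto simp: A_def)
    moreover have "{\<omega>\<in>space M. e \<le> \<bar>W n s \<omega> $ k $ a - W n u \<omega> $ k $ a\<bar>} \<in> events" for s
      by measurable
    ultimately show ?thesis by auto
  qed
  have A_prob: "prob (A q) \<le> band_gauge n k a u v / cosine_gauge e" for q
  proof -
    have "mono (\<lambda>j. u + (v - u) * (real j / 2^q))"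
      using uv by (intro monoI add_left_mono mult_left_mono divide_right_mono) auto
    from W_maximal_inequality[OF this e, of "2^q" n k a] show ?thesis by (simp add: A_def)
  qed
  have "incseq A"
  proof (rule incseq_SucI, rule subsetI)
    fix q \<omega> assume "\<omega> \<in> A q"
    then obtain j where j: "\<omega> \<in> space M" "j \<le> 2^q" "e \<le> \<bar>W n (u + (v - u) * (real j / 2^q)) \<omega> $ k $ a - W n u \<omega> $ k $ a\<bar>"
      by (auto simp: A_def)
    have "real (2 * j) / 2 ^ Suc q = real j / 2 ^ q" by simp
    then have "2 * j \<le> 2 ^ Suc q \<and> e \<le> \<bar>W n (u + (v - u) * (real (2 * j) / 2 ^ Suc q)) \<omega> $ k $ a - W n u \<omega> $ k $ a\<bar>"
      using j by (simp only:) simp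
    then show "\<omega> \<in> A (Suc q)"
      unfolding A_def using j(1) by blast
  qed
  have eq: "osc_bad n k a u v e = (\<Union>q. A q)" by (auto simp: osc_bad_def A_def)
  show "osc_bad n k a u v e \<in> events" unfolding eq using A_sets by auto
  have "(\<lambda>q. prob (A q)) \<longlonglongrightarrow> prob (\<Union>q. A q)"
    using A_sets \<open>incseq A\<close> by (intro finite_Lim_measure_incseq) auto
  then show "prob (osc_bad n k a u v e) \<le> band_gauge n k a u v / cosine_gauge e"
    unfolding eq by (rule LIMSEQ_le_const2) (use A_prob in auto)
qed

text \<open>The path jumps only at the finitely many sample coordinates, and an observation counts
  from its own coordinate on.\<close>

lemma W_right_locally_constant: "\<exists>d>0. \<forall>s. t \<le> s \<and> s < t + d \<longrightarrow> W n s \<omega> = W n t \<omega>"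
proof -
  let ?S = "(\<lambda>(i, k). X i \<omega> $ k) ` ({1..n} \<times> UNIV)"
  have "finite ?S" by simp
  from finite_set_avoid[OF this, of t]
  obtain d where d: "d > 0" "\<And>x. x \<in> ?S \<Longrightarrow> x \<noteq> t \<Longrightarrow> d \<le> dist t x" by blast
  have "W n s \<omega> = W n t \<omega>" if s: "t \<le> s" "s < t + d" for s
  proof -
    have "Phi s (X i \<omega>, Y i \<omega>) = (Phi t (X i \<omega>, Y i \<omega>) :: real^'d2^'d1)" if "i \<in> {1..n}" for i
    proof -
      have "X i \<omega> $ k \<le> s \<longleftrightarrow> X i \<omega> $ k \<le> t" for k
      proof -
        have "X i \<omega> $ k \<in> ?S" using that by force
        from d(2)[OF this] s show ?thesis
          by (cases "X i \<omega> $ k = t") (auto simp: dist_real_def abs_if split: if_splits)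
      qed
      then show ?thesis by (simp add: Phi_def)
    qed
    then have "(\<Sum>i = 1..n. Phi s (X i \<omega>, Y i \<omega>)) = (\<Sum>i = 1..n. Phi t (X i \<omega>, Y i \<omega>) :: real^'d2^'d1)"
      by (rule sum.cong[OF refl])
    then show ?thesis by (simp only: W_def)
  qed
  then show ?thesis using d(1) by blast
qed

lemma W_diff_less_of_not_osc_bad:
  assumes \<omega>: "\<omega> \<in> space M" "\<omega> \<notin> osc_bad n k a u v e" and e: "0 < e" and t: "u \<le> t" "t \<le> v"
  shows "\<bar>W n t \<omega> $ k $ a - W n u \<omega> $ k $ a\<bar> < e"
proof (cases "u = v")
  case True
  then show ?thesis using t e by simp
next
  case False
  then have uv: "u < v" using t by simp
  obtain d where d: "d > 0" "\<And>s. t \<le> s \<Longrightarrow> s < t + d \<Longrightarrow> W n s \<omega> = W n t \<omega>"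
    using W_right_locally_constant[of t n \<omega>] by auto
  obtain q where q: "(1/2)^q < d / (v - u)" using real_arch_pow_inv[of "d / (v - u)" "1/2"] d(1) uv by auto
  define r where "r = (t - u) / (v - u)"
  have r: "0 \<le> r" "r \<le> 1" "u + (v - u) * r = t" using t uv by (auto simp: r_def)
  \<comment> \<open>Rounding up places the subdivision point to the right of \<open>t\<close>, where
    \<open>W n\<close> still has the value it has at \<open>t\<close>.\<close>
  define j where "j = nat \<lceil>2^q * r\<rceil>"
  have j: "2^q * r \<le> real j" "real j < 2^q * r + 1"
    unfolding j_def using r by (auto simp: of_nat_nat ceiling_correct) linarith
  have "\<lceil>2^q * r\<rceil> \<le> 2^q" using r by (auto simp: ceiling_le_iff mult_left_le)
  then have "j \<le> 2^q" by (simp add: j_def nat_le_iff)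
  have jr: "r \<le> real j / 2^q" "real j / 2^q < r + (1/2)^q"
    using j by (simp_all add: field_simps power_divide)
  let ?s = "u + (v - u) * (real j / 2^q)"
  have "t \<le> ?s" using r(3) mult_left_mono[OF jr(1), of "v - u"] uv by linarith
  moreover have "?s < t + d"
  proof -
    have "(v - u) * (real j / 2^q) < (v - u) * (r + (1/2)^q)" using jr uv by (intro mult_strict_left_mono) auto
    also have "\<dots> = (v - u) * r + (v - u) * (1/2)^q" by (simp add: algebra_simps)
    also have "\<dots> < (v - u) * r + d" using q uv by (simp add: field_simps)
    finally show ?thesis using r by linarith
  qed
  ultimately have "W n ?s \<omega> = W n t \<omega>" by (rule d(2))
  moreover have "\<not> e \<le> \<bar>W n ?s \<omega> $ k $ a - W n u \<omega> $ k $ a\<bar>"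
    using \<omega> \<open>j \<le> 2^q\<close> unfolding osc_bad_def by blast
  ultimately show ?thesis by simp
qed

section \<open>Ties, counts at grid points, and the exceptional event\<close>

definition degenerate :: "nat \<Rightarrow> 'a set" where
  "degenerate n = {\<omega>\<in>space M. \<exists>k. \<exists>i\<in>{1..n}. \<not> (0 < X i \<omega> $ k \<and> X i \<omega> $ k \<le> 1) \<or>
      (\<exists>j\<in>{1..n}. i \<noteq> j \<and> X i \<omega> $ k = X j \<omega> $ k)}"

lemma AE_X_bounds:
  assumes "1 \<le> i"
  shows "AE \<omega> in M. 0 < X i \<omega> $ k \<and> X i \<omega> $ k \<le> 1"
proof -
  have "AE z in distr M borel (\<lambda>\<omega>. (X i \<omega>, Y i \<omega>)). 0 < fst z $ k \<and> fst z $ k \<le> 1"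
    using law.AE_law_bounds[of k] unfolding distr_law[OF assms] .
  then show ?thesis by (subst (asm) AE_distr_iff) auto
qed

text \<open>Cut the unit interval into \<open>N\<close> bands of width \<open>1 / N\<close>. Two
  independent uniform points share a band with probability \<open>N * (1 / N)\<^sup>2\<close>, which
  tends to 0.\<close>

lemma AE_no_tie:
  assumes ij: "1 \<le> i" "1 \<le> j" "i \<noteq> j"
  shows "AE \<omega> in M. X i \<omega> $ k \<noteq> X j \<omega> $ k"
proof -
  let ?T = "{\<omega>\<in>space M. X i \<omega> $ k = X j \<omega> $ k}"
  have T: "?T \<in> events" by measurable
  have le: "prob ?T \<le> 1 / real N" if N: "0 < N" for N :: nat
  proof -
    let ?B = "\<lambda>l. {z :: (real^'d1) \<times> (real^'d2). real l / N < fst z $ k \<and> fst z $ k \<le> (real l + 1) / N}"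
    let ?E = "\<lambda>l. \<Inter>h\<in>{i, j}. (\<lambda>\<omega>. (X h \<omega>, Y h \<omega>)) -` ?B l \<inter> space M"
    have B: "?B l \<in> sets borel" for l by measurable
    have E: "?E l \<in> events" for l
      by (intro sets.finite_INT measurable_sets[OF rv_pair B]) auto
    have pB: "prob ((\<lambda>\<omega>. (X h \<omega>, Y h \<omega>)) -` ?B l \<inter> space M) = 1 / N" if "1 \<le> h" "l < N" for h l
    proof -
      have "prob ((\<lambda>\<omega>. (X h \<omega>, Y h \<omega>)) -` ?B l \<inter> space M) = measure \<nu> (?B l)"
        unfolding distr_law[OF that(1), symmetric] using B by (subst measure_distr) auto
      also have "\<dots> = (real l + 1) / N - real l / N"
      proof -
        have "real l + 1 \<le> N" using that(2) by linarith
        then have "(real l + 1) / N \<le> 1" using N by simp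
        then show ?thesis
          using law.measure_band[of "real l / N" "(real l + 1) / N" k] sets_eq_imp_space_eq[OF law.sets_law] N
          by (simp add: divide_right_mono)
      qed
      finally show ?thesis using N by (simp add: field_simps)
    qed
    have "prob ?T \<le> prob (\<Union>l\<in>{..<N}. ?E l)"
    proof (rule finite_measure_mono_AE)
      show "AE \<omega> in M. \<omega> \<in> ?T \<longrightarrow> \<omega> \<in> (\<Union>l\<in>{..<N}. ?E l)"
        using AE_X_bounds[OF ij(1), of k]
      proof eventually_elim
        case (elim \<omega>)
        show ?case
        proof
          assume T: "\<omega> \<in> ?T"
          \<comment> \<open>The ceiling minus 1 fits bands that are open on the left and closed on
            the right.\<close>
          define l where "l = nat (\<lceil>N * (X i \<omega> $ k)\<rceil> - 1)"
          have pos: "0 < N * (X i \<omega> $ k)" using elim N by simp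
          then have l: "real l < N * (X i \<omega> $ k)" "N * (X i \<omega> $ k) \<le> real l + 1"
            unfolding l_def by (auto simp: of_nat_nat) linarith+
          have "N * (X i \<omega> $ k) \<le> N" using elim by (intro mult_left_le) auto
          then have "l < N" using l(1) by linarith
          moreover have "\<omega> \<in> ?E l" using T l N by (auto simp: field_simps)
          ultimately show "\<omega> \<in> (\<Union>l\<in>{..<N}. ?E l)" by blast
        qed
      qed
    qed (use E in auto)
    also have "\<dots> \<le> (\<Sum>l<N. prob (?E l))" using E by (intro finite_measure_subadditive_finite) auto
    also have "\<dots> = (\<Sum>l<N. (1 / N)\<^sup>2)"
    proof (rule sum.cong[OF refl])
      fix l assume "l \<in> {..<N}"
      have "prob (?E l) = (\<Prod>h\<in>{i, j}. prob ((\<lambda>\<omega>. (X h \<omega>, Y h \<omega>)) -` ?B l \<inter> space M))"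
        using ij B by (intro indep_varsD[OF indep]) auto
      also have "\<dots> = (\<Prod>h\<in>{i, j}. 1 / N)"
        using pB \<open>l \<in> {..<N}\<close> ij by (intro prod.cong) auto
      finally show "prob (?E l) = (1 / N)\<^sup>2" using ij by (simp add: power2_eq_square)
    qed
    also have "\<dots> = 1 / N" using N by (simp add: power2_eq_square)
    finally show ?thesis .
  qed
  have "prob ?T \<le> 0"
  proof (rule LIMSEQ_le_const)
    show "(\<lambda>N. 1 / real (Suc N)) \<longlonglongrightarrow> 0" using LIMSEQ_inverse_real_of_nat by (simp add: inverse_eq_divide)
    show "\<exists>N. \<forall>n\<ge>N. prob ?T \<le> 1 / real (Suc n)" using le by blast
  qed
  then have "prob ?T = 0" by (simp add: measure_le_0_iff)
  then show ?thesis using T by (simp add: prob_Collect_eq_0)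
qed

lemma degenerate_null: "degenerate n \<in> null_sets M"
proof -
  have sets: "degenerate n \<in> events" unfolding degenerate_def by measurable
  have "AE \<omega> in M. \<forall>k\<in>UNIV. \<forall>i\<in>{1..n}. (0 < X i \<omega> $ k \<and> X i \<omega> $ k \<le> 1) \<and>
      (\<forall>j\<in>{1..n}. i \<noteq> j \<longrightarrow> X i \<omega> $ k \<noteq> X j \<omega> $ k)"
    using AE_X_bounds AE_no_tie by (intro AE_finite_allI AE_conjI AE_impI) auto
  then have "AE \<omega> in M. \<omega> \<notin> degenerate n"
    by eventually_elim (auto simp: degenerate_def)
  then show ?thesis using AE_iff_null_sets[OF sets] by simp
qed

definition count_dev :: "nat \<Rightarrow> 'd1 \<Rightarrow> real \<Rightarrow> 'a \<Rightarrow> real" where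
  "count_dev n k s \<omega> = \<bar>real (card {i\<in>{1..n}. X i \<omega> $ k \<le> s}) - n * s\<bar>"

lemma count_dev_eq: "count_dev n k s \<omega> = \<bar>\<Sum>i = 1..n. (if X i \<omega> $ k \<le> s then 1 else 0) - s\<bar>"
  unfolding count_dev_def by (simp add: sum_subtractf flip: sum.inter_filter)

lemma rv_count_dev[measurable]: "count_dev n k s \<in> borel_measurable M"
  unfolding count_dev_eq[abs_def] by measurable

text \<open>Chebyshev's inequality: the count is a sum of independent indicators, so its variance is
  at most \<open>n\<close>.\<close>

lemma prob_count_dev:
  fixes N :: nat
  assumes s: "0 \<le> s" "s \<le> 1" and n: "0 < n" and N: "0 < N"
  shows "prob {\<omega>\<in>space M. n / N < count_dev n k s \<omega>} \<le> N\<^sup>2 / n"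
proof -
  define D where "D i \<omega> = (if X i \<omega> $ k \<le> s then 1 else 0) - s" for i \<omega>
  have D[measurable]: "D i \<in> borel_measurable M" for i unfolding D_def by measurable
  have D1: "\<bar>D i \<omega>\<bar> \<le> 1" for i \<omega> using s by (auto simp: D_def)
  have intD: "integrable M (D i)" for i
    by (rule integrable_const_bound[where B=1]) (use D1 in auto)
  have sqD: "integrable M (\<lambda>\<omega>. (D i \<omega>)\<^sup>2)" "(D i \<omega>)\<^sup>2 \<le> 1" for i \<omega>
  proof -
    show *: "(D i \<omega>)\<^sup>2 \<le> 1" for i \<omega> using power_mono[OF D1 abs_ge_zero, of i \<omega> 2] by simp
    show "integrable M (\<lambda>\<omega>. (D i \<omega>)\<^sup>2)"
      by (rule integrable_const_bound[where B=1]) (use * in auto)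
  qed
  have ED: "expectation (D i) = 0" if "1 \<le> i" for i
  proof -
    have sp: "space \<nu> = UNIV" using sets_eq_imp_space_eq[OF law.sets_law] by simp
    have "{\<omega>\<in>space M. X i \<omega> $ k \<le> s} \<in> events" by measurable
    moreover have "prob {\<omega>\<in>space M. X i \<omega> $ k \<le> s} = s"
    proof -
      have "{z :: (real^'d1) \<times> (real^'d2). fst z $ k \<le> s} \<in> sets borel" by measurable
      then have "measure \<nu> {z. fst z $ k \<le> s} = prob ((\<lambda>\<omega>. (X i \<omega>, Y i \<omega>)) -` {z. fst z $ k \<le> s} \<inter> space M)"
        unfolding distr_law[OF that, symmetric] by (subst measure_distr) auto
      also have "(\<lambda>\<omega>. (X i \<omega>, Y i \<omega>)) -` {z. fst z $ k \<le> s} \<inter> space M = {\<omega>\<in>space M. X i \<omega> $ k \<le> s}" by auto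
      finally show ?thesis using law.marginal_law[OF s] by simp
    qed
    moreover have "expectation (D i) = expectation (\<lambda>\<omega>. indicator {\<omega>\<in>space M. X i \<omega> $ k \<le> s} \<omega> - s)"
      by (intro Bochner_Integration.integral_cong) (auto simp: D_def)
    ultimately show ?thesis by (simp add: prob_space less_top[symmetric])
  qed
  \<comment> \<open>The centered indicators are treated as marks at the constant position 0, so the
    variance identity for strip sums applies on the strip from -1 to 0.\<close>
  interpret S: strip_sums M "{1..n}" "\<lambda>i \<omega>. (0, D i \<omega>)"
  proof
    have ind: "indep_vars (\<lambda>_. borel) (\<lambda>i \<omega>. (X i \<omega>, Y i \<omega>)) {1..n}"
      by (rule indep_vars_subset[OF indep]) auto
    define f where "f z = (0::real, (if fst z $ k \<le> s then 1 else 0) - s)" for z :: "(real^'d1) \<times> (real^'d2)"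
    have f: "f \<in> borel_measurable borel"
      unfolding f_def[abs_def] by (rule borel_measurable_Pair) measurable
    have "indep_vars (\<lambda>_. borel) (\<lambda>i \<omega>. f (X i \<omega>, Y i \<omega>)) {1..n}"
      by (rule indep_vars_compose2[OF ind f])
    then show "indep_vars (\<lambda>_. borel) (\<lambda>i \<omega>. (0::real, D i \<omega>)) {1..n}"
      by (simp only: f_def D_def fst_conv)
    show "expectation (\<lambda>\<omega>. if fst (0::real, D i \<omega>) \<le> s' then snd (0::real, D i \<omega>) else 0) = 0" if "i \<in> {1..n}" for i s'
      using ED[of i] that by (cases "0 \<le> s'") auto
  qed (use sqD in auto)
  have sum_eq: "S.strip_sum {1..n} (-1) 0 (\<lambda>i. (0, D i \<omega>)) = (\<Sum>i = 1..n. D i \<omega>)" for \<omega>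
    by (simp add: S.strip_sum_def strip_def)
  have "expectation (\<lambda>\<omega>. (\<Sum>i = 1..n. D i \<omega>)\<^sup>2) = (\<Sum>i = 1..n. expectation (\<lambda>\<omega>. (D i \<omega>)\<^sup>2))"
    using S.expectation_strip_sum_square[of "-1" 0] unfolding sum_eq by (simp add: strip_def)
  also have "\<dots> \<le> (\<Sum>i = 1..n. 1)"
    using sqD by (intro sum_mono integral_le_const) auto
  finally have var: "expectation (\<lambda>\<omega>. (\<Sum>i = 1..n. D i \<omega>)\<^sup>2) \<le> n" by simp
  have "prob {\<omega>\<in>space M. n / N < count_dev n k s \<omega>} \<le> prob {\<omega>\<in>space M. (n / N)\<^sup>2 \<le> (\<Sum>i = 1..n. D i \<omega>)\<^sup>2}"
  proof (rule finite_measure_mono)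
    show "{\<omega>\<in>space M. n / N < count_dev n k s \<omega>} \<subseteq> {\<omega>\<in>space M. (n / N)\<^sup>2 \<le> (\<Sum>i = 1..n. D i \<omega>)\<^sup>2}"
    proof clarify
      fix \<omega> assume "n / N < count_dev n k s \<omega>"
      then have "n / N \<le> \<bar>\<Sum>i = 1..n. D i \<omega>\<bar>" unfolding count_dev_eq D_def by simp
      from power_mono[OF this, of 2] show "(n / N)\<^sup>2 \<le> (\<Sum>i = 1..n. D i \<omega>)\<^sup>2" by simp
    qed
  qed measurable
  also have "\<dots> \<le> expectation (\<lambda>\<omega>. (\<Sum>i = 1..n. D i \<omega>)\<^sup>2) / (n / N)\<^sup>2"
  proof (rule integral_Markov_inequality_measure[where A="{}"])
    show "integrable M (\<lambda>\<omega>. (\<Sum>i = 1..n. D i \<omega>)\<^sup>2)"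
      using sqD by (intro integrable_square_sum) auto
  qed (use n N in auto)
  also have "\<dots> \<le> n / (n / N)\<^sup>2"
    using var by (rule divide_right_mono) simp
  also have "\<dots> = N\<^sup>2 / n" using n N by (simp add: power2_eq_square field_simps)
  finally show ?thesis .
qed

text \<open>Off this event the cells of level \<open>p\<close> have small oscillation, the grid
  counts satisfy the hypothesis of \<open>order_statistic_location\<close> with
  \<open>N = 2^p\<close>, and ranks are well defined.\<close>

definition bad :: "nat \<Rightarrow> nat \<Rightarrow> real \<Rightarrow> 'a set" where
  "bad n p e = (\<Union>k. \<Union>a. \<Union>l<2^p. osc_bad n k a (real l / 2^p) (real (Suc l) / 2^p) e) \<union>
     (\<Union>k. \<Union>l\<le>2^p. {\<omega>\<in>space M. n / 2^p < count_dev n k (real l / 2^p) \<omega>}) \<union> degenerate n"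

lemma bad_sets[measurable]: "0 < e \<Longrightarrow> bad n p e \<in> events"
proof -
  assume e: "0 < e"
  have "osc_bad n k a (real l / 2^p) (real (Suc l) / 2^p) e \<in> events" for k a l
    using e by (intro osc_bad_sets) (auto simp: divide_right_mono)
  moreover have "{\<omega>\<in>space M. n / 2^p < count_dev n k (real l / 2^p) \<omega>} \<in> events" for k l
    by measurable
  moreover have "degenerate n \<in> events" using degenerate_null by auto
  ultimately show ?thesis unfolding bad_def by (intro sets.Un sets.finite_UN) auto
qed

lemma prob_bad_le:
  assumes e: "0 < e" and n: "0 < n"
  shows "prob (bad n p e) \<le> (\<Sum>k\<in>UNIV. \<Sum>a\<in>UNIV. \<Sum>l<2^p. band_gauge n k a (real l / 2^p) (real (Suc l) / 2^p) / cosine_gauge e)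
      + (\<Sum>k\<in>(UNIV::'d1 set). \<Sum>l\<le>(2::nat)^p. real (2^p)^2 / n)"
proof -
  let ?O = "\<lambda>k a l. osc_bad n k a (real l / 2^p) (real (Suc l) / 2^p) e"
  let ?C = "\<lambda>k l. {\<omega>\<in>space M. n / 2^p < count_dev n k (real l / 2^p) \<omega>}"
  have O: "?O k a l \<in> events" "prob (?O k a l) \<le> band_gauge n k a (real l / 2^p) (real (Suc l) / 2^p) / cosine_gauge e" for k a l
    using e by (auto intro!: osc_bad_sets prob_osc_bad simp: divide_right_mono)
  have C: "?C k l \<in> events" for k l by measurable
  have pC: "prob (?C k l) \<le> real (2^p)^2 / n" if "l \<le> 2^p" for k l
  proof -
    have "real l \<le> 2^p" using of_nat_mono[OF that, where 'a=real] by simp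
    then have "prob {\<omega>\<in>space M. n / real (2^p) < count_dev n k (real l / 2^p) \<omega>} \<le> real (2^p)^2 / n"
      using n prob_count_dev[of "real l / 2^p" n "2^p" k] by simp
    then show ?thesis by simp
  qed
  have "prob (bad n p e) \<le> prob ((\<Union>k. \<Union>a. \<Union>l<2^p. ?O k a l) \<union> (\<Union>k. \<Union>l\<le>2^p. ?C k l)) + prob (degenerate n)"
    unfolding bad_def using O C null_setsD2[OF degenerate_null]
    by (intro measure_Un_le sets.Un sets.finite_UN) auto
  also have "prob (degenerate n) = 0" using degenerate_null by (simp add: measure_eq_0_null_sets)
  also have "prob ((\<Union>k. \<Union>a. \<Union>l<2^p. ?O k a l) \<union> (\<Union>k. \<Union>l\<le>2^p. ?C k l))
      \<le> prob (\<Union>k. \<Union>a. \<Union>l<2^p. ?O k a l) + prob (\<Union>k. \<Union>l\<le>2^p. ?C k l)"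
    using O C by (intro measure_Un_le sets.finite_UN) auto
  also have "prob (\<Union>k. \<Union>l\<le>2^p. ?C k l) \<le> (\<Sum>k\<in>UNIV. prob (\<Union>l\<le>2^p. ?C k l))"
    using C by (intro finite_measure_subadditive_finite) auto
  also have "\<dots> \<le> (\<Sum>k\<in>(UNIV::'d1 set). \<Sum>l\<le>(2::nat)^p. prob (?C k l))"
    using C by (intro sum_mono finite_measure_subadditive_finite) auto
  also have "\<dots> \<le> (\<Sum>k\<in>(UNIV::'d1 set). \<Sum>l\<le>(2::nat)^p. real (2^p)^2 / n)"
    using pC by (intro sum_mono) auto
  also have "prob (\<Union>k. \<Union>a. \<Union>l<2^p. ?O k a l) \<le> (\<Sum>k\<in>UNIV. prob (\<Union>a. \<Union>l<2^p. ?O k a l))"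
    using O by (intro finite_measure_subadditive_finite) (auto intro!: sets.finite_UN)
  also have "\<dots> \<le> (\<Sum>k\<in>UNIV. \<Sum>a\<in>UNIV. prob (\<Union>l<2^p. ?O k a l))"
    using O by (intro sum_mono finite_measure_subadditive_finite) auto
  also have "\<dots> \<le> (\<Sum>k\<in>UNIV. \<Sum>a\<in>UNIV. \<Sum>l<2^p. prob (?O k a l))"
    using O by (intro sum_mono finite_measure_subadditive_finite) auto
  also have "\<dots> \<le> (\<Sum>k\<in>UNIV. \<Sum>a\<in>UNIV. \<Sum>l<2^p. band_gauge n k a (real l / 2^p) (real (Suc l) / 2^p) / cosine_gauge e)"
    using O by (intro sum_mono) auto
  finally show ?thesis by simp
qed

definition bad_limit :: "nat \<Rightarrow> real \<Rightarrow> real" where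
  "bad_limit p e = (\<Sum>k\<in>UNIV. \<Sum>a\<in>UNIV. law.gauge_bound p k a / cosine_gauge e)"

lemma bad_limit_tendsto: "(\<lambda>p. bad_limit p e) \<longlonglongrightarrow> 0"
proof -
  have "(\<lambda>p. bad_limit p e) \<longlonglongrightarrow> (\<Sum>k\<in>(UNIV::'d1 set). \<Sum>a\<in>(UNIV::'d2 set). 0 / cosine_gauge e)"
    unfolding bad_limit_def divide_inverse by (intro tendsto_sum tendsto_mult tendsto_const law.gauge_bound_tendsto)
  then show ?thesis by simp
qed

text \<open>At fixed \<open>p\<close> the count deviations have probability of order
  \<open>1 / n\<close>, so only the gauge terms remain in the limit.\<close>

theorem eventually_prob_bad_less:
  assumes e: "0 < e" and d: "0 < d"
  shows "\<forall>\<^sub>F n in sequentially. prob (bad n p e) < bad_limit p e + d"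
proof -
  let ?v = "\<lambda>k a l. law.band_variance k a (real l / 2^p) (real (Suc l) / 2^p)"
  let ?r = "\<lambda>n. (\<Sum>k\<in>UNIV. \<Sum>a\<in>UNIV. \<Sum>l<2^p. band_gauge n k a (real l / 2^p) (real (Suc l) / 2^p) / cosine_gauge e)
      + (\<Sum>k\<in>(UNIV::'d1 set). \<Sum>l\<le>(2::nat)^p. real (2^p)^2 / n)"
  let ?R = "(\<Sum>k\<in>UNIV. \<Sum>a\<in>UNIV. \<Sum>l<2^p. (?v k a l / 2 - 1 + exp (- ?v k a l / 2)) / cosine_gauge e)
      + (\<Sum>k\<in>(UNIV::'d1 set). \<Sum>l\<le>(2::nat)^p. 0)"
  have cg: "0 < cosine_gauge e" using e by (rule cosine_gauge_pos)
  have "?r \<longlonglongrightarrow> ?R"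
    using cg by (intro tendsto_add tendsto_sum tendsto_divide tendsto_const band_gauge_tendsto lim_const_over_n)
      (auto simp: divide_right_mono)
  moreover have "?R \<le> bad_limit p e"
  proof -
    have "(\<Sum>l<2^p. (?v k a l / 2 - 1 + exp (- ?v k a l / 2)) / cosine_gauge e) \<le> law.gauge_bound p k a / cosine_gauge e" for k a
      unfolding law.gauge_bound_def sum_divide_distrib
      using cg by (intro sum_mono divide_right_mono half_minus_one_plus_exp_le law.band_variance_nonneg) auto
    then show ?thesis unfolding bad_limit_def by (auto intro!: sum_mono)
  qed
  ultimately have "\<forall>\<^sub>F n in sequentially. ?r n < bad_limit p e + d"
    using d by (intro order_tendstoD(2)) auto
  then show ?thesis using eventually_gt_at_top[of 0]
  proof eventually_elim
    case (elim n)
    then show ?case using prob_bad_le[OF e, of n p] by linarith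
  qed
qed

text \<open>Off the bad event, the induced process at time \<open>t\<close> is \<open>W n\<close> at an order statistic, and that
  order statistic lies within two dyadic cells of \<open>t\<close>.\<close>

theorem induced_sum_process_approx:
  fixes e t :: real
  assumes \<omega>: "\<omega> \<in> space M" "\<omega> \<notin> bad n p e" and e: "0 < e" and n: "2^p \<le> n" and t: "0 \<le> t" "t \<le> 1"
  shows "norm ((1 / sqrt n) *\<^sub>R induced_sum_process X Y n \<omega> t - W n (real (nat \<lfloor>2^p * t\<rfloor>) / 2^p) \<omega>)
     \<le> CARD('d1) * (CARD('d2) * (5 * e))"
proof -
  have nondeg: "\<omega> \<notin> degenerate n" using \<omega> by (auto simp: bad_def)
  have entry: "\<bar>((1 / sqrt n) *\<^sub>R induced_sum_process X Y n \<omega> t - W n (real (nat \<lfloor>2^p * t\<rfloor>) / 2^p) \<omega>) $ k $ a\<bar> \<le> 5 * e" for k a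
  proof -
    let ?x = "\<lambda>i. X i \<omega> $ k"
    define m where "m = nat \<lfloor>n * t\<rfloor>"
    have pos: "0 < ?x i \<and> ?x i \<le> 1" if "i \<in> {1..n}" for i
      using nondeg \<omega>(1) that unfolding degenerate_def by blast
    have inj: "inj_on ?x {1..n}"
      using nondeg \<omega>(1) unfolding degenerate_def inj_on_def by blast
    have "n * t \<le> n" using t by (simp add: mult_left_le)
    then have "m \<le> n" unfolding m_def by linarith
    from induced_order_stat_sum[OF inj _ this, of "\<lambda>i. Y i \<omega>"] pos
    obtain \<xi> where \<xi>: "0 \<le> \<xi>" "\<xi> = 0 \<or> \<xi> \<in> ?x ` {1..n}" "card {i\<in>{1..n}. ?x i \<le> \<xi>} = m"
      "(\<Sum>j = 1..m. induced_order_stat ?x (\<lambda>i. Y i \<omega>) n j) = (\<Sum>i = 1..n. if ?x i \<le> \<xi> then Y i \<omega> else 0)"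
      by blast
    have \<xi>1: "\<xi> \<le> 1" using \<xi>(2) pos by auto
    have eq: "((1 / sqrt n) *\<^sub>R induced_sum_process X Y n \<omega> t) $ k $ a = W n \<xi> \<omega> $ k $ a"
      unfolding induced_sum_process_def m_def[symmetric] using \<xi>(4) by (simp add: W_def Phi_def cong: if_cong)
    have "\<bar>\<xi> - real (nat \<lfloor>real (2^p) * t\<rfloor>) / real (2^p)\<bar> \<le> 2 / real (2^p)"
    proof (rule order_statistic_location[OF _ n t \<xi>(1) \<xi>1])
      show "\<bar>real (card {i\<in>{1..n}. ?x i \<le> real l / real (2^p)}) - n * (real l / real (2^p))\<bar> \<le> n / real (2^p)" if "l \<le> 2^p" for l
      proof -
        have "\<omega> \<notin> {\<omega>\<in>space M. n / 2^p < count_dev n k (real l / 2^p) \<omega>}"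
          using \<omega>(2) that unfolding bad_def by blast
        then show ?thesis using \<omega>(1) by (simp add: count_dev_def)
      qed
      show "card {i\<in>{1..n}. ?x i \<le> \<xi>} = nat \<lfloor>n * t\<rfloor>" using \<xi>(3) by (simp add: m_def)
    qed simp
    moreover have "nat \<lfloor>real (2^p) * t\<rfloor> \<le> 2^p"
    proof -
      have "real (2^p) * t \<le> real (2^p)" using t by (simp add: mult_left_le)
      then show ?thesis by linarith
    qed
    ultimately have "norm (W n \<xi> \<omega> $ k $ a - W n (real (nat \<lfloor>real (2^p) * t\<rfloor>) / real (2^p)) \<omega> $ k $ a) \<le> 5 * e"
    proof (intro oscillation_chain[where w="\<lambda>s. W n s \<omega> $ k $ a" and N="2^p"] \<xi>(1) \<xi>1)
      fix j :: nat and u assume j: "j < 2^p" "real j / real (2^p) \<le> u" "u \<le> (real j + 1) / real (2^p)"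
      have "\<omega> \<notin> osc_bad n k a (real j / 2^p) (real (Suc j) / 2^p) e"
        using \<omega>(2) j(1) unfolding bad_def by blast
      from W_diff_less_of_not_osc_bad[OF \<omega>(1) this e, of u] j
      show "norm (W n u \<omega> $ k $ a - W n (real j / real (2^p)) \<omega> $ k $ a) \<le> e"
        by (simp add: add.commute)
    qed auto
    then show ?thesis using eq by simp
  qed
  have "norm ((1 / sqrt n) *\<^sub>R induced_sum_process X Y n \<omega> t - W n (real (nat \<lfloor>2^p * t\<rfloor>) / 2^p) \<omega>)
    \<le> (\<Sum>k\<in>(UNIV::'d1 set). \<Sum>a\<in>(UNIV::'d2 set). 5 * e)"
    by (rule order_trans[OF norm_le_sum_entries]) (intro sum_mono entry)
  then show ?thesis by simp
qed

lemma W_oscillation: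
  fixes e t :: real
  assumes \<omega>: "\<omega> \<in> space M" "\<omega> \<notin> bad n p e" and e: "0 < e" and l: "l < 2^p"
    and t: "real l / 2^p \<le> t" "t \<le> real (Suc l) / 2^p"
  shows "norm (W n t \<omega> - W n (real l / 2^p) \<omega>) \<le> CARD('d1) * (CARD('d2) * e)"
proof -
  have "\<bar>(W n t \<omega> - W n (real l / 2^p) \<omega>) $ k $ a\<bar> \<le> e" for k a
  proof -
    have "\<omega> \<notin> osc_bad n k a (real l / 2^p) (real (Suc l) / 2^p) e"
      using \<omega>(2) l unfolding bad_def by blast
    from W_diff_less_of_not_osc_bad[OF \<omega>(1) this e t] show ?thesis by simp
  qed
  then have "norm (W n t \<omega> - W n (real l / 2^p) \<omega>) \<le> (\<Sum>k\<in>(UNIV::'d1 set). \<Sum>a\<in>(UNIV::'d2 set). e)"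
    by (intro order_trans[OF norm_le_sum_entries] sum_mono)
  then show ?thesis by simp
qed

end

section \<open>Gaussian sequences with prescribed covariance\<close>

locale square_integrable_seq =
  fixes N :: "'z measure" and h :: "nat \<Rightarrow> 'z \<Rightarrow> real"
  assumes h_meas[measurable]: "\<And>j. h j \<in> borel_measurable N"
    and h_sq: "\<And>j. integrable N (\<lambda>z. (h j z)\<^sup>2)"
begin

definition ip :: "('z \<Rightarrow> real) \<Rightarrow> ('z \<Rightarrow> real) \<Rightarrow> real" where
  "ip f g = (LINT z|N. f z * g z)"

definition L2 :: "('z \<Rightarrow> real) \<Rightarrow> bool" where
  "L2 f \<longleftrightarrow> f \<in> borel_measurable N \<and> integrable N (\<lambda>z. (f z)\<^sup>2)"

lemma L2_prod: "L2 f \<Longrightarrow> L2 g \<Longrightarrow> integrable N (\<lambda>z. f z * g z)"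
  unfolding L2_def
proof (elim conjE, rule Bochner_Integration.integrable_bound)
  assume fg: "f \<in> borel_measurable N" "g \<in> borel_measurable N"
    "integrable N (\<lambda>z. (f z)\<^sup>2)" "integrable N (\<lambda>z. (g z)\<^sup>2)"
  show "integrable N (\<lambda>z. (f z)\<^sup>2 + (g z)\<^sup>2)" using fg by simp
  show "(\<lambda>z. f z * g z) \<in> borel_measurable N" using fg by simp
  have "\<bar>x * y\<bar> \<le> x\<^sup>2 + y\<^sup>2" for x y :: real
    using sum_squares_bound[of x y] sum_squares_bound[of x "-y"] zero_le_power2[of x] zero_le_power2[of y]
    by (simp add: abs_le_iff)
  then show "AE z in N. norm (f z * g z) \<le> norm ((f z)\<^sup>2 + (g z)\<^sup>2)" by simp
qed

lemma L2_add: "L2 f \<Longrightarrow> L2 g \<Longrightarrow> L2 (\<lambda>z. f z + g z)"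
  using L2_prod[of f g] unfolding L2_def power2_sum
  by (intro conjI borel_measurable_add Bochner_Integration.integrable_add) (auto simp: mult.assoc)

lemma L2_cmult: "L2 f \<Longrightarrow> L2 (\<lambda>z. a * f z)"
  unfolding L2_def power_mult_distrib by (intro conjI borel_measurable_times integrable_mult_right) auto

lemma L2_sum: "finite A \<Longrightarrow> (\<And>i. i \<in> A \<Longrightarrow> L2 (f i)) \<Longrightarrow> L2 (\<lambda>z. \<Sum>i\<in>A. f i z)"
  by (induction A rule: finite_induct) (auto simp: L2_add, simp add: L2_def)

lemma L2_h: "L2 (h j)"
  by (simp add: L2_def h_sq)

lemma ip_sym: "ip f g = ip g f"
  by (simp add: ip_def mult.commute)

lemma ip_cmult: "ip (\<lambda>z. a * f z) g = a * ip f g"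
  by (simp add: ip_def mult.assoc)

lemma ip_sum:
  assumes "finite A" "\<And>i. i \<in> A \<Longrightarrow> L2 (f i)" "L2 g"
  shows "ip (\<lambda>z. \<Sum>i\<in>A. a i * f i z) g = (\<Sum>i\<in>A. a i * ip (f i) g)"
  unfolding ip_def sum_distrib_right
  by (subst Bochner_Integration.integral_sum) (auto simp: mult.assoc intro!: integrable_mult_right L2_prod assms)

lemma ip_diff:
  assumes "L2 f" "L2 f'" "L2 g"
  shows "ip (\<lambda>z. f z - f' z) g = ip f g - ip f' g"
  unfolding ip_def left_diff_distrib by (rule Bochner_Integration.integral_diff; rule L2_prod; rule assms)

text \<open>Linear dependence is allowed: if the residual has norm 0, then division by 0 yields 0
  and the new function is identically 0.\<close>

fun gs :: "nat \<Rightarrow> 'z \<Rightarrow> real" where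
  "gs j = (let r = (\<lambda>z. h j z - (\<Sum>i\<leftarrow>[0..<j]. ip (h j) (gs i) * gs i z))
           in (\<lambda>z. 1 / sqrt (ip r r) * r z))"

declare gs.simps[simp del]

definition res :: "nat \<Rightarrow> 'z \<Rightarrow> real" where
  "res j z = h j z - (\<Sum>i<j. ip (h j) (gs i) * gs i z)"

lemma gs_eq: "gs j = (\<lambda>z. 1 / sqrt (ip (res j) (res j)) * res j z)"
proof -
  have "res j = (\<lambda>z. h j z - (\<Sum>i\<leftarrow>[0..<j]. ip (h j) (gs i) * gs i z))"
    unfolding res_def[abs_def] by (simp add: interv_sum_list_conv_sum_set_nat lessThan_atLeast0)
  then show ?thesis by (subst gs.simps) (simp add: Let_def)
qed

lemma L2_gs: "L2 (gs j)"
proof (induction j rule: less_induct)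
  case (less j)
  have "L2 (\<lambda>z. \<Sum>i<j. ip (h j) (gs i) * gs i z)"
    by (rule L2_sum) (auto intro!: L2_cmult less)
  from L2_add[OF L2_h[of j] L2_cmult[OF this, of "-1"]]
  have "L2 (res j)" by (simp add: res_def[abs_def])
  then show ?case unfolding gs_eq by (rule L2_cmult)
qed

lemma L2_res: "L2 (res j)"
proof -
  have "L2 (\<lambda>z. \<Sum>i<j. ip (h j) (gs i) * gs i z)"
    by (rule L2_sum) (auto intro!: L2_cmult L2_gs)
  from L2_add[OF L2_h[of j] L2_cmult[OF this, of "-1"]]
  show ?thesis by (simp add: res_def[abs_def])
qed

definition proper :: "nat \<Rightarrow> bool" where
  "proper j \<longleftrightarrow> ip (res j) (res j) \<noteq> 0"

lemma gs_not_proper: "\<not> proper j \<Longrightarrow> gs j = (\<lambda>_. 0)"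
  by (simp add: gs_eq proper_def)

lemma ip_self_nonneg: "0 \<le> ip f f"
  unfolding ip_def by (rule Bochner_Integration.integral_nonneg) simp

lemma gs_norm: "ip (gs j) (gs j) = (if proper j then 1 else 0)"
proof (cases "proper j")
  case True
  let ?n = "ip (res j) (res j)"
  have n: "0 < ?n" using True ip_self_nonneg[of "res j"] by (simp add: proper_def)
  have "ip (gs j) (gs j) = 1 / sqrt ?n * ip (res j) (gs j)"
    by (subst gs_eq) (rule ip_cmult)
  also have "ip (res j) (gs j) = 1 / sqrt ?n * ?n"
    by (subst ip_sym, subst gs_eq) (rule ip_cmult)
  also have "1 / sqrt ?n * (1 / sqrt ?n * ?n) = 1"
    using n by (simp add: real_sqrt_mult[symmetric] field_simps)
  finally show ?thesis using True by simp
next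
  case False
  then show ?thesis by (simp add: gs_not_proper ip_def)
qed

lemma gs_orth: "i < j \<Longrightarrow> ip (gs j) (gs i) = 0"
proof (induction j arbitrary: i rule: less_induct)
  case (less j)
  have orth: "ip (gs a) (gs b) = (if a = b \<and> proper a then 1 else 0)" if "a < j" "b < j" for a b
    using less.IH[of a b] less.IH[of b a] that gs_norm[of a] ip_sym[of "gs a" "gs b"]
    by (cases a b rule: linorder_cases) auto
  have "ip (res j) (gs i) = ip (h j) (gs i) - ip (\<lambda>z. \<Sum>l<j. ip (h j) (gs l) * gs l z) (gs i)"
    unfolding res_def[abs_def] by (rule ip_diff) (auto intro!: L2_h L2_gs L2_sum L2_cmult)
  also have "ip (\<lambda>z. \<Sum>l<j. ip (h j) (gs l) * gs l z) (gs i) = (\<Sum>l<j. ip (h j) (gs l) * ip (gs l) (gs i))"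
    by (rule ip_sum) (auto intro!: L2_gs)
  also have "\<dots> = (\<Sum>l<j. if l = i then (if proper i then ip (h j) (gs i) else 0) else 0)"
    using less.prems by (intro sum.cong) (auto simp: orth)
  also have "\<dots> = (if proper i then ip (h j) (gs i) else 0)" using less.prems by (simp add: sum.delta)
  \<comment> \<open>If \<open>i\<close> is not proper, \<open>gs i\<close> is the zero function, so
    the coefficient that was not subtracted is 0 anyway.\<close>
  also have "ip (h j) (gs i) - \<dots> = 0" by (cases "proper i") (auto simp: gs_not_proper ip_def)
  finally show ?case by (simp only: gs_eq[of j] ip_cmult mult_zero_right)
qed

lemma gs_ip: "ip (gs i) (gs j) = (if i = j \<and> proper i then 1 else 0)"
  using gs_orth[of i j] gs_orth[of j i] gs_norm[of i] ip_sym[of "gs i" "gs j"]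
  by (cases i j rule: linorder_cases) auto

text \<open>The coordinates of \<open>h j\<close> in the Gram-Schmidt family, that is, a lower
  triangular Cholesky factor of the Gram matrix.\<close>

definition coef :: "nat \<Rightarrow> nat \<Rightarrow> real" where
  "coef j i = (if i < j then ip (h j) (gs i) else if i = j then sqrt (ip (res j) (res j)) else 0)"

lemma coef_zero: "j < i \<Longrightarrow> coef j i = 0" by (simp add: coef_def)

lemma coef_not_proper: "\<not> proper i \<Longrightarrow> coef j i = 0"
  by (cases "i = j") (simp_all add: coef_def gs_not_proper ip_def proper_def)

text \<open>A residual of norm 0 vanishes only almost everywhere, hence the form of the
  statement.\<close>

lemma h_expansion: "AE z in N. h j z = (\<Sum>i\<le>j. coef j i * gs i z)"
proof -
  have "AE z in N. res j z = sqrt (ip (res j) (res j)) * gs j z"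
  proof (cases "proper j")
    case True
    then have "sqrt (ip (res j) (res j)) \<noteq> 0" using ip_self_nonneg[of "res j"] by (simp add: proper_def)
    then show ?thesis by (subst gs_eq) simp
  next
    case False
    then have "(LINT z|N. (res j z)\<^sup>2) = 0" by (simp add: proper_def ip_def power2_eq_square)
    then have "AE z in N. (res j z)\<^sup>2 = 0"
      using L2_res[of j] by (subst (asm) integral_nonneg_eq_0_iff_AE) (auto simp: L2_def)
    then show ?thesis using False by (simp add: gs_not_proper)
  qed
  then show ?thesis
  proof eventually_elim
    case (elim z)
    have "(\<Sum>i\<le>j. coef j i * gs i z) = (\<Sum>i<j. ip (h j) (gs i) * gs i z) + sqrt (ip (res j) (res j)) * gs j z"
      by (simp add: lessThan_Suc_atMost[symmetric] coef_def)
    then show ?case using elim by (simp add: res_def)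
  qed
qed

text \<open>Orthonormality of the proper members; coefficients on improper ones are 0. The bound
  \<open>L\<close> serves as a common length for both expansions.\<close>

theorem ip_h:
  assumes "i \<le> L" "j \<le> L"
  shows "ip (h i) (h j) = (\<Sum>l\<le>L. coef i l * coef j l)"
proof -
  have ext: "(\<Sum>l\<le>i. coef i l * gs l z) = (\<Sum>l\<le>L. coef i l * gs l z)" if "i \<le> L" for i z
    using that by (intro sum.mono_neutral_left) (auto simp: coef_zero)
  have ae: "AE z in N. h i z = (\<Sum>l\<le>L. coef i l * gs l z)" if "i \<le> L" for i
    using h_expansion[of i] ext[OF that] by simp
  have L2s: "L2 (\<lambda>z. \<Sum>l\<le>L. coef i l * gs l z)" for i
    by (rule L2_sum) (auto intro!: L2_cmult L2_gs)
  have "ip (h i) (h j) = ip (\<lambda>z. \<Sum>l\<le>L. coef i l * gs l z) (\<lambda>z. \<Sum>l\<le>L. coef j l * gs l z)"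
    unfolding ip_def
  proof (rule integral_cong_AE)
    show "AE z in N. h i z * h j z = (\<Sum>l\<le>L. coef i l * gs l z) * (\<Sum>l\<le>L. coef j l * gs l z)"
      using ae[OF assms(1)] ae[OF assms(2)] by eventually_elim simp
    show "(\<lambda>z. (\<Sum>l\<le>L. coef i l * gs l z) * (\<Sum>l\<le>L. coef j l * gs l z)) \<in> borel_measurable N"
      using L2s unfolding L2_def by (intro borel_measurable_times) auto
  qed simp
  also have "\<dots> = (\<Sum>l\<le>L. coef i l * ip (gs l) (\<lambda>z. \<Sum>l\<le>L. coef j l * gs l z))"
    by (rule ip_sum) (auto intro!: L2_gs L2s)
  also have "\<dots> = (\<Sum>l\<le>L. coef i l * (\<Sum>m\<le>L. coef j m * ip (gs m) (gs l)))"
  proof (intro sum.cong refl arg_cong2[where f="(*)"])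
    fix l
    show "ip (gs l) (\<lambda>z. \<Sum>l\<le>L. coef j l * gs l z) = (\<Sum>m\<le>L. coef j m * ip (gs m) (gs l))"
      by (subst ip_sym) (intro ip_sum L2_gs finite_atMost)
  qed
  also have "\<dots> = (\<Sum>l\<le>L. coef i l * (\<Sum>m\<le>L. if m = l then coef j l else 0))"
    by (intro sum.cong refl arg_cong2[where f="(*)"]) (auto simp: gs_ip coef_not_proper)
  also have "\<dots> = (\<Sum>l\<le>L. coef i l * coef j l)" by (simp add: sum.delta)
  finally show ?thesis .
qed

end

locale gaussian_sequence = square_integrable_seq N h + prob_space P
  for N :: "'z measure" and h :: "nat \<Rightarrow> 'z \<Rightarrow> real" and P :: "'p measure" +
  fixes \<xi> :: "nat \<Rightarrow> 'p \<Rightarrow> real"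
  assumes \<xi>_indep: "indep_vars (\<lambda>_. borel) \<xi> UNIV"
    and \<xi>_distr: "\<And>n. distr P borel (\<xi> n) = std_normal_distribution"
begin

text \<open>The expansion of \<open>h j\<close> with the orthonormal functions replaced by
  independent standard normal variables, so that inner products become covariances.\<close>

definition G :: "nat \<Rightarrow> 'p \<Rightarrow> real" where
  "G j \<omega> = (\<Sum>l\<le>j. coef j l * \<xi> l \<omega>)"

lemma rv_\<xi>[measurable]: "\<xi> n \<in> borel_measurable P"
  using \<xi>_indep by (simp add: indep_vars_def2)

lemma rv_G[measurable]: "G j \<in> borel_measurable P"
  unfolding G_def[abs_def] by measurable

text \<open>Independence factorizes the characteristic function, and \<open>ip_h\<close> identifies
  the sum of squared coefficients as a second moment under \<open>N\<close>. The map
  \<open>j\<close> need not be injective.\<close>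

theorem G_char:
  fixes j :: "'x \<Rightarrow> nat"
  assumes "finite A"
  shows "(CLINT \<omega>|P. iexp (\<Sum>x\<in>A. b x * G (j x) \<omega>)) = complex_of_real (exp (- (LINT z|N. (\<Sum>x\<in>A. b x * h (j x) z)\<^sup>2) / 2))"
proof -
  define L where "L = Max (insert 0 (j ` A))"
  have L: "j x \<le> L" if "x \<in> A" for x
    unfolding L_def using assms that by (intro Max_ge) auto
  define \<beta> where "\<beta> l = (\<Sum>x\<in>A. b x * coef (j x) l)" for l
  have "(\<Sum>x\<in>A. b x * G (j x) \<omega>) = (\<Sum>l\<le>L. \<beta> l * \<xi> l \<omega>)" for \<omega>
  proof -
    have "G (j x) \<omega> = (\<Sum>l\<le>L. coef (j x) l * \<xi> l \<omega>)" if "x \<in> A" for x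
      unfolding G_def using L[OF that] by (intro sum.mono_neutral_left) (auto simp: coef_zero)
    then have "(\<Sum>x\<in>A. b x * G (j x) \<omega>) = (\<Sum>x\<in>A. \<Sum>l\<le>L. b x * coef (j x) l * \<xi> l \<omega>)"
      by (simp add: sum_distrib_left mult.assoc)
    also have "\<dots> = (\<Sum>l\<le>L. \<beta> l * \<xi> l \<omega>)"
      by (subst sum.swap) (simp add: \<beta>_def sum_distrib_right)
    finally show ?thesis .
  qed
  then have "(CLINT \<omega>|P. iexp (\<Sum>x\<in>A. b x * G (j x) \<omega>)) = char (distr P borel (\<lambda>\<omega>. \<Sum>l\<le>L. \<beta> l * \<xi> l \<omega>)) 1"
    by (simp add: char_def integral_distr)
  also have "\<dots> = (\<Prod>l\<le>L. char (distr P borel (\<lambda>\<omega>. \<beta> l * \<xi> l \<omega>)) 1)"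
    by (intro char_distr_sum indep_vars_compose2[OF indep_vars_subset[OF \<xi>_indep]]) auto
  also have "\<dots> = (\<Prod>l\<le>L. complex_of_real (exp (- (\<beta> l)\<^sup>2 / 2)))"
  proof (rule prod.cong[OF refl])
    fix l
    have "char (distr P borel (\<lambda>\<omega>. \<beta> l * \<xi> l \<omega>)) 1 = char (distr P borel (\<xi> l)) (\<beta> l)"
      by (simp add: char_def integral_distr)
    then show "char (distr P borel (\<lambda>\<omega>. \<beta> l * \<xi> l \<omega>)) 1 = complex_of_real (exp (- (\<beta> l)\<^sup>2 / 2))"
      by (simp add: \<xi>_distr char_std_normal_distribution)
  qed
  also have "\<dots> = complex_of_real (exp (- (\<Sum>l\<le>L. (\<beta> l)\<^sup>2) / 2))"
    by (simp add: exp_sum[symmetric] sum_negf sum_divide_distrib flip: of_real_prod)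
  also have "(\<Sum>l\<le>L. (\<beta> l)\<^sup>2) = (LINT z|N. (\<Sum>x\<in>A. b x * h (j x) z)\<^sup>2)"
  proof -
    have "(LINT z|N. (\<Sum>x\<in>A. b x * h (j x) z)\<^sup>2) = ip (\<lambda>z. \<Sum>x\<in>A. b x * h (j x) z) (\<lambda>z. \<Sum>x\<in>A. b x * h (j x) z)"
      by (simp add: ip_def power2_eq_square)
    also have "\<dots> = (\<Sum>x\<in>A. b x * ip (h (j x)) (\<lambda>z. \<Sum>x\<in>A. b x * h (j x) z))"
      using assms by (intro ip_sum L2_sum L2_cmult L2_h)
    also have "\<dots> = (\<Sum>x\<in>A. b x * (\<Sum>y\<in>A. b y * ip (h (j y)) (h (j x))))"
    proof (intro sum.cong refl arg_cong2[where f="(*)"])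
      fix x
      show "ip (h (j x)) (\<lambda>z. \<Sum>x\<in>A. b x * h (j x) z) = (\<Sum>y\<in>A. b y * ip (h (j y)) (h (j x)))"
        using assms by (subst ip_sym) (intro ip_sum L2_h)
    qed
    also have "\<dots> = (\<Sum>x\<in>A. \<Sum>y\<in>A. \<Sum>l\<le>L. (b x * coef (j x) l) * (b y * coef (j y) l))"
      using ip_h[OF L L] by (simp add: sum_distrib_left mult_ac)
    also have "\<dots> = (\<Sum>l\<le>L. \<Sum>x\<in>A. \<Sum>y\<in>A. (b x * coef (j x) l) * (b y * coef (j y) l))"
      by (subst sum.swap[of _ "{..L}"]) (intro sum.cong refl sum.swap)
    also have "\<dots> = (\<Sum>l\<le>L. (\<beta> l)\<^sup>2)"
      by (simp add: \<beta>_def power2_eq_square sum_product)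
    finally show ?thesis by simp
  qed
  finally show ?thesis .
qed

end

text \<open>The type of the sample space is the one demanded for the limit law; only the coordinates at
  the natural numbers are used.\<close>

lemma ex_iid_std_normal:
  fixes b :: "'v::euclidean_space"
  assumes b: "norm b = 1"
  shows "\<exists>(P :: (real \<Rightarrow> 'v) measure) \<xi>. prob_space P \<and> prob_space.indep_vars P (\<lambda>_. borel) \<xi> (UNIV :: nat set) \<and>
     (\<forall>n. distr P borel (\<xi> n) = std_normal_distribution)"
proof -
  \<comment> \<open>A scalar normal law carried by the line through \<open>b\<close>; since
    \<open>b\<close> has norm 1, the inner product with \<open>b\<close> recovers the
    scalar.\<close>
  define Q where "Q = distr std_normal_distribution borel (\<lambda>x. x *\<^sub>R b)"
  have Q: "prob_space Q" unfolding Q_def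
    by (intro prob_space.prob_space_distr prob_space_normal_density) auto
  have Q_sets: "sets Q = sets borel" by (simp add: Q_def)
  define P where "P = (\<Pi>\<^sub>M t\<in>(UNIV :: real set). Q)"
  interpret Q: prob_space Q by fact
  interpret PP: product_prob_space "\<lambda>_::real. Q" UNIV ..
  interpret P: prob_space P unfolding P_def by (rule PP.prob_space_axioms)
  have "P.indep_vars (\<lambda>_. Q) (\<lambda>t \<omega>. \<omega> t) UNIV"
  proof (subst P.indep_vars_iff_distr_eq_PiM)
    have "distr P (PiM UNIV (\<lambda>_. Q)) (\<lambda>x. \<lambda>i\<in>UNIV. x i) = distr P P (\<lambda>x. x)"
      unfolding P_def by (intro distr_cong) auto
    also have "\<dots> = P" by simp
    finally show "distr P (PiM UNIV (\<lambda>_. Q)) (\<lambda>x. \<lambda>i\<in>UNIV. x i) = (\<Pi>\<^sub>M i\<in>UNIV. distr P Q (\<lambda>\<omega>. \<omega> i))"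
      unfolding P_def using PP.PiM_component by simp
  qed (auto simp: P_def)
  then have "P.indep_vars (\<lambda>_. borel) (\<lambda>t \<omega>. \<omega> t \<bullet> b) UNIV"
    by (rule P.indep_vars_compose2) (simp add: Q_sets cong: measurable_cong_sets)
  then have "P.indep_vars (\<lambda>_. borel) (\<lambda>t \<omega>. \<omega> t \<bullet> b) (range real)"
    by (rule P.indep_vars_subset) simp
  then have "P.indep_vars (\<lambda>_. borel) (\<lambda>n \<omega>. \<omega> (real n) \<bullet> b) UNIV"
    by (rule P.indep_vars_reindex_inj[rotated]) simp
  moreover have "distr P borel (\<lambda>\<omega>. \<omega> (real n) \<bullet> b) = std_normal_distribution" for n
  proof -
    have "distr P borel (\<lambda>\<omega>. \<omega> (real n) \<bullet> b) = distr (distr P Q (\<lambda>\<omega>. \<omega> (real n))) borel (\<lambda>x. x \<bullet> b)"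
    proof -
      have "(\<lambda>\<omega>. \<omega> (real n)) \<in> P \<rightarrow>\<^sub>M Q"
        unfolding P_def by (rule measurable_component_singleton) simp
      moreover have "(\<lambda>x. x \<bullet> b) \<in> Q \<rightarrow>\<^sub>M borel"
        by (simp add: Q_sets cong: measurable_cong_sets)
      ultimately show ?thesis by (subst distr_distr) (simp_all add: o_def)
    qed
    also have "distr P Q (\<lambda>\<omega>. \<omega> (real n)) = Q" unfolding P_def by (rule PP.PiM_component) simp
    also have "distr Q borel (\<lambda>x. x \<bullet> b) = distr std_normal_distribution borel (\<lambda>x. x)"
      unfolding Q_def using b by (subst distr_distr) (auto simp: o_def dot_square_norm)
    also have "\<dots> = distr std_normal_distribution std_normal_distribution (\<lambda>x. x)"
      by (rule distr_cong) auto
    finally show ?thesis by simp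
  qed
  ultimately show ?thesis using P.prob_space_axioms by blast
qed

section \<open>The limit process\<close>

definition dyadics :: "real set" where
  "dyadics = {real l / 2^q | l q :: nat. l \<le> 2^q}"

lemma countable_dyadics: "countable dyadics"
proof -
  have "dyadics \<subseteq> (\<lambda>(l, q). real l / 2^q) ` (UNIV :: (nat \<times> nat) set)" by (auto simp: dyadics_def)
  then show ?thesis by (rule countable_subset) simp
qed

lemma dyadics_bounds: "t \<in> dyadics \<Longrightarrow> 0 \<le> t \<and> t \<le> 1"
proof -
  assume "t \<in> dyadics"
  then obtain l q :: nat where t: "t = real l / 2^q" "l \<le> 2^q" by (auto simp: dyadics_def)
  have "real l \<le> 2^q" using of_nat_mono[OF t(2), where 'a=real] by simp
  then show ?thesis by (simp add: t)
qed

lemma dyadicsI: "l \<le> 2^q \<Longrightarrow> real l / 2^q \<in> dyadics"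
  by (auto simp: dyadics_def)

text \<open>The ramp is 1 up to \<open>c\<close> and 0 from \<open>2 * c\<close> on. One minus the
  product is a Lipschitz function between the indicators of "some \<open>x i\<close> is at least
  \<open>2 * c\<close>" and "some \<open>x i\<close> exceeds \<open>c\<close>".\<close>

lemma prod_ramp_bounds:
  fixes x :: "'i \<Rightarrow> real" and c :: real
  assumes c: "0 < c" and I: "finite I"
  defines "\<psi> \<equiv> \<lambda>y. max 0 (min 1 (2 - y / c))"
  shows "0 \<le> (\<Prod>i\<in>I. \<psi> (x i))" "(\<Prod>i\<in>I. \<psi> (x i)) \<le> 1"
    and "(\<forall>i\<in>I. x i \<le> c) \<Longrightarrow> (\<Prod>i\<in>I. \<psi> (x i)) = 1"
    and "(\<exists>i\<in>I. 2 * c \<le> x i) \<Longrightarrow> (\<Prod>i\<in>I. \<psi> (x i)) = 0"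
    and "\<bar>(\<Prod>i\<in>I. \<psi> (x i)) - (\<Prod>i\<in>I. \<psi> (y i))\<bar> \<le> (\<Sum>i\<in>I. \<bar>x i - y i\<bar> / c)"
proof -
  have \<psi>: "0 \<le> \<psi> y" "\<psi> y \<le> 1" for y by (auto simp: \<psi>_def)
  show "0 \<le> (\<Prod>i\<in>I. \<psi> (x i))" "(\<Prod>i\<in>I. \<psi> (x i)) \<le> 1" using \<psi> by (auto intro!: prod_nonneg prod_le_1)
  show "(\<Prod>i\<in>I. \<psi> (x i)) = 1" if "\<forall>i\<in>I. x i \<le> c"
  proof (rule prod.neutral, rule ballI)
    fix i assume "i \<in> I"
    then have "x i / c \<le> 1" using that c by simp
    then show "\<psi> (x i) = 1" by (simp add: \<psi>_def)
  qed
  show "(\<Prod>i\<in>I. \<psi> (x i)) = 0" if ex: "\<exists>i\<in>I. 2 * c \<le> x i"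
  proof -
    obtain i where i: "i \<in> I" "2 * c \<le> x i" using ex by blast
    then have "2 \<le> x i / c" using c by (simp add: field_simps)
    then have "\<psi> (x i) = 0" by (simp add: \<psi>_def)
    then show ?thesis using i I by (auto simp: prod_zero_iff)
  qed
  have lip: "\<bar>\<psi> a - \<psi> b\<bar> \<le> \<bar>a - b\<bar> / c" for a b
  proof -
    have "\<bar>\<psi> a - \<psi> b\<bar> \<le> \<bar>a / c - b / c\<bar>" by (auto simp: \<psi>_def max_def min_def)
    also have "\<dots> = \<bar>a - b\<bar> / c" using c by (simp add: diff_divide_distrib[symmetric])
    finally show ?thesis .
  qed
  have "norm ((\<Prod>i\<in>I. \<psi> (x i)) - (\<Prod>i\<in>I. \<psi> (y i))) \<le> (\<Sum>i\<in>I. norm (\<psi> (x i) - \<psi> (y i)))"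
    using \<psi> by (intro norm_prod_diff) auto
  also have "\<dots> \<le> (\<Sum>i\<in>I. \<bar>x i - y i\<bar> / c)" using lip by (intro sum_mono) auto
  finally show "\<bar>(\<Prod>i\<in>I. \<psi> (x i)) - (\<Prod>i\<in>I. \<psi> (y i))\<bar> \<le> (\<Sum>i\<in>I. \<bar>x i - y i\<bar> / c)" by simp
qed

locale gaussian_limit = copula_sample M \<nu> X Y + P: prob_space P
  for M :: "'a measure" and \<nu> :: "((real^'d1) \<times> (real^'d2)) measure" and X Y
    and P :: "'p measure" +
  fixes \<xi> :: "nat \<Rightarrow> 'p \<Rightarrow> real"
  assumes \<xi>_indep: "P.indep_vars (\<lambda>_. borel) \<xi> UNIV"
    and \<xi>_distr: "\<And>n. distr P borel (\<xi> n) = std_normal_distribution"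
begin

definition entries :: "(real \<times> 'd1 \<times> 'd2) set" where
  "entries = dyadics \<times> UNIV"

text \<open>The scalar entries at dyadic times, enumerated so that Gram-Schmidt can run through
  them.\<close>

definition hh :: "nat \<Rightarrow> (real^'d1) \<times> (real^'d2) \<Rightarrow> real" where
  "hh j z = (case from_nat_into entries j of (t, k, a) \<Rightarrow> Phi t z $ k $ a)"

lemma hh_to_nat: "t \<in> dyadics \<Longrightarrow> hh (to_nat_on entries (t, k, a)) z = Phi t z $ k $ a"
  unfolding hh_def using countable_dyadics by (subst from_nat_into_to_nat_on) (auto simp: entries_def)

lemma gaussian_sequence: "gaussian_sequence \<nu> hh P \<xi>"
proof
  fix j
  obtain t k a where j: "from_nat_into entries j = (t, k, a)" by (cases "from_nat_into entries j")
  have "hh j = (\<lambda>z. Phi t z $ k $ a)" by (simp add: hh_def j fun_eq_iff)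
  moreover have "(\<lambda>z. Phi t z $ k $ a) \<in> borel_measurable \<nu>"
    by (simp add: Phi_entry)
  moreover have "integrable \<nu> (\<lambda>z. (Phi t z $ k $ a)\<^sup>2)"
    by (rule Bochner_Integration.integrable_bound[OF law.integrable_entry_square[of a]]) (auto simp: Phi_entry)
  ultimately show "hh j \<in> borel_measurable \<nu>" "integrable \<nu> (\<lambda>z. (hh j z)\<^sup>2)" by simp_all
qed (rule \<xi>_indep \<xi>_distr)+

sublocale gseq: gaussian_sequence \<nu> hh P \<xi>
  by (rule gaussian_sequence)

definition zeta :: "real \<Rightarrow> 'p \<Rightarrow> real^'d2^'d1" where
  "zeta t \<omega> = (\<chi> k a. gseq.G (to_nat_on entries (t, k, a)) \<omega>)"

lemma rv_zeta[measurable]: "zeta t \<in> borel_measurable P"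
  unfolding zeta_def[abs_def] by measurable

text \<open>The exponent is the one in \<open>W_char_convergence\<close>; this identifies
  \<open>zeta\<close> as the limit at finitely many dyadic times.\<close>

lemma zeta_char:
  fixes F :: "'i set"
  assumes F: "finite F" and \<tau>: "\<And>i. i \<in> F \<Longrightarrow> \<tau> i \<in> dyadics"
  shows "(CLINT \<omega>|P. iexp (\<Sum>i\<in>F. a i \<bullet> zeta (\<tau> i) \<omega>)) = complex_of_real (exp (- (LINT z|\<nu>. (law.weighted a \<tau> F z)\<^sup>2) / 2))"
proof -
  let ?A = "F \<times> (UNIV :: ('d1 \<times> 'd2) set)"
  let ?b = "\<lambda>(i, k, c). a i $ k $ c"
  let ?j = "\<lambda>(i, k, c). to_nat_on entries (\<tau> i, k, c)"
  have "(\<Sum>i\<in>F. a i \<bullet> zeta (\<tau> i) \<omega>) = (\<Sum>x\<in>?A. ?b x * gseq.G (?j x) \<omega>)" for \<omega>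
    by (simp add: inner_entries zeta_def sum.cartesian_product split_beta UNIV_Times_UNIV[symmetric] del: UNIV_Times_UNIV)
  moreover have "law.weighted a \<tau> F z = (\<Sum>x\<in>?A. ?b x * hh (?j x) z)" for z
  proof -
    have "(\<Sum>x\<in>?A. ?b x * hh (?j x) z) = (\<Sum>x\<in>?A. ?b x * (case x of (i, k, c) \<Rightarrow> Phi (\<tau> i) z $ k $ c))"
      using \<tau> by (intro sum.cong) (auto simp: hh_to_nat)
    also have "\<dots> = law.weighted a \<tau> F z"
      by (simp add: law.weighted_def inner_entries sum.cartesian_product split_beta UNIV_Times_UNIV[symmetric] del: UNIV_Times_UNIV)
    finally show ?thesis by simp
  qed
  ultimately show ?thesis using gseq.G_char[of ?A ?b ?j] F by simp
qed

text \<open>The vectors on the grid are flattened into scalars indexed by time, block and entry, to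
  which \<open>char_convergence_imp_lipschitz_convergence\<close> applies.\<close>

theorem grid_convergence:
  fixes F :: "(nat \<Rightarrow> real^'d2^'d1) \<Rightarrow> real"
  assumes L: "0 \<le> L" and lip: "\<And>v w. \<bar>F v - F w\<bar> \<le> L * (\<Sum>l\<le>2^q. norm (v l - w l))"
    and bdd: "\<And>w. \<bar>F w\<bar> \<le> B"
  shows "(\<lambda>n. LINT \<omega>|M. F (\<lambda>l. W n (real l / 2^q) \<omega>)) \<longlonglongrightarrow> (LINT \<omega>|P. F (\<lambda>l. zeta (real l / 2^q) \<omega>))"
proof -
  let ?I = "{..(2::nat)^q} \<times> (UNIV :: ('d1 \<times> 'd2) set)"
  define f where "f x = F (\<lambda>l. \<chi> k a. x (l, k, a))" for x :: "nat \<times> 'd1 \<times> 'd2 \<Rightarrow> real"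
  define V where "V n \<omega> = (\<lambda>(l, k, a). W n (real l / 2^q) \<omega> $ k $ a)" for n \<omega>
  define U where "U \<omega> = (\<lambda>(l, k, a). zeta (real l / 2^q) \<omega> $ k $ a)" for \<omega>
  have inner: "(\<Sum>i\<in>?I. a i * w (fst i) $ fst (snd i) $ snd (snd i)) = (\<Sum>l\<le>2^q. (\<chi> k c. a (l, k, c)) \<bullet> w l)"
    for a and w :: "nat \<Rightarrow> real^'d2^'d1"
    by (simp add: inner_entries sum.cartesian_product split_beta UNIV_Times_UNIV[symmetric] del: UNIV_Times_UNIV)
  have "(\<lambda>n. LINT \<omega>|M. f (V n \<omega>)) \<longlonglongrightarrow> (LINT \<omega>|P. f (U \<omega>))"
  proof (rule char_convergence_imp_lipschitz_convergence[where I="?I" and V=V and U=U and f=f and L=L and B=B])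
    show "prob_space M" "prob_space P" by unfold_locales
    show "finite ?I" by simp
    show "(\<lambda>\<omega>. V n \<omega> i) \<in> borel_measurable M" for n i by (cases i) (simp add: V_def)
    show "(\<lambda>\<omega>. U \<omega> i) \<in> borel_measurable P" for i by (cases i) (simp add: U_def)
    show "\<bar>f x\<bar> \<le> B" for x by (simp add: f_def bdd)
    show "\<bar>f x - f y\<bar> \<le> L * (\<Sum>i\<in>?I. \<bar>x i - y i\<bar>)" for x y
    proof -
      have "\<bar>f x - f y\<bar> \<le> L * (\<Sum>l\<le>2^q. norm ((\<chi> k a. x (l, k, a)) - (\<chi> k a. y (l, k, a)) :: real^'d2^'d1))"
        unfolding f_def by (rule lip)
      also have "\<dots> \<le> L * (\<Sum>l\<le>2^q. \<Sum>k\<in>UNIV. \<Sum>a\<in>UNIV. \<bar>x (l, k, a) - y (l, k, a)\<bar>)"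
        using L by (intro mult_left_mono sum_mono order_trans[OF norm_le_sum_entries]) auto
      finally show ?thesis
        by (simp add: sum.cartesian_product split_beta UNIV_Times_UNIV[symmetric] del: UNIV_Times_UNIV)
    qed
    fix a :: "nat \<times> 'd1 \<times> 'd2 \<Rightarrow> real"
    let ?a = "\<lambda>l. \<chi> k c. a (l, k, c)"
    have "(\<lambda>n. CLINT \<omega>|M. iexp (\<Sum>l\<le>2^q. ?a l \<bullet> W n (real l / 2^q) \<omega>))
       \<longlonglongrightarrow> (CLINT \<omega>|P. iexp (\<Sum>l\<le>2^q. ?a l \<bullet> zeta (real l / 2^q) \<omega>))"
      using W_char_convergence[of ?a "\<lambda>l. real l / 2^q" "{..2^q}"]
        zeta_char[of "{..2^q}" "\<lambda>l. real l / 2^q" ?a] dyadicsI by simp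
    moreover have "(\<Sum>i\<in>?I. a i * V n \<omega> i) = (\<Sum>l\<le>2^q. ?a l \<bullet> W n (real l / 2^q) \<omega>)" for n \<omega>
      using inner[of a "\<lambda>l. W n (real l / 2^q) \<omega>"] by (simp add: V_def split_beta)
    moreover have "(\<Sum>i\<in>?I. a i * U \<omega> i) = (\<Sum>l\<le>2^q. ?a l \<bullet> zeta (real l / 2^q) \<omega>)" for \<omega>
      using inner[of a "\<lambda>l. zeta (real l / 2^q) \<omega>"] by (simp add: U_def split_beta)
    ultimately show "(\<lambda>n. CLINT \<omega>|M. iexp (\<Sum>i\<in>?I. a i * V n \<omega> i)) \<longlonglongrightarrow> (CLINT \<omega>|P. iexp (\<Sum>i\<in>?I. a i * U \<omega> i))"
      by (simp only:)
  qed
  moreover have "(\<chi> k a. (x::real^'d2^'d1) $ k $ a) = x" for x by (simp add: vec_eq_iff)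
  ultimately show ?thesis by (simp add: f_def V_def U_def)
qed

section \<open>Oscillation of the limit at dyadic times\<close>

definition scale :: real where "scale = real CARD('d1) * real CARD('d2)"

lemma scale_pos: "0 < scale" by (simp add: scale_def)

text \<open>Cells have level \<open>p\<close>, and points are taken from the refinement of level
  \<open>p + i\<close>. The threshold is twice the bound of \<open>W_oscillation\<close>, which
  leaves room for a Lipschitz ramp.\<close>

definition rough :: "nat \<Rightarrow> nat \<Rightarrow> real \<Rightarrow> 'p set" where
  "rough p i e = {\<omega>\<in>space P. \<exists>l<2^p. \<exists>r\<le>2^(p + i). real l / 2^p \<le> real r / 2^(p + i) \<and> real r / 2^(p + i) \<le> real (Suc l) / 2^p \<and>
     2 * (scale * e) \<le> norm (zeta (real r / 2^(p + i)) \<omega> - zeta (real l / 2^p) \<omega>)}"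

lemma rough_sets[measurable]: "rough p i e \<in> P.events"
proof -
  have "rough p i e = (\<Union>l<2^p. \<Union>r\<in>{r. r \<le> 2^(p + i) \<and> real l / 2^p \<le> real r / 2^(p + i) \<and> real r / 2^(p + i) \<le> real (Suc l) / 2^p}.
     {\<omega>\<in>space P. 2 * (scale * e) \<le> norm (zeta (real r / 2^(p + i)) \<omega> - zeta (real l / 2^p) \<omega>)})"
    by (auto simp: rough_def)
  moreover have "{\<omega>\<in>space P. 2 * (scale * e) \<le> norm (zeta s \<omega> - zeta t \<omega>)} \<in> P.events" for s t
    by measurable
  ultimately show ?thesis by auto
qed

text \<open>A Lipschitz functional of the grid is at most the indicator of \<open>bad\<close> along
  \<open>W n\<close> and at least the indicator of \<open>rough\<close> at \<open>zeta\<close>. Its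
  expectation passes to the limit, and the resulting bound does not depend on the refinement
  \<open>i\<close>.\<close>

lemma prob_rough_le:
  assumes e: "0 < e"
  shows "P.prob (rough p i e) \<le> bad_limit p e"
proof -
  let ?q = "p + i"
  let ?Q = "{(l, r). l < 2^p \<and> r \<le> 2^?q \<and> real l / 2^p \<le> real r / 2^?q \<and> real r / 2^?q \<le> real (Suc l) / 2^p}"
  have fin: "finite ?Q" by (rule finite_subset[of _ "{..<2^p} \<times> {..2^?q}"]) auto
  define c where "c = scale * e"
  have c: "0 < c" using e scale_pos by (simp add: c_def)
  \<comment> \<open>On the grid of level \<open>p + i\<close>, the cell end \<open>l / 2^p\<close>
    has index \<open>l * 2^i\<close>.\<close>
  let ?x = "\<lambda>w (l, r). norm (w r - w (l * 2^i) :: real^'d2^'d1)"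
  define \<psi> where "\<psi> y = max 0 (min 1 (2 - y / c))" for y
  define F where "F w = 1 - (\<Prod>u\<in>?Q. \<psi> (?x w u))" for w
  note ramp = prod_ramp_bounds[OF c fin, folded \<psi>_def]
  have grid: "real (l * 2^i) / 2^?q = real l / 2^p" for l by (simp add: power_add)
  have F01: "0 \<le> F w" "F w \<le> 1" for w
    using ramp(1,2)[of "?x w"] by (auto simp: F_def)
  have idx: "l * 2^i \<le> 2^?q" if "l < 2^p" for l :: nat
    using that by (simp add: power_add)
  have lipF: "\<bar>F v - F w\<bar> \<le> (2 * card ?Q / c) * (\<Sum>l\<le>2^?q. norm (v l - w l))" for v w
  proof -
    let ?S = "\<Sum>l\<le>2^?q. norm (v l - w l)"
    have one: "norm (v l - w l) \<le> ?S" if "l \<le> 2^?q" for l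
      using member_le_sum[of l "{..2^?q}" "\<lambda>l. norm (v l - w l)"] that by simp
    have "\<bar>F v - F w\<bar> = \<bar>(\<Prod>u\<in>?Q. \<psi> (?x v u)) - (\<Prod>u\<in>?Q. \<psi> (?x w u))\<bar>"
      by (simp add: F_def abs_minus_commute)
    also have "\<dots> \<le> (\<Sum>u\<in>?Q. \<bar>?x v u - ?x w u\<bar> / c)" by (rule ramp(5))
    also have "\<dots> \<le> (\<Sum>u\<in>?Q. 2 * ?S / c)"
    proof (rule sum_mono)
      fix u assume "u \<in> ?Q"
      then obtain l r where u: "u = (l, r)" "l < 2^p" "r \<le> 2^?q" by auto
      have "\<bar>?x v u - ?x w u\<bar> \<le> norm ((v r - v (l * 2^i)) - (w r - w (l * 2^i)))"
        unfolding u by (simp add: norm_triangle_ineq3)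
      also have "\<dots> \<le> norm (v r - w r) + norm (v (l * 2^i) - w (l * 2^i))"
        using norm_triangle_ineq4[of "v r - w r" "v (l * 2^i) - w (l * 2^i)"] by (simp add: algebra_simps)
      also have "\<dots> \<le> ?S + ?S" using one idx u by (intro add_mono) auto
      finally show "\<bar>?x v u - ?x w u\<bar> / c \<le> 2 * ?S / c" using c by (intro divide_right_mono) auto
    qed
    also have "\<dots> = (2 * card ?Q / c) * ?S" by simp
    finally show ?thesis .
  qed
  have "(\<lambda>n. LINT \<omega>|M. F (\<lambda>l. W n (real l / 2^?q) \<omega>)) \<longlonglongrightarrow> (LINT \<omega>|P. F (\<lambda>l. zeta (real l / 2^?q) \<omega>))"
  proof (rule grid_convergence[where L="2 * card ?Q / c" and B=1])
    show "0 \<le> 2 * card ?Q / c" using c by simp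
    show "\<bar>F v - F w\<bar> \<le> (2 * card ?Q / c) * (\<Sum>l\<le>2^?q. norm (v l - w l))" for v w by (rule lipF)
    show "\<bar>F w\<bar> \<le> 1" for w using F01[of w] by simp
  qed
  note conv = this
  have FM: "(\<lambda>\<omega>. F (\<lambda>l. W n (real l / 2^?q) \<omega>)) \<in> borel_measurable M" for n
  proof -
    have "(\<lambda>\<omega>. \<psi> (?x (\<lambda>l. W n (real l / 2^?q) \<omega>) u)) \<in> borel_measurable M" for u
      unfolding \<psi>_def by (cases u) simp
    then show ?thesis unfolding F_def by (intro borel_measurable_diff borel_measurable_prod) auto
  qed
  have FP: "(\<lambda>\<omega>. F (\<lambda>l. zeta (real l / 2^?q) \<omega>)) \<in> borel_measurable P"
  proof -
    have "(\<lambda>\<omega>. \<psi> (?x (\<lambda>l. zeta (real l / 2^?q) \<omega>) u)) \<in> borel_measurable P" for u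
      unfolding \<psi>_def by (cases u) simp
    then show ?thesis unfolding F_def by (intro borel_measurable_diff borel_measurable_prod) auto
  qed
  have FW_le: "F (\<lambda>l. W n (real l / 2^?q) \<omega>) \<le> indicator (bad n p e) \<omega>" if \<omega>: "\<omega> \<in> space M" for n \<omega>
  proof (cases "\<omega> \<in> bad n p e")
    case False
    have "\<forall>u\<in>?Q. ?x (\<lambda>l. W n (real l / 2^?q) \<omega>) u \<le> c"
    proof clarify
      fix l r :: nat assume "l < 2^p" "real l / 2^p \<le> real r / 2^?q" "real r / 2^?q \<le> real (Suc l) / 2^p"
      from W_oscillation[OF \<omega> False e this]
      show "norm (W n (real r / 2^?q) \<omega> - W n (real (l * 2^i) / 2^?q) \<omega>) \<le> c"
        unfolding grid by (simp add: c_def scale_def)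
    qed
    then have "F (\<lambda>l. W n (real l / 2^?q) \<omega>) = 0" unfolding F_def by (subst ramp(3)) auto
    then show ?thesis by simp
  qed (use F01 in simp)
  have EW: "(LINT \<omega>|M. F (\<lambda>l. W n (real l / 2^?q) \<omega>)) \<le> prob (bad n p e)" for n
  proof -
    have "(LINT \<omega>|M. F (\<lambda>l. W n (real l / 2^?q) \<omega>)) \<le> (LINT \<omega>|M. indicator (bad n p e) \<omega>)"
    proof (rule integral_mono)
      show "integrable M (\<lambda>\<omega>. F (\<lambda>l. W n (real l / 2^?q) \<omega>))"
        by (rule integrable_const_bound[where B=1]) (use FM F01 in \<open>auto intro!: AE_I2\<close>)
      show "integrable M (indicator (bad n p e) :: _ \<Rightarrow> real)"
        using bad_sets[OF e] by (intro integrable_real_indicator) (auto simp: less_top[symmetric])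
    qed (rule FW_le)
    then show ?thesis using bad_sets[OF e, of n p] by simp
  qed
  have "(LINT \<omega>|P. F (\<lambda>l. zeta (real l / 2^?q) \<omega>)) \<le> bad_limit p e"
  proof (rule field_le_epsilon)
    fix d :: real assume "0 < d"
    from eventually_prob_bad_less[OF e this, of p]
    have "\<forall>\<^sub>F n in sequentially. (LINT \<omega>|M. F (\<lambda>l. W n (real l / 2^?q) \<omega>)) \<le> bad_limit p e + d"
      by (rule eventually_mono) (use EW order_trans in \<open>blast intro: less_imp_le order_trans\<close>)
    then show "(LINT \<omega>|P. F (\<lambda>l. zeta (real l / 2^?q) \<omega>)) \<le> bad_limit p e + d"
      by (rule tendsto_upperbound[OF conv]) simp
  qed
  moreover have "P.prob (rough p i e) \<le> (LINT \<omega>|P. F (\<lambda>l. zeta (real l / 2^?q) \<omega>))"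
  proof -
    have "P.prob (rough p i e) = (LINT \<omega>|P. indicator (rough p i e) \<omega>)" by simp
    also have "\<dots> \<le> (LINT \<omega>|P. F (\<lambda>l. zeta (real l / 2^?q) \<omega>))"
    proof (rule integral_mono)
      show "integrable P (\<lambda>\<omega>. F (\<lambda>l. zeta (real l / 2^?q) \<omega>))"
        by (rule P.integrable_const_bound[where B=1]) (use FP F01 in \<open>auto intro!: AE_I2\<close>)
      show "integrable P (indicator (rough p i e) :: _ \<Rightarrow> real)"
        using rough_sets by (intro integrable_real_indicator) (auto simp: less_top[symmetric])
      show "indicator (rough p i e) \<omega> \<le> F (\<lambda>l. zeta (real l / 2^?q) \<omega>)" for \<omega>
      proof (cases "\<omega> \<in> rough p i e")
        case True
        then obtain l r where lr: "l < 2^p" "r \<le> 2^?q" "real l / 2^p \<le> real r / 2^?q" "real r / 2^?q \<le> real (Suc l) / 2^p"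
          "2 * c \<le> norm (zeta (real r / 2^?q) \<omega> - zeta (real l / 2^p) \<omega>)"
          unfolding rough_def c_def by blast
        have "\<exists>u\<in>?Q. 2 * c \<le> ?x (\<lambda>l. zeta (real l / 2^?q) \<omega>) u"
          using lr by (intro bexI[of _ "(l, r)"]) (simp_all only: grid prod.case mem_Collect_eq simp_thms)
        then have "F (\<lambda>l. zeta (real l / 2^?q) \<omega>) = 1" unfolding F_def by (subst ramp(4)) auto
        then show ?thesis by (simp add: indicator_def)
      qed (use F01 in simp)
    qed
    finally show ?thesis .
  qed
  ultimately show ?thesis by linarith
qed

end

text \<open>Characteristic functions determine laws: after division by \<open>sqrt Q\<close> the law
  is standard normal, and for \<open>Q = 0\<close> it is the point mass at 0.\<close>

lemma (in prob_space) gaussian_char_imp_normal_rv: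
  assumes V[measurable]: "V \<in> borel_measurable M" and Q: "0 \<le> Q"
    and char: "\<And>s. (CLINT \<omega>|M. iexp (s * V \<omega>)) = complex_of_real (exp (- (s\<^sup>2 * Q) / 2))"
  shows "normal_rv M V" and "integrable M V" and "expectation V = 0"
    and "integrable M (\<lambda>\<omega>. (V \<omega>)\<^sup>2)" and "expectation (\<lambda>\<omega>. (V \<omega>)\<^sup>2) = Q"
proof -
  have "normal_rv M V \<and> integrable M V \<and> expectation V = 0 \<and> integrable M (\<lambda>\<omega>. (V \<omega>)\<^sup>2) \<and> expectation (\<lambda>\<omega>. (V \<omega>)\<^sup>2) = Q"
  proof (cases "Q = 0")
    case True
    have "distr M borel V = distr M borel (\<lambda>_. 0)"
    proof (rule Levy_uniqueness)
      show "Characteristic_Functions.char (distr M borel V) = Characteristic_Functions.char (distr M borel (\<lambda>_. 0))"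
      proof
        fix s
        have "Characteristic_Functions.char (distr M borel V) s = (CLINT \<omega>|M. iexp (s * V \<omega>))"
          unfolding char_def by (subst integral_distr) simp_all
        also have "\<dots> = 1" unfolding char True by simp
        also have "1 = Characteristic_Functions.char (distr M borel (\<lambda>_. 0)) s"
          unfolding char_def by (subst integral_distr) (simp_all add: prob_space)
        finally show "Characteristic_Functions.char (distr M borel V) s = Characteristic_Functions.char (distr M borel (\<lambda>_. 0)) s" .
      qed
    qed (rule real_distribution_distr, simp)+
    moreover have "AE x in distr M borel (\<lambda>_. 0::real). x = 0"
      by (subst AE_distr_iff) auto
    ultimately have "AE x in distr M borel V. x = 0" by (simp only:)
    then have ae: "AE \<omega> in M. V \<omega> = 0" by (subst (asm) AE_distr_iff) auto
    have ae2: "AE \<omega> in M. (V \<omega>)\<^sup>2 = 0" using ae by eventually_elim simp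
    have "integrable M V" using integrable_cong_AE[of V M "\<lambda>_. 0"] ae by simp
    moreover have "expectation V = 0" using integral_cong_AE[of V M "\<lambda>_. 0"] ae by simp
    moreover have "integrable M (\<lambda>\<omega>. (V \<omega>)\<^sup>2)" using integrable_cong_AE[of "\<lambda>\<omega>. (V \<omega>)\<^sup>2" M "\<lambda>_. 0"] ae2 by simp
    moreover have "expectation (\<lambda>\<omega>. (V \<omega>)\<^sup>2) = 0" using integral_cong_AE[of "\<lambda>\<omega>. (V \<omega>)\<^sup>2" M "\<lambda>_. 0"] ae2 by simp
    ultimately show ?thesis using ae True unfolding normal_rv_def by auto
  next
    case False
    define \<sigma> where "\<sigma> = sqrt Q"
    have \<sigma>: "0 < \<sigma>" "\<sigma>\<^sup>2 = Q" using False Q by (auto simp: \<sigma>_def)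
    define U where "U \<omega> = V \<omega> / \<sigma>" for \<omega>
    have U[measurable]: "U \<in> borel_measurable M" unfolding U_def[abs_def] by measurable
    have "distr M borel U = std_normal_distribution"
    proof (rule Levy_uniqueness)
      show "Characteristic_Functions.char (distr M borel U) = Characteristic_Functions.char std_normal_distribution"
      proof
        fix s
        have "Characteristic_Functions.char (distr M borel U) s = (CLINT \<omega>|M. iexp (s * U \<omega>))"
          unfolding char_def by (subst integral_distr) simp_all
        also have "\<dots> = (CLINT \<omega>|M. iexp (s / \<sigma> * V \<omega>))"
          by (simp add: U_def)
        also have "\<dots> = complex_of_real (exp (- ((s / \<sigma>)\<^sup>2 * Q) / 2))" by (rule char)
        also have "(s / \<sigma>)\<^sup>2 * Q = s\<^sup>2" using \<sigma> False by (simp add: power_divide)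
        finally show "Characteristic_Functions.char (distr M borel U) s = Characteristic_Functions.char std_normal_distribution s"
          by (simp add: char_std_normal_distribution)
      qed
    qed (auto intro!: real_distribution_distr real_dist_normal_dist)
    then have "distributed M lborel U std_normal_density"
      unfolding distributed_def by (auto cong: distr_cong)
    from normal_density_affine[OF this, of \<sigma> 0]
    have D: "distributed M lborel V (normal_density 0 \<sigma>)"
      using \<sigma> by (simp add: U_def)
    have "integrable M V"
      using distributed_integrable[OF D, of "\<lambda>x. x"] integrable_normal_moment_nz_1[OF \<sigma>(1), of 0] by simp
    moreover have "integrable M (\<lambda>\<omega>. (V \<omega>)\<^sup>2)"
      using distributed_integrable[OF D, of "\<lambda>x. x\<^sup>2"] integrable_normal_moment[OF \<sigma>(1), of 0 2] by simp
    moreover have E: "expectation V = 0" by (rule normal_distributed_expectation[OF \<sigma>(1) D])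
    moreover have "expectation (\<lambda>\<omega>. (V \<omega>)\<^sup>2) = Q"
      using normal_distributed_variance[OF \<sigma>(1) D] \<sigma>(2) by (simp add: E)
    ultimately show ?thesis using D \<sigma>(1) V unfolding normal_rv_def by blast
  qed
  then show "normal_rv M V" and "integrable M V" and "expectation V = 0"
    and "integrable M (\<lambda>\<omega>. (V \<omega>)\<^sup>2)" and "expectation (\<lambda>\<omega>. (V \<omega>)\<^sup>2) = Q" by auto
qed

text \<open>Approximation is from above because \<open>Phi\<close> is right-continuous in time: the
  indicators at the dyadic times then converge at every observation.\<close>

definition dyadic_above :: "nat \<Rightarrow> real \<Rightarrow> real" where
  "dyadic_above p t = real (nat \<lceil>2^p * t\<rceil>) / 2^p"

lemma dyadic_above:
  assumes t: "0 \<le> t" "t \<le> 1"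
  shows "dyadic_above p t \<in> dyadics" "t \<le> dyadic_above p t" "dyadic_above p t \<le> t + (1/2)^p"
proof -
  have "\<lceil>2^p * t\<rceil> \<le> 2^p" using t by (simp add: ceiling_le_iff mult_left_le)
  then have "nat \<lceil>2^p * t\<rceil> \<le> 2^p" by (simp add: nat_le_iff)
  then show "dyadic_above p t \<in> dyadics" unfolding dyadic_above_def by (rule dyadicsI)
  have n: "real (nat \<lceil>2^p * t\<rceil>) = of_int \<lceil>2^p * t\<rceil>" using t by (simp add: of_nat_nat)
  have "2^p * t \<le> of_int \<lceil>2^p * t\<rceil>" "of_int \<lceil>2^p * t\<rceil> \<le> 2^p * t + 1" by linarith+
  then show "t \<le> dyadic_above p t" "dyadic_above p t \<le> t + (1/2)^p"
    unfolding dyadic_above_def n by (simp_all add: field_simps power_divide)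
qed

lemma dyadic_above_tendsto:
  assumes t: "0 \<le> t" "t \<le> 1"
  shows "(\<lambda>p. dyadic_above p t) \<longlonglongrightarrow> t"
proof (rule tendsto_sandwich)
  show "\<forall>\<^sub>F p in sequentially. t \<le> dyadic_above p t" using dyadic_above(2)[OF t] by simp
  show "\<forall>\<^sub>F p in sequentially. dyadic_above p t \<le> t + (1/2)^p" using dyadic_above(3)[OF t] by simp
  have "(\<lambda>p. (1/2::real)^p) \<longlonglongrightarrow> 0" by (rule LIMSEQ_power_zero) simp
  from tendsto_add[OF tendsto_const[of t] this] show "(\<lambda>p. t + (1/2)^p) \<longlonglongrightarrow> t" by simp
qed simp

lemma ex_dyadic_cell:
  assumes t: "0 \<le> t" "t \<le> 1"
  shows "\<exists>l<2^p. real l / 2^p \<le> t \<and> t \<le> real (Suc l) / 2^p"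
proof (cases "t = 1")
  case True
  have "real (Suc (2^p - 1)) = 2^p" by (subst Suc_diff_1) simp_all
  then show ?thesis using True by (intro exI[of _ "2^p - 1"]) (simp add: field_simps)
next
  case False
  define l where "l = nat \<lfloor>2^p * t\<rfloor>"
  have l: "real l \<le> 2^p * t" "2^p * t < real l + 1" unfolding l_def using t by (auto simp: of_nat_nat)
  have "2^p * t < 2^p * 1" using t False by (intro mult_strict_left_mono) auto
  then have "real l < 2^p" using l(1) by linarith
  then have "l < 2^p" by simp
  then show ?thesis using l by (intro exI[of _ l]) (simp add: field_simps)
qed

lemma closure_dyadics: "{0..1} \<subseteq> closure dyadics"
proof
  fix t :: real assume "t \<in> {0..1}"
  then have t: "0 \<le> t" "t \<le> 1" by auto
  show "t \<in> closure dyadics"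
    unfolding closure_sequential using dyadic_above(1)[OF t] dyadic_above_tendsto[OF t]
    by (intro exI[of _ "\<lambda>p. dyadic_above p t"]) simp
qed

text \<open>Two points closer than a cell width lie in the same cell or in two neighbouring cells.\<close>

lemma uniformly_continuous_on_dyadics:
  fixes f :: "real \<Rightarrow> 'v::real_normed_vector"
  assumes "\<And>e. 0 < e \<Longrightarrow> \<exists>p. \<forall>l<2^p. \<forall>t\<in>dyadics. real l / 2^p \<le> t \<and> t \<le> real (Suc l) / 2^p \<longrightarrow> norm (f t - f (real l / 2^p)) < e"
  shows "uniformly_continuous_on dyadics f"
  unfolding uniformly_continuous_on_def
proof (intro allI impI)
  fix e :: real assume "0 < e"
  then obtain p where p: "\<And>l t. l < 2^p \<Longrightarrow> t \<in> dyadics \<Longrightarrow> real l / 2^p \<le> t \<Longrightarrow> t \<le> real (Suc l) / 2^p \<Longrightarrow> norm (f t - f (real l / 2^p)) < e / 3"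
    using assms[of "e / 3"] by auto
  have main: "norm (f t - f s) < e" if st: "s \<in> dyadics" "t \<in> dyadics" "s \<le> t" "t < s + (1/2)^p" for s t
  proof -
    note sb = dyadics_bounds[OF st(1)] and tb = dyadics_bounds[OF st(2)]
    obtain l where l: "l < 2^p" "real l / 2^p \<le> s" "s \<le> real (Suc l) / 2^p"
      using ex_dyadic_cell[of s p] sb by auto
    have s: "norm (f s - f (real l / 2^p)) < e / 3" using p l st by blast
    show ?thesis
    proof (cases "t \<le> real (Suc l) / 2^p")
      case True
      have "norm (f t - f (real l / 2^p)) < e / 3" using p l st True order_trans by blast
      then have "norm (f t - f s) < e / 3 + e / 3" by (rule norm_diff_triangle_less) (use s in \<open>simp add: norm_minus_commute\<close>)
      then show ?thesis using \<open>0 < e\<close> by simp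
    next
      case False
      then have "real (Suc l) / 2^p < 1" using tb by linarith
      then have "real (Suc l) < real (2^p)" by simp
      then have l': "Suc l < 2^p" by (simp only: of_nat_less_iff)
      have "t \<le> real (Suc l) / 2^p + 1 / 2^p" using st(4) l(3) by (simp add: power_divide)
      also have "\<dots> = real (Suc (Suc l)) / 2^p" by (simp add: field_simps)
      finally have "norm (f t - f (real (Suc l) / 2^p)) < e / 3" using p[OF l' st(2)] False by simp
      moreover have "norm (f (real (Suc l) / 2^p) - f (real l / 2^p)) < e / 3"
      proof (rule p[OF l(1)])
        show "real (Suc l) / 2^p \<in> dyadics" by (rule dyadicsI) (use l(1) in simp)
      qed (auto simp: divide_right_mono)
      ultimately have "norm (f t - f (real l / 2^p)) < e / 3 + e / 3" by (rule norm_diff_triangle_less)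
      then have "norm (f t - f s) < (e / 3 + e / 3) + e / 3" by (rule norm_diff_triangle_less) (use s in \<open>simp add: norm_minus_commute\<close>)
      then show ?thesis by simp
    qed
  qed
  show "\<exists>d>0. \<forall>x\<in>dyadics. \<forall>x'\<in>dyadics. dist x' x < d \<longrightarrow> dist (f x') (f x) < e"
  proof (intro exI conjI ballI impI)
    show "0 < (1/2::real)^p" by simp
    fix s t assume st: "s \<in> dyadics" "t \<in> dyadics" "dist t s < (1/2)^p"
    show "dist (f t) (f s) < e"
    proof (cases "s \<le> t")
      case True
      then show ?thesis using main[of s t] st by (simp add: dist_norm)
    next
      case False
      then show ?thesis using main[of t s] st by (simp add: dist_norm norm_minus_commute)
    qed
  qed
qed

section \<open>Continuous extension from the dyadic times, and the law of the limit\<close>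

context gaussian_limit
begin

definition very_rough :: "nat \<Rightarrow> real \<Rightarrow> 'p set" where
  "very_rough p e = (\<Union>i. rough p i e)"

lemma very_rough_sets[measurable]: "very_rough p e \<in> P.events"
  unfolding very_rough_def by auto

text \<open>The events increase with the refinement under a common bound, so the bound passes to
  their union.\<close>

lemma prob_very_rough_le:
  assumes e: "0 < e"
  shows "P.prob (very_rough p e) \<le> bad_limit p e"
proof -
  have "incseq (\<lambda>i. rough p i e)"
  proof (rule incseq_SucI, rule subsetI)
    fix i \<omega> assume "\<omega> \<in> rough p i e"
    then obtain l r where lr: "\<omega> \<in> space P" "l < 2^p" "r \<le> 2^(p + i)" "real l / 2^p \<le> real r / 2^(p + i)" "real r / 2^(p + i) \<le> real (Suc l) / 2^p"
      "2 * (scale * e) \<le> norm (zeta (real r / 2^(p + i)) \<omega> - zeta (real l / 2^p) \<omega>)"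
      unfolding rough_def by blast
    have "real (2 * r) / 2^(p + Suc i) = real r / 2^(p + i)" "2 * r \<le> 2^(p + Suc i)" using lr(3) by simp_all
    then show "\<omega> \<in> rough p (Suc i) e"
      unfolding rough_def using lr by (intro CollectI conjI exI[of _ l] exI[of _ "2 * r"]) (simp_all only:)
  qed
  then have "(\<lambda>i. P.prob (rough p i e)) \<longlonglongrightarrow> P.prob (\<Union>i. rough p i e)"
    by (intro P.finite_Lim_measure_incseq) auto
  then show ?thesis
    unfolding very_rough_def by (rule LIMSEQ_le_const2) (use prob_rough_le[OF e] in auto)
qed

definition regular :: "'p set" where
  "regular = {\<omega>\<in>space P. \<forall>m. \<exists>p. \<omega> \<notin> very_rough p (1 / Suc m)}"

lemma regular_sets[measurable]: "regular \<in> P.events"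
proof -
  have "regular = (\<Inter>m. \<Union>p. space P - very_rough p (1 / Suc m))"
    by (auto simp: regular_def)
  then show ?thesis by auto
qed

text \<open>Being very rough at every level has probability at most
  \<open>bad_limit p (1 / Suc m)\<close> for each \<open>p\<close>, and this tends to 0; countably
  many tolerances suffice.\<close>

lemma AE_regular: "AE \<omega> in P. \<omega> \<in> regular"
proof -
  have "AE \<omega> in P. \<exists>p. \<omega> \<notin> very_rough p (1 / Suc m)" for m
  proof -
    let ?A = "\<Inter>p. very_rough p (1 / Suc m)"
    have A: "?A \<in> P.events" by auto
    have "P.prob ?A \<le> 0"
    proof (rule LIMSEQ_le_const)
      show "(\<lambda>p. bad_limit p (1 / Suc m)) \<longlonglongrightarrow> 0" by (rule bad_limit_tendsto)
      have "P.prob ?A \<le> bad_limit p (1 / Suc m)" for p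
        by (rule order_trans[OF P.finite_measure_mono prob_very_rough_le]) auto
      then show "\<exists>N. \<forall>n\<ge>N. P.prob ?A \<le> bad_limit n (1 / Suc m)" by blast
    qed
    then have "P.prob ?A = 0" by (simp add: measure_le_0_iff)
    then have "?A \<in> null_sets P" using A by (simp add: P.emeasure_eq_measure null_sets_def)
    from AE_not_in[OF this] show ?thesis by eventually_elim auto
  qed
  then have "AE \<omega> in P. \<forall>m. \<exists>p. \<omega> \<notin> very_rough p (1 / Suc m)" unfolding AE_all_countable by blast
  then show ?thesis using AE_space by eventually_elim (simp add: regular_def)
qed

lemma zeta_uniformly_continuous:
  assumes "\<omega> \<in> regular"
  shows "uniformly_continuous_on dyadics (\<lambda>t. zeta t \<omega>)"
proof (rule uniformly_continuous_on_dyadics)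
  fix e :: real assume e: "0 < e"
  obtain m where "inverse (real (Suc m)) < e / (2 * scale)"
    using reals_Archimedean[of "e / (2 * scale)"] e scale_pos by auto
  then have m: "2 * (scale * (1 / Suc m)) < e" using scale_pos by (simp add: field_simps)
  obtain p where p: "\<omega> \<notin> very_rough p (1 / Suc m)" using assms by (auto simp: regular_def)
  show "\<exists>p. \<forall>l<2^p. \<forall>t\<in>dyadics. real l / 2^p \<le> t \<and> t \<le> real (Suc l) / 2^p \<longrightarrow> norm (zeta t \<omega> - zeta (real l / 2^p) \<omega>) < e"
  proof (intro exI[of _ p] allI impI ballI)
    fix l t assume l: "l < (2::nat)^p" and t: "t \<in> dyadics" "real l / 2^p \<le> t \<and> t \<le> real (Suc l) / 2^p"
    obtain r q where rq: "t = real r / 2^q" "r \<le> 2^q" using t(1) by (auto simp: dyadics_def)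
    \<comment> \<open>Rewriting \<open>t\<close> over the denominator \<open>2^(p + q)\<close> makes
      it a point of the refinement that \<open>rough p q\<close> tests.\<close>
    have eq: "t = real (r * 2^p) / 2^(p + q)" by (simp add: rq(1) power_add)
    have le: "r * 2^p \<le> 2^(p + q)" using rq(2) by (simp add: power_add)
    have "\<omega> \<notin> rough p q (1 / Suc m)" using p by (auto simp: very_rough_def)
    moreover have "\<omega> \<in> space P" using assms by (simp add: regular_def)
    ultimately have "\<not> 2 * (scale * (1 / Suc m)) \<le> norm (zeta t \<omega> - zeta (real l / 2^p) \<omega>)"
      unfolding rough_def using l t(2) le unfolding eq by blast
    then show "norm (zeta t \<omega> - zeta (real l / 2^p) \<omega>) < e" using m by linarith
  qed
qed

text \<open>The value 0 off \<open>regular\<close> makes every path continuous and bounded, not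
  merely almost every one; the weak convergence statement demands bounded paths everywhere.\<close>

definition Z :: "'p \<Rightarrow> real \<Rightarrow> real^'d2^'d1" where
  "Z \<omega> t = (if \<omega> \<in> regular then lim (\<lambda>p. zeta (dyadic_above p t) \<omega>) else 0)"

lemma Z_extension:
  assumes "\<omega> \<in> regular"
  shows "continuous_on {0..1} (Z \<omega>)"
    and "\<And>t. 0 \<le> t \<Longrightarrow> t \<le> 1 \<Longrightarrow> (\<lambda>p. zeta (dyadic_above p t) \<omega>) \<longlonglongrightarrow> Z \<omega> t"
    and "\<And>t. t \<in> dyadics \<Longrightarrow> Z \<omega> t = zeta t \<omega>"
proof -
  obtain g where g: "uniformly_continuous_on (closure dyadics) g" "\<And>x. x \<in> dyadics \<Longrightarrow> zeta x \<omega> = g x"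
    using uniformly_continuous_on_extension_on_closure[OF zeta_uniformly_continuous[OF assms]] by metis
  have cont: "continuous_on {0..1} g"
    using uniformly_continuous_imp_continuous[OF g(1)] closure_dyadics by (rule continuous_on_subset)
  have lim: "(\<lambda>p. zeta (dyadic_above p t) \<omega>) \<longlonglongrightarrow> g t" if t: "0 \<le> t" "t \<le> 1" for t
  proof -
    have "(\<lambda>p. g (dyadic_above p t)) \<longlonglongrightarrow> g t"
      using t dyadics_bounds[OF dyadic_above(1)[OF t]]
      by (intro continuous_on_tendsto_compose[OF cont dyadic_above_tendsto[OF t]]) auto
    then show ?thesis using g(2)[OF dyadic_above(1)[OF t]] by simp
  qed
  have Zg: "Z \<omega> t = g t" if "0 \<le> t" "t \<le> 1" for t
    using limI[OF lim[OF that]] assms by (simp add: Z_def)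
  show "continuous_on {0..1} (Z \<omega>)"
    using cont by (rule continuous_on_cong[THEN iffD1, rotated -1]) (auto simp: Zg)
  show "(\<lambda>p. zeta (dyadic_above p t) \<omega>) \<longlonglongrightarrow> Z \<omega> t" if "0 \<le> t" "t \<le> 1" for t
    using lim[OF that] Zg[OF that] by simp
  show "Z \<omega> t = zeta t \<omega>" if "t \<in> dyadics" for t
    using dyadics_bounds[OF that] Zg[of t] g(2)[OF that] by simp
qed

lemma Z_continuous: "continuous_on {0..1} (Z \<omega>)"
proof (cases "\<omega> \<in> regular")
  case True
  then show ?thesis by (rule Z_extension(1))
next
  case False
  then have "Z \<omega> = (\<lambda>_. 0)" by (auto simp: Z_def)
  then show ?thesis by simp
qed

lemma rv_Z[measurable]:
  assumes t: "0 \<le> t" "t \<le> 1"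
  shows "(\<lambda>\<omega>. Z \<omega> t) \<in> borel_measurable P"
proof (rule borel_measurable_LIMSEQ_metric)
  show "(\<lambda>\<omega>. if \<omega> \<in> regular then zeta (dyadic_above p t) \<omega> else 0) \<in> borel_measurable P" for p
    by measurable
  fix \<omega> assume "\<omega> \<in> space P"
  show "(\<lambda>p. if \<omega> \<in> regular then zeta (dyadic_above p t) \<omega> else 0) \<longlonglongrightarrow> Z \<omega> t"
  proof (cases "\<omega> \<in> regular")
    case True
    then show ?thesis using Z_extension(2)[OF True t] by simp
  qed (simp add: Z_def)
qed

text \<open>Dominated convergence on both sides of \<open>zeta_char\<close>: paths converge by
  continuity, and \<open>weighted\<close> converges at every observation because the dyadic times
  decrease to \<tau> in the limit from the right.\<close>

theorem Z_char:
  fixes F :: "'i set"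
  assumes F: "finite F" and \<tau>: "\<And>i. i \<in> F \<Longrightarrow> 0 \<le> \<tau> i \<and> \<tau> i \<le> 1"
  shows "(CLINT \<omega>|P. iexp (\<Sum>i\<in>F. a i \<bullet> Z \<omega> (\<tau> i))) = complex_of_real (exp (- (LINT z|\<nu>. (law.weighted a \<tau> F z)\<^sup>2) / 2))"
proof (rule LIMSEQ_unique)
  let ?\<tau> = "\<lambda>p i. dyadic_above p (\<tau> i)"
  have ZF: "(\<lambda>\<omega>. \<Sum>i\<in>F. a i \<bullet> Z \<omega> (\<tau> i)) \<in> borel_measurable P"
    using \<tau> by (intro borel_measurable_sum borel_measurable_inner borel_measurable_const rv_Z) auto
  show "(\<lambda>p. CLINT \<omega>|P. iexp (\<Sum>i\<in>F. a i \<bullet> zeta (?\<tau> p i) \<omega>)) \<longlonglongrightarrow> (CLINT \<omega>|P. iexp (\<Sum>i\<in>F. a i \<bullet> Z \<omega> (\<tau> i)))"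
  proof (rule integral_dominated_convergence[where w="\<lambda>_. 1"])
    show "(\<lambda>\<omega>. iexp (\<Sum>i\<in>F. a i \<bullet> Z \<omega> (\<tau> i))) \<in> borel_measurable P"
      using ZF by measurable
    show "(\<lambda>\<omega>. iexp (\<Sum>i\<in>F. a i \<bullet> zeta (?\<tau> p i) \<omega>)) \<in> borel_measurable P" for p by measurable
    show "AE \<omega> in P. (\<lambda>p. iexp (\<Sum>i\<in>F. a i \<bullet> zeta (?\<tau> p i) \<omega>)) \<longlonglongrightarrow> iexp (\<Sum>i\<in>F. a i \<bullet> Z \<omega> (\<tau> i))"
      using AE_regular
    proof eventually_elim
      case (elim \<omega>)
      have "(\<lambda>p. \<Sum>i\<in>F. a i \<bullet> zeta (?\<tau> p i) \<omega>) \<longlonglongrightarrow> (\<Sum>i\<in>F. a i \<bullet> Z \<omega> (\<tau> i))"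
        using \<tau> Z_extension(2)[OF elim] by (intro tendsto_sum tendsto_inner tendsto_const) auto
      then show ?case by (rule isCont_tendsto_compose[OF isCont_iexp])
    qed
    show "AE \<omega> in P. norm (iexp (\<Sum>i\<in>F. a i \<bullet> zeta (?\<tau> p i) \<omega>)) \<le> 1" for p
      by (intro AE_I2) (simp del: of_real_sum)
  qed simp
  have "(\<lambda>p. LINT z|\<nu>. (law.weighted a (?\<tau> p) F z)\<^sup>2) \<longlonglongrightarrow> (LINT z|\<nu>. (law.weighted a \<tau> F z)\<^sup>2)"
  proof (rule integral_dominated_convergence[where w="\<lambda>z. (\<Sum>i\<in>F. norm (a i) * CARD('d1))\<^sup>2 * (norm (snd z))\<^sup>2"])
    show "integrable \<nu> (\<lambda>z. (\<Sum>i\<in>F. norm (a i) * CARD('d1))\<^sup>2 * (norm (snd z))\<^sup>2)"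
      using law.square_law by simp
    show "AE z in \<nu>. norm ((law.weighted a (?\<tau> p) F z)\<^sup>2) \<le> (\<Sum>i\<in>F. norm (a i) * CARD('d1))\<^sup>2 * (norm (snd z))\<^sup>2" for p
      using law.weighted_square_le by (intro AE_I2) simp
    show "AE z in \<nu>. (\<lambda>p. (law.weighted a (?\<tau> p) F z)\<^sup>2) \<longlonglongrightarrow> (law.weighted a \<tau> F z)\<^sup>2"
    proof (rule AE_I2)
      fix z
      have "(\<lambda>p. Phi (?\<tau> p i) z :: real^'d2^'d1) \<longlonglongrightarrow> Phi (\<tau> i) z" if "i \<in> F" for i
      proof (rule vec_tendstoI)
        fix k
        note t = \<tau>[OF that, THEN conjunct1] \<tau>[OF that, THEN conjunct2]
        show "(\<lambda>p. (Phi (?\<tau> p i) z :: real^'d2^'d1) $ k) \<longlonglongrightarrow> Phi (\<tau> i) z $ k"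
        proof (rule tendsto_eventually, cases "fst z $ k \<le> \<tau> i")
          case True
          then have "fst z $ k \<le> ?\<tau> p i" for p using dyadic_above(2)[OF t, of p] by linarith
          then show "\<forall>\<^sub>F p in sequentially. (Phi (?\<tau> p i) z :: real^'d2^'d1) $ k = Phi (\<tau> i) z $ k"
            using True by (simp add: Phi_def)
        next
          case False
          then have "\<forall>\<^sub>F p in sequentially. ?\<tau> p i < fst z $ k"
            using order_tendstoD(2)[OF dyadic_above_tendsto[OF t]] by simp
          then show "\<forall>\<^sub>F p in sequentially. (Phi (?\<tau> p i) z :: real^'d2^'d1) $ k = Phi (\<tau> i) z $ k"
            by (rule eventually_mono) (use False in \<open>simp add: Phi_def\<close>)
        qed
      qed
      then show "(\<lambda>p. (law.weighted a (?\<tau> p) F z)\<^sup>2) \<longlonglongrightarrow> (law.weighted a \<tau> F z)\<^sup>2"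
        unfolding law.weighted_def by (intro tendsto_power tendsto_sum tendsto_inner tendsto_const)
    qed
  qed measurable
  then have lim: "(\<lambda>p. complex_of_real (exp (- (LINT z|\<nu>. (law.weighted a (?\<tau> p) F z)\<^sup>2) / 2)))
      \<longlonglongrightarrow> complex_of_real (exp (- (LINT z|\<nu>. (law.weighted a \<tau> F z)\<^sup>2) / 2))"
    by (intro tendsto_intros) simp_all
  have "(CLINT \<omega>|P. iexp (\<Sum>i\<in>F. a i \<bullet> zeta (?\<tau> p i) \<omega>)) = complex_of_real (exp (- (LINT z|\<nu>. (law.weighted a (?\<tau> p) F z)\<^sup>2) / 2))" for p
    using \<tau> by (intro zeta_char F dyadic_above(1)) auto
  with lim show "(\<lambda>p. CLINT \<omega>|P. iexp (\<Sum>i\<in>F. a i \<bullet> zeta (?\<tau> p i) \<omega>)) \<longlonglongrightarrow> complex_of_real (exp (- (LINT z|\<nu>. (law.weighted a \<tau> F z)\<^sup>2) / 2))"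
    by (simp only:)
qed

text \<open>Multiplying all weights by \<open>s\<close> turns \<open>Z_char\<close> into the whole
  characteristic function of \<open>V\<close>.\<close>

theorem Z_normal:
  fixes F :: "'i set" and a :: "'i \<Rightarrow> real^'d2^'d1"
  assumes F: "finite F" and \<tau>: "\<And>i. i \<in> F \<Longrightarrow> 0 \<le> \<tau> i \<and> \<tau> i \<le> 1"
  defines "V \<equiv> \<lambda>\<omega>. \<Sum>i\<in>F. a i \<bullet> Z \<omega> (\<tau> i)"
  shows "normal_rv P V" and "integrable P V" and "P.expectation V = 0"
    and "integrable P (\<lambda>\<omega>. (V \<omega>)\<^sup>2)" and "P.expectation (\<lambda>\<omega>. (V \<omega>)\<^sup>2) = (LINT z|\<nu>. (law.weighted a \<tau> F z)\<^sup>2)"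
proof -
  have V: "V \<in> borel_measurable P"
    unfolding V_def using \<tau> by (intro borel_measurable_sum borel_measurable_inner borel_measurable_const rv_Z) auto
  have Q: "0 \<le> (LINT z|\<nu>. (law.weighted a \<tau> F z)\<^sup>2)" by (rule Bochner_Integration.integral_nonneg) simp
  have char: "(CLINT \<omega>|P. iexp (s * V \<omega>)) = complex_of_real (exp (- (s\<^sup>2 * (LINT z|\<nu>. (law.weighted a \<tau> F z)\<^sup>2)) / 2))" for s
  proof -
    have "s * V \<omega> = (\<Sum>i\<in>F. (s *\<^sub>R a i) \<bullet> Z \<omega> (\<tau> i))" for \<omega>
      by (simp add: V_def sum_distrib_left)
    moreover have "law.weighted (\<lambda>i. s *\<^sub>R a i) \<tau> F z = s * law.weighted a \<tau> F z" for z
      by (simp add: law.weighted_def sum_distrib_left)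
    ultimately show ?thesis
      using Z_char[where a="\<lambda>i. s *\<^sub>R a i", OF F \<tau>] by (simp only: power_mult_distrib integral_mult_right_zero)
  qed
  show "normal_rv P V" and "integrable P V" and "P.expectation V = 0"
    and "integrable P (\<lambda>\<omega>. (V \<omega>)\<^sup>2)" and "P.expectation (\<lambda>\<omega>. (V \<omega>)\<^sup>2) = (LINT z|\<nu>. (law.weighted a \<tau> F z)\<^sup>2)"
    by (rule P.gaussian_char_imp_normal_rv[OF V Q char])+
qed

text \<open>Polarization: the product is recovered from the squares of the sum and the difference,
  both covered by \<open>Z_normal\<close>.\<close>

theorem Z_covariance:
  assumes s: "0 \<le> s" "s \<le> 1" and t: "0 \<le> t" "t \<le> 1"
  shows "integrable P (\<lambda>\<omega>. (x \<bullet> Z \<omega> s) * (y \<bullet> Z \<omega> t))"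
    and "P.expectation (\<lambda>\<omega>. (x \<bullet> Z \<omega> s) * (y \<bullet> Z \<omega> t)) = (LINT z|\<nu>. (x \<bullet> Phi s z) * (y \<bullet> Phi t z))"
proof -
  let ?F = "{True, False}"
  let ?\<tau> = "\<lambda>b. if b then s else t"
  let ?a = "\<lambda>b. if b then x else y" and ?b = "\<lambda>b. if b then x else - y"
  have \<tau>: "0 \<le> ?\<tau> b \<and> ?\<tau> b \<le> 1" for b using s t by simp
  note plus = Z_normal[where F="?F" and \<tau>="?\<tau>" and a="?a", OF _ \<tau>, simplified]
  note minus = Z_normal[where F="?F" and \<tau>="?\<tau>" and a="?b", OF _ \<tau>, simplified]
  have polar: "u * v = ((u + v)\<^sup>2 - (u - v)\<^sup>2) / 4" for u v :: real
    by (simp add: power2_eq_square algebra_simps)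
  have wp: "law.weighted ?a ?\<tau> ?F z = x \<bullet> Phi s z + y \<bullet> Phi t z" for z by (simp add: law.weighted_def)
  have wm: "law.weighted ?b ?\<tau> ?F z = x \<bullet> Phi s z - y \<bullet> Phi t z" for z by (simp add: law.weighted_def)
  have ip: "integrable P (\<lambda>\<omega>. (x \<bullet> Z \<omega> s + y \<bullet> Z \<omega> t)\<^sup>2)" and im: "integrable P (\<lambda>\<omega>. (x \<bullet> Z \<omega> s - y \<bullet> Z \<omega> t)\<^sup>2)"
    using plus(4) minus(4) by simp_all
  have np: "integrable \<nu> (\<lambda>z. (x \<bullet> Phi s z + y \<bullet> Phi t z)\<^sup>2)" and nm: "integrable \<nu> (\<lambda>z. (x \<bullet> Phi s z - y \<bullet> Phi t z)\<^sup>2)"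
    using law.integrable_weighted_square[of ?a ?\<tau> ?F] law.integrable_weighted_square[of ?b ?\<tau> ?F] unfolding wp wm by simp_all
  show "integrable P (\<lambda>\<omega>. (x \<bullet> Z \<omega> s) * (y \<bullet> Z \<omega> t))"
    unfolding polar using ip im by simp
  show "P.expectation (\<lambda>\<omega>. (x \<bullet> Z \<omega> s) * (y \<bullet> Z \<omega> t)) = (LINT z|\<nu>. (x \<bullet> Phi s z) * (y \<bullet> Phi t z))"
    unfolding polar using ip im np nm plus(5) minus(5) unfolding wp wm by simp
qed

end

section \<open>Weak convergence in the space of bounded paths\<close>

abbreviation path_space :: "(real \<Rightarrow> 'v::euclidean_space) metric" where
  "path_space \<equiv> funspace {0..1} euclidean_metric"

lemma restrict_in_path_space:
  fixes f :: "real \<Rightarrow> 'v::euclidean_space"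
  shows "restrict f {0..1} \<in> mspace path_space \<longleftrightarrow> bounded (f ` {0..1})"
proof -
  have "restrict f {0..1} ` {0..1} = f ` {0..1}" by auto
  then show ?thesis by (simp add: Met_TC.fspace_def)
qed

lemma path_space_dist_le:
  fixes f f' :: "real \<Rightarrow> 'v::euclidean_space"
  assumes "bounded (f ` {0..1})" "bounded (f' ` {0..1})"
    and "\<And>t. 0 \<le> t \<Longrightarrow> t \<le> 1 \<Longrightarrow> norm (f t - f' t) \<le> a"
  shows "mdist path_space (restrict f {0..1}) (restrict f' {0..1}) \<le> a"
  using assms restrict_in_path_space[of f] restrict_in_path_space[of f']
  by (subst funspace_mdist_le) (auto simp: dist_norm)

definition step :: "nat \<Rightarrow> (nat \<Rightarrow> 'v::euclidean_space) \<Rightarrow> real \<Rightarrow> 'v" where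
  "step m w = restrict (\<lambda>t. w (nat \<lfloor>m * t\<rfloor>)) {0..1}"

lemma step_index: "0 \<le> t \<Longrightarrow> t \<le> 1 \<Longrightarrow> nat \<lfloor>real m * t\<rfloor> \<le> m"
proof -
  assume "0 \<le> t" "t \<le> 1"
  then have "real m * t \<le> m" by (simp add: mult_left_le)
  then show ?thesis by linarith
qed

lemma bounded_step_path: "bounded ((\<lambda>t. w (nat \<lfloor>real m * t\<rfloor>)) ` {0..1})"
proof (rule finite_imp_bounded, rule finite_subset)
  show "(\<lambda>t. w (nat \<lfloor>real m * t\<rfloor>)) ` {0..1} \<subseteq> w ` {..m}"
    using step_index[of _ m] by auto
qed simp

lemma step_in_path_space: "step m w \<in> mspace path_space"
  unfolding step_def using bounded_step_path by (simp only: restrict_in_path_space)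

lemma step_dist_le: "mdist path_space (step m v) (step m w) \<le> (\<Sum>l\<le>m. norm (v l - w l))"
  unfolding step_def
proof (rule path_space_dist_le[OF bounded_step_path bounded_step_path])
  fix t :: real assume "0 \<le> t" "t \<le> 1"
  then show "norm (v (nat \<lfloor>real m * t\<rfloor>) - w (nat \<lfloor>real m * t\<rfloor>)) \<le> (\<Sum>l\<le>m. norm (v l - w l))"
    using member_le_sum[of "nat \<lfloor>real m * t\<rfloor>" "{..m}" "\<lambda>l. norm (v l - w l)"] step_index[of t m] by simp
qed

text \<open>In the supremum metric a step path depends continuously on its \<open>m + 1\<close>
  values, so the functional is a continuous function of finitely many random vectors.\<close>

lemma measurable_functional_of_step:
  fixes v :: "nat \<Rightarrow> 'a \<Rightarrow> 'v::euclidean_space"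
  assumes cont: "continuous_map (mtopology_of path_space) euclideanreal g"
    and v: "\<And>l. l \<le> m \<Longrightarrow> v l \<in> borel_measurable Q"
  shows "(\<lambda>\<omega>. g (step m (\<lambda>l. v l \<omega>))) \<in> borel_measurable Q"
proof -
  define h where "h w = g (step m w)" for w :: "nat \<Rightarrow> 'v"
  have "isCont h w" for w
    unfolding isCont_def
  proof (rule tendstoI)
    fix e :: real assume "0 < e"
    then obtain d where d: "d > 0" "\<And>y. y \<in> mspace path_space \<Longrightarrow> mdist path_space (step m w) y < d \<Longrightarrow> \<bar>g y - g (step m w)\<bar> < e"
      using continuous_map_real_epsilon[OF cont step_in_path_space] by blast
    have "((\<lambda>u. u l) \<longlongrightarrow> w l) (at w)" for l
      using continuous_on_product_coordinates[of l] by (auto simp: continuous_on_def)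
    then have "((\<lambda>u. \<Sum>l\<le>m. norm (w l - u l)) \<longlongrightarrow> (\<Sum>l\<le>m. norm (w l - w l))) (at w)"
      by (intro tendsto_intros)
    then have "\<forall>\<^sub>F u in at w. (\<Sum>l\<le>m. norm (w l - u l)) < d"
      using d(1) by (intro order_tendstoD(2)) auto
    then show "\<forall>\<^sub>F u in at w. dist (h u) (h w) < e"
    proof eventually_elim
      case (elim u)
      then show ?case
        using d(2)[OF step_in_path_space[of m u]] step_dist_le[of m w u] by (simp add: h_def dist_real_def)
    qed
  qed
  then have "h \<in> borel_measurable borel"
    by (intro borel_measurable_continuous_onI continuous_at_imp_continuous_on) auto
  then have h: "h \<in> borel_measurable (\<Pi>\<^sub>M i\<in>UNIV. borel)"
    using measurable_cong_sets[OF sets_PiM_equal_borel refl] by auto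
  have "(\<lambda>\<omega>. \<lambda>l\<in>UNIV. if l \<le> m then v l \<omega> else 0) \<in> Q \<rightarrow>\<^sub>M (\<Pi>\<^sub>M i\<in>UNIV. borel)"
  proof (rule measurable_restrict)
    show "(\<lambda>\<omega>. if l \<le> m then v l \<omega> else 0) \<in> borel_measurable Q" for l
      using v[of l] by (cases "l \<le> m") simp_all
  qed
  from measurable_compose[OF this h]
  have "(\<lambda>\<omega>. h (\<lambda>l. if l \<le> m then v l \<omega> else 0)) \<in> borel_measurable Q"
    by (simp only: restrict_UNIV)
  moreover have "step m (\<lambda>l. if l \<le> m then v l \<omega> else 0) = step m (\<lambda>l. v l \<omega>)" for \<omega>
    unfolding step_def using step_index by (intro restrict_ext) auto
  ultimately show ?thesis by (simp add: h_def)
qed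

text \<open>Sorting takes values in the countable set of lists. The insertion step is measurable for
  each fixed list and is then evaluated at the random sorted tail.\<close>

lemma measurable_sort_key:
  assumes x: "\<And>i. i \<in> set js \<Longrightarrow> (\<lambda>\<omega>. x \<omega> i) \<in> borel_measurable Q"
  shows "(\<lambda>\<omega>. sort_key (x \<omega> :: nat \<Rightarrow> real) js) \<in> Q \<rightarrow>\<^sub>M count_space UNIV"
  using x
proof (induction js)
  case (Cons j js)
  have ins: "(\<lambda>\<omega>. insort_key (x \<omega>) j ys) \<in> Q \<rightarrow>\<^sub>M count_space UNIV" if "set ys \<subseteq> set js" for ys
    using that
  proof (induction ys)
    case (Cons y ys)
    have [measurable]: "(\<lambda>\<omega>. x \<omega> j) \<in> borel_measurable Q" "(\<lambda>\<omega>. x \<omega> y) \<in> borel_measurable Q"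
      using Cons.prems \<open>\<And>i. i \<in> set (j # js) \<Longrightarrow> _\<close> by auto
    have [measurable]: "(\<lambda>\<omega>. y # insort_key (x \<omega>) j ys) \<in> Q \<rightarrow>\<^sub>M count_space UNIV"
      using Cons by (intro measurable_compose[OF Cons.IH]) auto
    show ?case by simp
  qed simp
  \<comment> \<open>Measurability of the insertion is known only for lists with elements from
    \<open>js\<close>, so the range of the sorted tail is restricted accordingly.\<close>
  define S where "S = {ys. set ys = set js \<and> length ys = length js}"
  have S: "countable S" by (rule countable_subset[OF subset_UNIV]) simp
  have sk: "(\<lambda>\<omega>. sort_key (x \<omega>) js) \<in> Q \<rightarrow>\<^sub>M count_space S"
  proof (rule measurable_count_space_extend[OF subset_UNIV])
    show "(\<lambda>\<omega>. sort_key (x \<omega>) js) \<in> space Q \<rightarrow> S" by (simp add: S_def)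
    show "(\<lambda>\<omega>. sort_key (x \<omega>) js) \<in> Q \<rightarrow>\<^sub>M count_space UNIV" using Cons by simp
  qed
  have "(\<lambda>\<omega>. insort_key (x \<omega>) j (sort_key (x \<omega>) js)) \<in> Q \<rightarrow>\<^sub>M count_space UNIV"
    by (rule measurable_compose_countable'[OF _ sk S, where f="\<lambda>ys \<omega>. insort_key (x \<omega>) j ys"]) (rule ins, simp add: S_def)
  then show ?case by simp
qed simp

lemma measurable_induced_order_stat:
  fixes y :: "nat \<Rightarrow> 'a \<Rightarrow> 'v::euclidean_space"
  assumes x: "\<And>i. (\<lambda>\<omega>. x \<omega> i) \<in> borel_measurable Q" and y: "\<And>i. y i \<in> borel_measurable Q"
  shows "(\<lambda>\<omega>. induced_order_stat (x \<omega>) (\<lambda>i. y i \<omega>) n j) \<in> borel_measurable Q"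
proof -
  have "(\<lambda>\<omega>. sort_key (x \<omega>) [1..<Suc n] ! (j - 1)) \<in> Q \<rightarrow>\<^sub>M count_space UNIV"
    by (rule measurable_compose[OF measurable_sort_key]) (auto intro: x)
  from measurable_compose_countable'[OF _ this, where f="\<lambda>i \<omega>. y i \<omega>"] y
  show ?thesis unfolding induced_order_stat_def by simp
qed

section \<open>Comparison of the sample paths with the limit paths\<close>

context gaussian_limit
begin

definition Zt :: "nat \<Rightarrow> 'a \<Rightarrow> real \<Rightarrow> real^'d2^'d1" where
  "Zt n \<omega> t = (1 / sqrt n) *\<^sub>R induced_sum_process X Y n \<omega> t"

definition Zgrid :: "nat \<Rightarrow> nat \<Rightarrow> 'a \<Rightarrow> real^'d2^'d1" where
  "Zgrid n l \<omega> = (1 / sqrt n) *\<^sub>R (\<chi> k. \<Sum>j = 1..l. induced_order_stat (\<lambda>i. X i \<omega> $ k) (\<lambda>i. Y i \<omega>) n j)"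

abbreviation sample_path :: "nat \<Rightarrow> 'a \<Rightarrow> real \<Rightarrow> real^'d2^'d1" where
  "sample_path n \<omega> \<equiv> restrict (Zt n \<omega>) {0..1}"

abbreviation limit_path :: "'p \<Rightarrow> real \<Rightarrow> real^'d2^'d1" where
  "limit_path \<omega> \<equiv> restrict (Z \<omega>) {0..1}"

lemma Zt_eq_step: "sample_path n \<omega> = step n (\<lambda>l. Zgrid n l \<omega>)"
  by (simp add: step_def Zt_def[abs_def] Zgrid_def induced_sum_process_def)

lemma rv_Zgrid: "Zgrid n l \<in> borel_measurable M"
  unfolding Zgrid_def[abs_def]
  by (intro borel_measurable_scaleR borel_measurable_const borel_measurable_vec_lambda borel_measurable_sum
      measurable_induced_order_stat borel_measurable_vec_nth' rv_X rv_Y)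

lemma Z_bounded: "bounded (Z \<omega> ` {0..1})"
  by (intro compact_imp_bounded compact_continuous_image Z_continuous) simp

lemma Zt_in_path_space: "sample_path n \<omega> \<in> mspace path_space"
  unfolding Zt_eq_step by (rule step_in_path_space)

lemma Z_in_path_space: "limit_path \<omega> \<in> mspace path_space"
  using Z_bounded by (simp only: restrict_in_path_space)

lemma rv_functional_Zt:
  assumes "continuous_map (mtopology_of path_space) euclideanreal g"
  shows "(\<lambda>\<omega>. g (sample_path n \<omega>)) \<in> borel_measurable M"
  unfolding Zt_eq_step using assms by (rule measurable_functional_of_step) (rule rv_Zgrid)

definition Zstep :: "nat \<Rightarrow> 'p \<Rightarrow> real \<Rightarrow> real^'d2^'d1" where
  "Zstep q \<omega> = step (2^q) (\<lambda>l. Z \<omega> (real l / 2^q))"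

lemma Zstep_tendsto: "(\<lambda>q. mdist path_space (limit_path \<omega>) (Zstep q \<omega>)) \<longlonglongrightarrow> 0"
proof (rule LIMSEQ_I)
  fix e :: real assume e: "0 < e"
  have "uniformly_continuous_on {0..1} (Z \<omega>)"
    by (intro compact_uniformly_continuous Z_continuous) simp
  then obtain d where d: "d > 0" "\<And>s t. s \<in> {0..1} \<Longrightarrow> t \<in> {0..1} \<Longrightarrow> dist t s < d \<Longrightarrow> dist (Z \<omega> t) (Z \<omega> s) < e / 2"
    unfolding uniformly_continuous_on_def using e by (metis half_gt_zero)
  obtain q0 where q0: "(1/2)^q0 < d" using real_arch_pow_inv[OF d(1), of "1/2"] by auto
  show "\<exists>no. \<forall>q\<ge>no. norm (mdist path_space (limit_path \<omega>) (Zstep q \<omega>) - 0) < e"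
  proof (intro exI allI impI)
    fix q assume "q0 \<le> q"
    then have "(1/2::real)^q \<le> (1/2)^q0" by (intro power_decreasing) auto
    then have q: "(1/2)^q < d" using q0 by linarith
    have "mdist path_space (limit_path \<omega>) (Zstep q \<omega>) \<le> e / 2"
      unfolding Zstep_def step_def
    proof (rule path_space_dist_le[OF Z_bounded bounded_step_path])
      fix t :: real assume t: "0 \<le> t" "t \<le> 1"
      define s where "s = real (nat \<lfloor>real (2^q) * t\<rfloor>) / 2^q"
      have l: "real (nat \<lfloor>real (2^q) * t\<rfloor>) \<le> 2^q * t" "2^q * t < real (nat \<lfloor>real (2^q) * t\<rfloor>) + 1"
        using t by (auto simp: of_nat_nat)
      have s: "0 \<le> s" "s \<le> t" "t < s + (1/2)^q"
        using l unfolding s_def by (auto simp: field_simps power_divide)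
      then show "norm (Z \<omega> t - Z \<omega> (real (nat \<lfloor>real (2^q) * t\<rfloor>) / 2^q)) \<le> e / 2"
        using d(2)[of s t] t q unfolding s_def[symmetric] by (simp add: dist_norm)
    qed
    then show "norm (mdist path_space (limit_path \<omega>) (Zstep q \<omega>) - 0) < e"
      using e mdist_nonneg[of path_space "limit_path \<omega>" "Zstep q \<omega>"] by simp
  qed
qed

lemma rv_functional_Zstep:
  assumes "continuous_map (mtopology_of path_space) euclideanreal g"
  shows "(\<lambda>\<omega>. g (Zstep q \<omega>)) \<in> borel_measurable P"
  unfolding Zstep_def using assms
proof (rule measurable_functional_of_step)
  fix l :: nat assume "l \<le> 2^q"
  then show "(\<lambda>\<omega>. Z \<omega> (real l / 2^q)) \<in> borel_measurable P"
    using dyadics_bounds[OF dyadicsI[of l q]] by (intro rv_Z) auto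
qed

lemma functional_Zstep_tendsto:
  assumes cont: "continuous_map (mtopology_of path_space) euclideanreal g"
  shows "(\<lambda>q. g (Zstep q \<omega>)) \<longlonglongrightarrow> g (limit_path \<omega>)"
proof (rule tendstoI)
  fix e :: real assume "0 < e"
  then obtain d where d: "d > 0" "\<And>y. y \<in> mspace path_space \<Longrightarrow> mdist path_space (limit_path \<omega>) y < d \<Longrightarrow> \<bar>g y - g (limit_path \<omega>)\<bar> < e"
    using continuous_map_real_epsilon[OF cont Z_in_path_space] by blast
  have "\<forall>\<^sub>F q in sequentially. mdist path_space (limit_path \<omega>) (Zstep q \<omega>) < d"
    using order_tendstoD(2)[OF Zstep_tendsto d(1)] .
  then show "\<forall>\<^sub>F q in sequentially. dist (g (Zstep q \<omega>)) (g (limit_path \<omega>)) < e"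
  proof eventually_elim
    case (elim q)
    then show ?case using d(2)[of "Zstep q \<omega>"] by (simp add: dist_real_def Zstep_def step_in_path_space del: mspace_funspace mdist_funspace)
  qed
qed

lemma rv_functional_Z:
  assumes cont: "continuous_map (mtopology_of path_space) euclideanreal g"
  shows "(\<lambda>\<omega>. g (limit_path \<omega>)) \<in> borel_measurable P"
  by (rule borel_measurable_LIMSEQ_metric[OF rv_functional_Zstep[OF cont] functional_Zstep_tendsto[OF cont]])

text \<open>Three comparisons at a suitable level \<open>q\<close>: sample path with the step path
  of \<open>W n\<close> off the bad event, step path of \<open>W n\<close> with that of
  \<open>zeta\<close> by \<open>grid_convergence\<close>, and step path of the limit with the limit
  itself by continuity.\<close>

lemma Lipschitz_convergence:
  fixes g :: "(real \<Rightarrow> real^'d2^'d1) \<Rightarrow> real"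
  assumes lip: "\<And>x y. x \<in> mspace path_space \<Longrightarrow> y \<in> mspace path_space \<Longrightarrow> \<bar>g x - g y\<bar> \<le> K * mdist path_space x y"
    and bdd: "\<And>x. x \<in> mspace path_space \<Longrightarrow> \<bar>g x\<bar> \<le> B" and K: "0 \<le> K"
  shows "(\<lambda>n. LINT \<omega>|M. g (sample_path n \<omega>)) \<longlonglongrightarrow> (LINT \<omega>|P. g (limit_path \<omega>))"
proof (rule LIMSEQ_I)
  fix r :: real assume r: "0 < r"
  have cont: "continuous_map (mtopology_of path_space) euclideanreal g"
    by (rule lipschitz_imp_continuous_map_real[OF lip])
  have B: "0 \<le> B" using bdd[OF Z_in_path_space] by (meson abs_ge_zero order_trans)
  \<comment> \<open>The factor of \<open>e\<close> in
    \<open>induced_sum_process_approx\<close>.\<close>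
  define c where "c = real CARD('d1) * (real CARD('d2) * 5)"
  have c: "0 < c" by (simp add: c_def)
  \<comment> \<open>Chosen so that the Lipschitz bound off the bad event is at most
    \<open>r / 5\<close>; \<open>K + 1\<close> avoids dividing by 0.\<close>
  define e where "e = r / (5 * (K + 1) * c)"
  have e: "0 < e" using r K c by (simp add: e_def)
  have Ke: "K * (c * e) \<le> r / 5"
  proof -
    have "K * (c * e) \<le> (K + 1) * (c * e)" using c e by (intro mult_right_mono) auto
    also have "\<dots> = ((K + 1) * c) * r / (((K + 1) * c) * 5)" by (simp add: e_def mult_ac)
    also have "\<dots> = r / 5" using c K by (subst mult_divide_mult_cancel_left) auto
    finally show ?thesis .
  qed
  have "(\<lambda>q. LINT \<omega>|P. g (Zstep q \<omega>)) \<longlonglongrightarrow> (LINT \<omega>|P. g (limit_path \<omega>))"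
  proof (rule integral_dominated_convergence[where w="\<lambda>_. B"])
    show "AE \<omega> in P. (\<lambda>q. g (Zstep q \<omega>)) \<longlonglongrightarrow> g (limit_path \<omega>)"
      by (rule AE_I2) (rule functional_Zstep_tendsto[OF cont])
    show "AE \<omega> in P. norm (g (Zstep q \<omega>)) \<le> B" for q
      by (rule AE_I2) (simp only: real_norm_def Zstep_def bdd[OF step_in_path_space])
  qed (simp_all only: rv_functional_Z[OF cont] rv_functional_Zstep[OF cont] P.integrable_const)
  then have ev1: "\<forall>\<^sub>F q in sequentially. \<bar>(LINT \<omega>|P. g (Zstep q \<omega>)) - (LINT \<omega>|P. g (limit_path \<omega>))\<bar> < r / 5"
    using r unfolding tendsto_iff dist_real_def by (metis divide_pos_pos zero_less_numeral)
  \<comment> \<open>Together with an equal slack in \<open>ev3\<close> this bounds the bad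
    probability by \<open>r / (5 * (B + 1))\<close>. The bad event then costs at most two fifths of
    \<open>r\<close>, which completes the five.\<close>
  have "\<forall>\<^sub>F q in sequentially. bad_limit q e < r / (10 * (B + 1))"
    using order_tendstoD(2)[OF bad_limit_tendsto, of "r / (10 * (B + 1))" e] r B by simp
  then obtain q where q: "\<bar>(LINT \<omega>|P. g (Zstep q \<omega>)) - (LINT \<omega>|P. g (limit_path \<omega>))\<bar> < r / 5"
    "bad_limit q e < r / (10 * (B + 1))"
    using eventually_happens'[OF sequentially_bot eventually_conj[OF ev1]] by blast
  let ?Ws = "\<lambda>n \<omega>. step (2^q) (\<lambda>l. W n (real l / 2^q) \<omega>)"
  have "(\<lambda>n. LINT \<omega>|M. g (?Ws n \<omega>)) \<longlonglongrightarrow> (LINT \<omega>|P. g (step (2^q) (\<lambda>l. zeta (real l / 2^q) \<omega>)))"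
  proof (rule grid_convergence[where L=K and B=B and F="\<lambda>w. g (step (2^q) w)", OF K])
    show "\<bar>g (step (2^q) v) - g (step (2^q) w)\<bar> \<le> K * (\<Sum>l\<le>2^q. norm (v l - w l))" for v w
      by (rule order_trans[OF lip[OF step_in_path_space step_in_path_space] mult_left_mono[OF step_dist_le K]])
    show "\<bar>g (step (2^q) w)\<bar> \<le> B" for w by (rule bdd[OF step_in_path_space])
  qed
  moreover have "(LINT \<omega>|P. g (step (2^q) (\<lambda>l. zeta (real l / 2^q) \<omega>))) = (LINT \<omega>|P. g (Zstep q \<omega>))"
  proof (rule integral_cong_AE)
    show "(\<lambda>\<omega>. g (step (2^q) (\<lambda>l. zeta (real l / 2^q) \<omega>))) \<in> borel_measurable P"
      by (rule measurable_functional_of_step[OF cont rv_zeta])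
    show "AE \<omega> in P. g (step (2^q) (\<lambda>l. zeta (real l / 2^q) \<omega>)) = g (Zstep q \<omega>)"
      using AE_regular
    proof eventually_elim
      case (elim \<omega>)
      have "step (2^q) (\<lambda>l. zeta (real l / 2^q) \<omega>) = Zstep q \<omega>"
        unfolding Zstep_def step_def
      proof (rule restrict_ext)
        fix t :: real assume "t \<in> {0..1}"
        then have "nat \<lfloor>real (2^q) * t\<rfloor> \<le> 2^q" by (intro step_index) auto
        from Z_extension(3)[OF elim dyadicsI[OF this]]
        show "zeta (real (nat \<lfloor>real (2^q) * t\<rfloor>) / 2^q) \<omega> = Z \<omega> (real (nat \<lfloor>real (2^q) * t\<rfloor>) / 2^q)" by simp
      qed
      then show ?case by simp
    qed
  qed (rule rv_functional_Zstep[OF cont])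
  ultimately have "(\<lambda>n. LINT \<omega>|M. g (?Ws n \<omega>)) \<longlonglongrightarrow> (LINT \<omega>|P. g (Zstep q \<omega>))" by simp
  then have ev2: "\<forall>\<^sub>F n in sequentially. \<bar>(LINT \<omega>|M. g (?Ws n \<omega>)) - (LINT \<omega>|P. g (Zstep q \<omega>))\<bar> < r / 5"
    using r unfolding tendsto_iff dist_real_def by (metis divide_pos_pos zero_less_numeral)
  have ev3: "\<forall>\<^sub>F n in sequentially. prob (bad n q e) < bad_limit q e + r / (10 * (B + 1))"
    using r B by (intro eventually_prob_bad_less[OF e]) simp
  have main: "\<bar>(LINT \<omega>|M. g (sample_path n \<omega>)) - (LINT \<omega>|M. g (?Ws n \<omega>))\<bar> \<le> r / 5 + 2 * B * prob (bad n q e)"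
    if n: "2^q \<le> n" for n
  proof -
    have meas: "(\<lambda>\<omega>. g (sample_path n \<omega>)) \<in> borel_measurable M" "(\<lambda>\<omega>. g (?Ws n \<omega>)) \<in> borel_measurable M"
      by (rule rv_functional_Zt[OF cont], rule measurable_functional_of_step[OF cont rv_W])
    have int: "integrable M (\<lambda>\<omega>. g (sample_path n \<omega>))" "integrable M (\<lambda>\<omega>. g (?Ws n \<omega>))"
      by (rule integrable_const_bound[where B=B, OF _ meas(1)], rule AE_I2, simp only: real_norm_def bdd[OF Zt_in_path_space],
          rule integrable_const_bound[where B=B, OF _ meas(2)], rule AE_I2, simp only: real_norm_def bdd[OF step_in_path_space])
    have bi: "integrable M (\<lambda>\<omega>. indicator (bad n q e) \<omega> :: real)"
      using bad_sets[OF e] by (intro integrable_real_indicator) (auto simp: less_top[symmetric])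
    have "\<bar>(LINT \<omega>|M. g (sample_path n \<omega>)) - (LINT \<omega>|M. g (?Ws n \<omega>))\<bar> =
       \<bar>LINT \<omega>|M. g (sample_path n \<omega>) - g (?Ws n \<omega>)\<bar>"
      using int by (simp only: Bochner_Integration.integral_diff)
    also have "\<dots> \<le> (LINT \<omega>|M. \<bar>g (sample_path n \<omega>) - g (?Ws n \<omega>)\<bar>)" by (rule integral_abs_bound)
    also have "\<dots> \<le> (LINT \<omega>|M. r / 5 + 2 * B * indicator (bad n q e) \<omega>)"
    proof (rule integral_mono)
      show "integrable M (\<lambda>\<omega>. \<bar>g (sample_path n \<omega>) - g (?Ws n \<omega>)\<bar>)"
        using int by (intro integrable_abs Bochner_Integration.integrable_diff)
      show "integrable M (\<lambda>\<omega>. r / 5 + 2 * B * indicator (bad n q e) \<omega>)"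
        by (intro Bochner_Integration.integrable_add integrable_mult_right bi integrable_const)
      fix \<omega> assume \<omega>: "\<omega> \<in> space M"
      show "\<bar>g (sample_path n \<omega>) - g (?Ws n \<omega>)\<bar> \<le> r / 5 + 2 * B * indicator (bad n q e) \<omega>"
      proof (cases "\<omega> \<in> bad n q e")
        case True
        have "\<bar>g (sample_path n \<omega>)\<bar> \<le> B" "\<bar>g (?Ws n \<omega>)\<bar> \<le> B"
          by (rule bdd[OF Zt_in_path_space], rule bdd[OF step_in_path_space])
        then show ?thesis using True r by simp
      next
        case False
        have "mdist path_space (sample_path n \<omega>) (?Ws n \<omega>) \<le> c * e"
          unfolding step_def
        proof (rule path_space_dist_le[OF _ bounded_step_path])
          show "bounded (Zt n \<omega> ` {0..1})" using Zt_in_path_space restrict_in_path_space by blast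
          fix t :: real assume t: "0 \<le> t" "t \<le> 1"
          from induced_sum_process_approx[OF \<omega> False e n t]
          show "norm (Zt n \<omega> t - W n (real (nat \<lfloor>real (2^q) * t\<rfloor>) / 2^q) \<omega>) \<le> c * e"
            by (simp add: Zt_def c_def mult.assoc)
        qed
        then have "K * mdist path_space (sample_path n \<omega>) (?Ws n \<omega>) \<le> K * (c * e)"
          using K by (rule mult_left_mono)
        then have "\<bar>g (sample_path n \<omega>) - g (?Ws n \<omega>)\<bar> \<le> r / 5"
          using lip[OF Zt_in_path_space[of n \<omega>] step_in_path_space[of "2^q" "\<lambda>l. W n (real l / 2^q) \<omega>"]] Ke by linarith
        then show ?thesis using False by simp
      qed
    qed
    also have "\<dots> = r / 5 + 2 * B * prob (bad n q e)"
      using bi bad_sets[OF e, of n q] by (simp add: prob_space)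
    finally show ?thesis .
  qed
  have "\<forall>\<^sub>F n in sequentially. norm ((LINT \<omega>|M. g (sample_path n \<omega>)) - (LINT \<omega>|P. g (limit_path \<omega>))) < r"
    using ev2 ev3 eventually_ge_at_top[of "2^q"]
  proof eventually_elim
    case (elim n)
    have "prob (bad n q e) \<le> r / (5 * (B + 1))"
    proof -
      have aux: "x < y + z \<Longrightarrow> y < z \<Longrightarrow> x \<le> 2 * z" for x y z :: real by linarith
      have "2 * (r / (10 * d)) = r / (5 * d)" for d :: real by simp
      then show ?thesis using aux[OF elim(2) q(2)] by (simp only:)
    qed
    then have "2 * B * prob (bad n q e) \<le> 2 * B * (r / (5 * (B + 1)))" using B by (intro mult_left_mono) auto
    also have "\<dots> \<le> 2 * (r / 5)" using B r by (simp add: field_simps)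
    finally show ?case using main[OF elim(3)] elim(1) q(1) unfolding real_norm_def by linarith
  qed
  then show "\<exists>no. \<forall>n\<ge>no. norm ((LINT \<omega>|M. g (sample_path n \<omega>)) - (LINT \<omega>|P. g (limit_path \<omega>))) < r"
    by (simp only: eventually_sequentially)
qed

text \<open>Continuous functionals of the sample paths are measurable, so the outer expectations are
  expectations and the Lipschitz case extends by \<open>convergence_of_lipschitz\<close>.\<close>

theorem weak_convergence:
  "weakly_converges_uniformly {0..1} M Zt P Z"
  unfolding weakly_converges_uniformly_def Let_def
proof (intro conjI allI ballI impI)
  show "sample_path n \<omega> \<in> mspace path_space" for n \<omega> by (rule Zt_in_path_space)
  show "limit_path \<omega> \<in> mspace path_space" for \<omega> by (rule Z_in_path_space)
  fix g :: "(real \<Rightarrow> real^'d2^'d1) \<Rightarrow> real"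
  assume "continuous_map (mtopology_of path_space) euclideanreal g \<and> bounded (g ` mspace path_space)"
  then have cont: "continuous_map (mtopology_of path_space) euclideanreal g" and "bounded (g ` mspace path_space)" by auto
  then obtain B where B: "\<And>x. x \<in> mspace path_space \<Longrightarrow> \<bar>g x\<bar> \<le> B"
    unfolding bounded_iff by auto
  show "(\<lambda>\<omega>. g (limit_path \<omega>)) \<in> borel_measurable P" by (rule rv_functional_Z[OF cont])
  have "integrable M (\<lambda>\<omega>. g (sample_path n \<omega>))" for n
    by (rule integrable_const_bound[where B=B, OF _ rv_functional_Zt[OF cont]]) (rule AE_I2, simp only: real_norm_def B[OF Zt_in_path_space])
  then have "outer_expectation M (\<lambda>\<omega>. g (sample_path n \<omega>)) = (LINT \<omega>|M. g (sample_path n \<omega>))" for n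
    by (rule outer_expectation_eq)
  moreover have "(\<lambda>n. LINT \<omega>|M. g (sample_path n \<omega>)) \<longlonglongrightarrow> (LINT \<omega>|P. g (limit_path \<omega>))"
    by (rule convergence_of_lipschitz[where L=path_space and V="\<lambda>n \<omega>. sample_path n \<omega>" and U="\<lambda>\<omega>. limit_path \<omega>" and B=B,
          OF prob_space_axioms P.prob_space_axioms Zt_in_path_space Z_in_path_space rv_functional_Zt rv_functional_Z Lipschitz_convergence cont B])
  ultimately show "(\<lambda>n. outer_expectation M (\<lambda>\<omega>. g (sample_path n \<omega>))) \<longlonglongrightarrow> (LINT \<omega>|P. g (limit_path \<omega>))"
    by simp
qed

end

section \<open>The regression model\<close>

lemma integrable_componentwise:
  fixes f :: "'a \<Rightarrow> 'v::euclidean_space"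
  assumes "\<And>b. b \<in> Basis \<Longrightarrow> integrable N (\<lambda>x. f x \<bullet> b)"
  shows "integrable N f"
proof -
  have "integrable N (\<lambda>x. \<Sum>b\<in>Basis. (f x \<bullet> b) *\<^sub>R b)"
    using assms by (intro Bochner_Integration.integrable_sum integrable_scaleR_left)
  then show ?thesis by (simp add: euclidean_representation)
qed

lemma integral_matrix:
  fixes f :: "'a \<Rightarrow> real^'n^'m"
  assumes "\<And>i j. integrable N (\<lambda>x. f x $ i $ j)"
  shows "integrable N f" and "(LINT x|N. f x) $ i $ j = (LINT x|N. f x $ i $ j)"
proof -
  show int: "integrable N f"
  proof (rule integrable_componentwise)
    fix b :: "real^'n^'m" assume "b \<in> Basis"
    then obtain i j where b: "b = axis i (axis j 1)" by (auto simp: Basis_vec_def)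
    show "integrable N (\<lambda>x. f x \<bullet> b)" using assms[of i j] by (simp add: b inner_axis)
  qed
  have "(LINT x|N. f x \<bullet> axis i (axis j 1)) = (LINT x|N. f x) \<bullet> axis i (axis j 1)"
    by (rule integral_inner_left) (rule int)
  then show "(LINT x|N. f x) $ i $ j = (LINT x|N. f x $ i $ j)" by (simp add: inner_axis)
qed

lemma row_outer_entry: "row_outer v w $ i $ j = v $ i * w $ j"
  by (simp add: row_outer_def matrix_matrix_mult_def transpose_def rowvector_def)

text \<open>Lower orthants are stable under intersection, generate the Borel sets, and exhaust the
  space along the diagonal.\<close>

lemma emeasure_eqI_atMost:
  fixes \<mu> \<mu>' :: "'v::ordered_euclidean_space measure"
  assumes "finite_measure \<mu>" and sets: "sets \<mu> = sets borel" "sets \<mu>' = sets borel"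
    and eq: "\<And>a. emeasure \<mu> {..a} = emeasure \<mu>' {..a}"
  shows "\<mu> = \<mu>'"
proof (rule measure_eqI_generator_eq[where \<Omega>=UNIV and E="range (\<lambda>a. {..a})" and A="\<lambda>n. {..real n *\<^sub>R One}"])
  show "Int_stable (range (\<lambda>a::'v. {..a}))"
  proof (rule Int_stableI_image)
    show "\<exists>c\<in>UNIV. {..a} \<inter> {..b} = {..c}" for a b :: 'v
      by (rule bexI[of _ "inf a b"]) auto
  qed
  show "sets \<mu> = sigma_sets UNIV (range (\<lambda>a. {..a}))" "sets \<mu>' = sigma_sets UNIV (range (\<lambda>a. {..a}))"
    using sets by (simp_all add: borel_eq_atMost)
  show "(\<Union>n. {..real n *\<^sub>R (One::'v)}) = UNIV"
  proof (intro equalityI subset_UNIV subsetI)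
    fix x :: 'v
    obtain n :: nat where n: "infnorm x \<le> real n" using real_arch_simple by blast
    have "x \<le> real n *\<^sub>R One"
      using order_trans[OF _ n] Basis_le_infnorm by (auto simp: eucl_le[where 'a='v] abs_le_iff)
    then show "x \<in> (\<Union>n. {..real n *\<^sub>R (One::'v)})" by auto
  qed
  show "emeasure \<mu> {..real n *\<^sub>R One} \<noteq> \<infinity>" for n
    using assms(1) by (simp add: finite_measure.emeasure_finite)
qed (use eq in auto)

locale regression_model = prob_space N for N :: "'b measure" +
  fixes X :: "'b \<Rightarrow> real^'d1" and Y :: "'b \<Rightarrow> real^'d2" and C c :: "real^'d1 \<Rightarrow> real"
    and m :: "real^'d1 \<Rightarrow> real^'d2" and sigma2 :: "real^'d1 \<Rightarrow> real^'d2^'d2"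
  assumes X[measurable]: "X \<in> borel_measurable N" and Y[measurable]: "Y \<in> borel_measurable N"
    and X_range: "\<And>\<omega>. \<omega> \<in> space N \<Longrightarrow> X \<omega> \<in> cbox 0 1"
    and C: "\<And>u. C u = measure N {\<omega> \<in> space N. X \<omega> \<le> u}"
    and copula: "is_copula C" and dens: "has_density C c"
    and m: "is_cond_exp_given N X Y m"
    and sigma2: "is_cond_exp_given N X (\<lambda>\<omega>. row_outer (Y \<omega> - m (X \<omega>)) (Y \<omega> - m (X \<omega>))) sigma2"
    and sq: "integrable N (\<lambda>\<omega>. (norm (Y \<omega>))\<^sup>2)"
    and m0: "\<And>u. u \<in> cbox 0 1 \<Longrightarrow> m u = 0"
begin

definition law :: "((real^'d1) \<times> (real^'d2)) measure" where
  "law = distr N borel (\<lambda>\<omega>. (X \<omega>, Y \<omega>))"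

lemma rv_pair[measurable]: "(\<lambda>\<omega>. (X \<omega>, Y \<omega>)) \<in> borel_measurable N"
  by (rule borel_measurable_Pair) measurable

lemma corner_cbox: "0 \<le> t \<Longrightarrow> t \<le> 1 \<Longrightarrow> corner k t \<in> cbox 0 (1::real^'d1)"
  by (auto simp: mem_box_cart corner_def)

lemma le_corner_iff: "x \<in> cbox 0 1 \<Longrightarrow> x \<le> corner k t \<longleftrightarrow> (x::real^'d1) $ k \<le> t"
  by (auto simp: mem_box_cart corner_def less_eq_vec_def)

text \<open>Inside the cube, the orthant below \<open>corner k t\<close> is the half-space given by
  the \<open>k\<close>-th coordinate. Both \<open>X\<close> and the measure that witnesses the
  copula are carried by the cube.\<close>

lemma marginal:
  assumes t: "0 \<le> t" "t \<le> 1"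
  shows "prob {\<omega> \<in> space N. X \<omega> $ k \<le> t} = t"
proof -
  obtain \<mu> :: "(real^'d1) measure" where \<mu>: "prob_space \<mu>" "sets \<mu> = sets borel" "measure \<mu> (cbox 0 1) = 1"
    "\<And>u. u \<in> cbox 0 1 \<Longrightarrow> C u = measure \<mu> {v. v \<le> u}"
    "distr \<mu> borel (\<lambda>v. v $ k) = uniform_measure lborel {0..1}"
    using copula unfolding is_copula_def by blast
  interpret \<mu>: prob_space \<mu> by fact
  have sp: "space \<mu> = UNIV" using sets_eq_imp_space_eq[OF \<mu>(2)] by simp
  note [measurable_cong] = \<mu>(2)
  have "prob {\<omega> \<in> space N. X \<omega> $ k \<le> t} = C (corner k t)"
    unfolding C using X_range by (intro arg_cong[where f=prob]) (auto simp: le_corner_iff)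
  also have "\<dots> = measure \<mu> {v. v \<le> corner k t}" by (rule \<mu>(4)[OF corner_cbox[OF t]])
  also have "\<dots> = measure \<mu> {v. v $ k \<le> t}"
  proof (rule \<mu>.finite_measure_eq_AE)
    have "AE v in \<mu>. v \<in> cbox 0 1"
      using \<mu>(2,3) by (subst \<mu>.prob_eq_1[symmetric]) auto
    then show "AE v in \<mu>. (v \<in> {v. v \<le> corner k t}) = (v \<in> {v. v $ k \<le> t})"
      by eventually_elim (simp add: le_corner_iff)
    have "{v. v \<le> corner k t} = {..corner k t}" by auto
    then show "{v. v \<le> corner k t} \<in> sets \<mu>" by (simp add: \<mu>(2))
    have "{v \<in> space \<mu>. v $ k \<le> t} \<in> sets \<mu>" by measurable
    then show "{v. v $ k \<le> t} \<in> sets \<mu>" by (simp add: sp)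
  qed
  also have "\<dots> = measure (distr \<mu> borel (\<lambda>v. v $ k)) {..t}"
    by (subst measure_distr) (auto simp: sp intro!: arg_cong[where f="measure \<mu>"])
  also have "\<dots> = measure lborel ({0..1} \<inter> {..t}) / measure lborel {0..1::real}"
    unfolding \<mu>(5) by (subst measure_uniform_measure) auto
  also have "{0..1} \<inter> {..t} = {0..t}" using t by auto
  finally show ?thesis using t by simp
qed

abbreviation \<F> :: "'b measure" where
  "\<F> \<equiv> vimage_algebra (space N) X borel"

sublocale F: finite_measure_subalgebra N \<F>
proof
  show "subalgebra N \<F>"
    unfolding subalgebra_def using X by (auto simp: sets_vimage_algebra2 measurable_def)
qed

lemma F_sets: "B \<in> sets borel \<Longrightarrow> {\<omega> \<in> space N. X \<omega> \<in> B} \<in> sets \<F>"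
  by (auto simp: sets_vimage_algebra2)

lemma entry_integrable_square: "integrable N (\<lambda>\<omega>. (Y \<omega> $ a)\<^sup>2)"
proof (rule Bochner_Integration.integrable_bound[OF sq])
  show "AE \<omega> in N. norm ((Y \<omega> $ a)\<^sup>2) \<le> norm ((norm (Y \<omega>))\<^sup>2)"
    using power_mono[OF component_le_norm_cart abs_ge_zero, of _ a 2] by (intro AE_I2) simp
qed measurable

lemma entry_integrable: "integrable N (\<lambda>\<omega>. Y \<omega> $ a)"
  by (rule square_integrable_imp_integrable[OF _ entry_integrable_square]) measurable

text \<open>The half-space event lies in the sigma-algebra of \<open>X\<close>, so \<open>Y\<close>
  may be replaced there by its conditional expectation, which is 0.\<close>

lemma zero:
  "expectation (\<lambda>\<omega>. if X \<omega> $ k \<le> s then Y \<omega> $ a else 0) = 0"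
proof -
  let ?A = "{\<omega> \<in> space N. X \<omega> \<in> {x. x $ k \<le> s}}"
  have "{x :: real^'d1. x $ k \<le> s} \<in> sets borel" by measurable
  then have A: "?A \<in> sets \<F>" by (rule F_sets)
  have ae: "AE \<omega> in N. real_cond_exp N \<F> (\<lambda>\<omega>. Y \<omega> $ a) \<omega> = 0"
  proof -
    have "(axis a 1 :: real^'d2) \<in> Basis" by (simp add: axis_in_Basis_iff)
    then have "AE \<omega> in N. real_cond_exp N \<F> (\<lambda>\<omega>. Y \<omega> \<bullet> axis a 1) \<omega> = m (X \<omega>) \<bullet> axis a 1"
      using m unfolding is_cond_exp_given_def by blast
    then show ?thesis using AE_space by eventually_elim (simp add: m0 X_range inner_axis)
  qed
  have "expectation (\<lambda>\<omega>. if X \<omega> $ k \<le> s then Y \<omega> $ a else 0) = (LINT \<omega>:?A|N. Y \<omega> $ a)"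
    unfolding set_lebesgue_integral_def by (intro Bochner_Integration.integral_cong) auto
  also have "\<dots> = (LINT \<omega>:?A|N. real_cond_exp N \<F> (\<lambda>\<omega>. Y \<omega> $ a) \<omega>)"
    by (rule F.real_cond_exp_intA[OF entry_integrable A])
  also have "\<dots> = (LINT \<omega>|N. 0)"
    unfolding set_lebesgue_integral_def
  proof (rule integral_cong_AE)
    have "?A \<in> sets N" using A F.subalg by (auto simp: subalgebra_def)
    then show "(\<lambda>\<omega>. indicator ?A \<omega> *\<^sub>R real_cond_exp N \<F> (\<lambda>\<omega>. Y \<omega> $ a) \<omega>) \<in> borel_measurable N"
      by measurable
    show "AE \<omega> in N. indicator ?A \<omega> *\<^sub>R real_cond_exp N \<F> (\<lambda>\<omega>. Y \<omega> $ a) \<omega> = 0"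
      using ae by eventually_elim simp
  qed simp
  finally show ?thesis by simp
qed

lemma mean_zero_law: "mean_zero_law law"
proof (intro mean_zero_law.intro mean_zero_law_axioms.intro)
  show "prob_space law" unfolding law_def by (rule prob_space_distr) measurable
  show "sets law = sets borel" by (simp add: law_def)
  show "integrable law (\<lambda>z. (norm (snd z))\<^sup>2)"
    unfolding law_def by (subst integrable_distr_eq) (use sq in auto)
  show "measure law {z. fst z $ k \<le> t} = t" if "0 \<le> t" "t \<le> 1" for k t
  proof -
    have "{z :: (real^'d1) \<times> (real^'d2). fst z $ k \<le> t} \<in> sets borel" by measurable
    then have "measure law {z. fst z $ k \<le> t} = prob ((\<lambda>\<omega>. (X \<omega>, Y \<omega>)) -` {z. fst z $ k \<le> t} \<inter> space N)"
      unfolding law_def by (subst measure_distr) auto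
    also have "(\<lambda>\<omega>. (X \<omega>, Y \<omega>)) -` {z. fst z $ k \<le> t} \<inter> space N = {\<omega> \<in> space N. X \<omega> $ k \<le> t}" by auto
    finally show ?thesis using marginal[OF that] by simp
  qed
  show "(LINT z|law. (if fst z $ k \<le> s then snd z $ a else 0)) = 0" for k a s
  proof -
    have "(\<lambda>z :: (real^'d1) \<times> (real^'d2). if fst z $ k \<le> s then snd z $ a else 0) \<in> borel_measurable borel" by measurable
    then have "(LINT z|law. (if fst z $ k \<le> s then snd z $ a else 0)) = expectation (\<lambda>\<omega>. if fst (X \<omega>, Y \<omega>) $ k \<le> s then snd (X \<omega>, Y \<omega>) $ a else 0)"
      unfolding law_def by (subst integral_distr) auto
    then show ?thesis using zero[of k s a] by (simp cong: if_cong)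
  qed
qed

text \<open>The values of \<open>c\<close> are controlled only on the cube; the cut-off yields a
  density on the whole space.\<close>

definition dens_fun :: "real^'d1 \<Rightarrow> real" where
  "dens_fun v = indicator (cbox 0 1) v * c v"

lemma dens_fun_meas[measurable]: "dens_fun \<in> borel_measurable borel"
  and dens_fun_nonneg: "0 \<le> dens_fun v"
  and dens_fun_int: "integrable lborel dens_fun"
proof -
  have "set_integrable lborel (cbox 0 1) c" "\<forall>v\<in>cbox 0 1. 0 \<le> c v"
    using dens unfolding has_density_def by auto
  then show "integrable lborel dens_fun" "0 \<le> dens_fun v"
    by (auto simp: set_integrable_def dens_fun_def[abs_def] indicator_def)
  then show "dens_fun \<in> borel_measurable borel" using borel_measurable_integrable by simp
qed

lemma atMost_Int_cbox: "u \<in> cbox 0 1 \<Longrightarrow> {..u} \<inter> cbox 0 1 = cbox 0 (u::real^'d1)"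
  by (auto simp: mem_box_cart less_eq_vec_def) (meson order_trans)

text \<open>Both measures are compared on lower orthants. If \<open>a\<close> is nonnegative it may
  be clipped to the cube, where the density formula for \<open>C\<close> applies; otherwise both
  sides are 0.\<close>

lemma X_law: "distr N borel X = density lborel (\<lambda>v. ennreal (dens_fun v))"
proof (rule emeasure_eqI_atMost)
  show "finite_measure (distr N borel X)"
    by (intro prob_space.finite_measure prob_space_distr) measurable
  fix a :: "real^'d1"
  have L: "emeasure (distr N borel X) {..a} = ennreal (prob {\<omega> \<in> space N. X \<omega> \<le> a})"
    by (subst emeasure_distr) (auto simp: emeasure_eq_measure intro!: arg_cong[where f=prob])
  have R: "emeasure (density lborel (\<lambda>v. ennreal (dens_fun v))) {..a} = (\<integral>\<^sup>+v. ennreal (indicator ({..a} \<inter> cbox 0 1) v * c v) \<partial>lborel)"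
  proof -
    have "emeasure (density lborel (\<lambda>v. ennreal (dens_fun v))) {..a} = (\<integral>\<^sup>+v. ennreal (dens_fun v) * indicator {..a} v \<partial>lborel)"
      by (rule emeasure_density) measurable
    also have "\<dots> = (\<integral>\<^sup>+v. ennreal (indicator ({..a} \<inter> cbox 0 1) v * c v) \<partial>lborel)"
      by (intro nn_integral_cong) (auto simp: dens_fun_def indicator_def)
    finally show ?thesis .
  qed
  show "emeasure (distr N borel X) {..a} = emeasure (density lborel (\<lambda>v. ennreal (dens_fun v))) {..a}"
  proof (cases "0 \<le> a")
    case True
    define a' where "a' = inf a 1"
    have a': "a' \<in> cbox 0 1" using True by (auto simp: a'_def mem_box_cart less_eq_vec_def inf_vec_def)
    have eq: "x \<le> a \<longleftrightarrow> x \<le> a'" if "x \<in> cbox 0 1" for x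
      using that by (auto simp: a'_def mem_box_cart less_eq_vec_def inf_vec_def)
    have "{..a} \<inter> cbox 0 1 = cbox 0 a'" using eq atMost_Int_cbox[OF a'] by auto
    then have "emeasure (density lborel (\<lambda>v. ennreal (dens_fun v))) {..a} = (\<integral>\<^sup>+v. ennreal (indicator (cbox 0 a') v * c v) \<partial>lborel)"
      unfolding R by simp
    also have "\<dots> = ennreal (LINT v|lborel. indicator (cbox 0 a') v * c v)"
    proof (rule nn_integral_eq_integral)
      have sub: "cbox 0 a' \<subseteq> cbox 0 1" using atMost_Int_cbox[OF a'] by auto
      have *: "indicator (cbox 0 a') v * c v = indicator (cbox 0 a') v * dens_fun v" for v
        using sub by (auto simp: dens_fun_def indicator_def)
      show "integrable lborel (\<lambda>v. indicator (cbox 0 a') v * c v)"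
        unfolding * by (rule integrable_mult_indicator[where 'b=real, simplified]) (use dens_fun_int in auto)
      show "AE v in lborel. 0 \<le> indicator (cbox 0 a') v * c v"
        unfolding * using dens_fun_nonneg by simp
    qed
    also have "(LINT v|lborel. indicator (cbox 0 a') v * c v) = C a'"
      using dens a' unfolding has_density_def set_lebesgue_integral_def by simp
    also have "C a' = prob {\<omega> \<in> space N. X \<omega> \<le> a}"
      unfolding C using eq X_range by (intro arg_cong[where f=prob]) auto
    finally show ?thesis using L by simp
  next
    case False
    then have "\<not> x \<le> a" if "x \<in> cbox 0 1" for x
      using that order_trans[of 0 x a] by (auto simp: mem_box_cart less_eq_vec_def)
    then have "{\<omega> \<in> space N. X \<omega> \<le> a} = {}" "{..a} \<inter> cbox 0 1 = {}" using X_range by auto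
    then show ?thesis unfolding L R by (simp only:) simp
  qed
qed simp_all

lemma sigma2_meas[measurable]: "sigma2 \<in> borel_measurable borel"
  using sigma2 by (simp add: is_cond_exp_given_def)

lemma YY_integrable: "integrable N (\<lambda>\<omega>. Y \<omega> $ i * Y \<omega> $ j)"
proof (rule Bochner_Integration.integrable_bound)
  show "integrable N (\<lambda>\<omega>. (Y \<omega> $ i)\<^sup>2 + (Y \<omega> $ j)\<^sup>2)" using entry_integrable_square by simp
  have "\<bar>x * y\<bar> \<le> x\<^sup>2 + y\<^sup>2" for x y :: real
    using sum_squares_bound[of x y] sum_squares_bound[of x "-y"] zero_le_power2[of x] zero_le_power2[of y]
    by (simp add: abs_le_iff)
  then show "AE \<omega> in N. norm (Y \<omega> $ i * Y \<omega> $ j) \<le> norm ((Y \<omega> $ i)\<^sup>2 + (Y \<omega> $ j)\<^sup>2)" by simp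
qed measurable

lemma sigma2_cond_exp: "AE \<omega> in N. real_cond_exp N \<F> (\<lambda>\<omega>. Y \<omega> $ i * Y \<omega> $ j) \<omega> = sigma2 (X \<omega>) $ i $ j"
proof -
  let ?b = "axis i (axis j 1) :: real^'d2^'d2"
  let ?V = "\<lambda>\<omega>. row_outer (Y \<omega> - m (X \<omega>)) (Y \<omega> - m (X \<omega>)) \<bullet> ?b"
  have "?b \<in> Basis" by (simp add: axis_in_Basis_iff)
  then have ae: "AE \<omega> in N. real_cond_exp N \<F> ?V \<omega> = sigma2 (X \<omega>) \<bullet> ?b"
    using sigma2 unfolding is_cond_exp_given_def by blast
  have m_meas: "m \<in> borel_measurable borel" using m by (simp add: is_cond_exp_given_def)
  have V: "?V \<omega> = (Y \<omega> - m (X \<omega>)) $ i * (Y \<omega> - m (X \<omega>)) $ j" for \<omega>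
    by (simp add: inner_axis row_outer_entry)
  have "AE \<omega> in N. real_cond_exp N \<F> ?V \<omega> = real_cond_exp N \<F> (\<lambda>\<omega>. Y \<omega> $ i * Y \<omega> $ j) \<omega>"
  proof (rule F.real_cond_exp_cong)
    show "AE \<omega> in N. ?V \<omega> = Y \<omega> $ i * Y \<omega> $ j"
      using AE_space by eventually_elim (simp add: m0 X_range inner_axis row_outer_entry)
    show "?V \<in> borel_measurable N" unfolding V
      using measurable_compose[OF X m_meas] by (intro borel_measurable_times borel_measurable_vec_nth' borel_measurable_diff Y)
  qed measurable
  then show ?thesis using ae by eventually_elim (simp add: inner_axis)
qed

lemma sigma2_integrable: "integrable lborel (\<lambda>v. dens_fun v * sigma2 v $ i $ j)"
proof -
  have "integrable N (real_cond_exp N \<F> (\<lambda>\<omega>. Y \<omega> $ i * Y \<omega> $ j))"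
    by (rule F.real_cond_exp_int(1)[OF YY_integrable])
  then have "integrable N (\<lambda>\<omega>. sigma2 (X \<omega>) $ i $ j)"
    using sigma2_cond_exp[of i j] by (subst integrable_cong_AE[symmetric]) (auto intro: borel_measurable_cond_exp2)
  then have "integrable (distr N borel X) (\<lambda>v. sigma2 v $ i $ j)"
    by (subst integrable_distr_eq) auto
  then show ?thesis unfolding X_law
    by (subst (asm) integrable_density) (auto simp: dens_fun_nonneg)
qed

text \<open>As the event belongs to the sigma-algebra of \<open>X\<close>, the product may be
  replaced by \<open>sigma2 (X \<omega>)\<close>; the integral is then transported to Lebesgue
  measure by \<open>X_law\<close>.\<close>

theorem covariance_kernel:
  assumes u: "u \<in> cbox 0 1"
  shows "expectation (\<lambda>\<omega>. if X \<omega> \<le> u then Y \<omega> $ i * Y \<omega> $ j else 0) = (LINT v:cbox 0 u|lborel. c v *\<^sub>R sigma2 v) $ i $ j"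
proof -
  let ?A = "{\<omega> \<in> space N. X \<omega> \<in> {..u}}"
  have A: "?A \<in> sets \<F>" by (rule F_sets) simp
  then have AN: "?A \<in> sets N" using F.subalg by (auto simp: subalgebra_def)
  have ind: "indicator (cbox 0 u) v *\<^sub>R (c v *\<^sub>R sigma2 v) = (indicator {..u} v * dens_fun v) *\<^sub>R sigma2 v" for v
    using atMost_Int_cbox[OF u] by (auto simp: dens_fun_def indicator_def)
  have int: "integrable lborel (\<lambda>v. ((indicator {..u} v * dens_fun v) *\<^sub>R sigma2 v) $ i $ j)" for i j
    using integrable_mult_indicator[of "{..u}" lborel, OF _ sigma2_integrable[of i j]] by (simp add: mult.assoc)
  have "expectation (\<lambda>\<omega>. if X \<omega> \<le> u then Y \<omega> $ i * Y \<omega> $ j else 0) = (LINT \<omega>:?A|N. Y \<omega> $ i * Y \<omega> $ j)"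
    unfolding set_lebesgue_integral_def by (intro Bochner_Integration.integral_cong) auto
  also have "\<dots> = (LINT \<omega>:?A|N. real_cond_exp N \<F> (\<lambda>\<omega>. Y \<omega> $ i * Y \<omega> $ j) \<omega>)"
    by (rule F.real_cond_exp_intA[OF YY_integrable A])
  also have "\<dots> = (LINT \<omega>|N. indicator {..u} (X \<omega>) * sigma2 (X \<omega>) $ i $ j)"
    unfolding set_lebesgue_integral_def
  proof (rule integral_cong_AE)
    show "(\<lambda>\<omega>. indicator ?A \<omega> *\<^sub>R real_cond_exp N \<F> (\<lambda>\<omega>. Y \<omega> $ i * Y \<omega> $ j) \<omega>) \<in> borel_measurable N"
      using AN by measurable
    show "AE \<omega> in N. indicator ?A \<omega> *\<^sub>R real_cond_exp N \<F> (\<lambda>\<omega>. Y \<omega> $ i * Y \<omega> $ j) \<omega> = indicator {..u} (X \<omega>) * sigma2 (X \<omega>) $ i $ j"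
      using sigma2_cond_exp[of i j] AE_space by eventually_elim (auto simp: indicator_def)
  qed measurable
  also have "\<dots> = (LINT v|distr N borel X. indicator {..u} v * sigma2 v $ i $ j)"
    by (subst integral_distr) auto
  also have "\<dots> = (LINT v|lborel. dens_fun v *\<^sub>R (indicator {..u} v * sigma2 v $ i $ j))"
    unfolding X_law by (subst integral_density) (auto simp: dens_fun_nonneg)
  also have "\<dots> = (LINT v|lborel. ((indicator {..u} v * dens_fun v) *\<^sub>R sigma2 v) $ i $ j)"
    by (intro Bochner_Integration.integral_cong) auto
  also have "\<dots> = (LINT v:cbox 0 u|lborel. c v *\<^sub>R sigma2 v) $ i $ j"
    unfolding set_lebesgue_integral_def ind by (rule integral_matrix(2)[OF int, symmetric])
  finally show ?thesis .
qed

end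

section \<open>Conclusion\<close>

lemma insort_key_cong:
  "(\<And>i. i \<in> insert j (set ys) \<Longrightarrow> f i = g i) \<Longrightarrow> insort_key f j ys = insort_key g j ys"
  by (induction ys) auto

lemma sort_key_cong:
  "(\<And>i. i \<in> set js \<Longrightarrow> f i = g i) \<Longrightarrow> sort_key f js = sort_key g js"
proof (induction js)
  case (Cons j js)
  then show ?case using insort_key_cong[of j "sort_key g js" f g] by simp
qed simp

text \<open>Sorting reads only the indices from 1 to \<open>n\<close>, so values at index 0 may be
  changed freely.\<close>

lemma induced_order_stat_cong:
  assumes "\<And>i. 1 \<le> i \<Longrightarrow> x i = x' i" "\<And>i. 1 \<le> i \<Longrightarrow> y i = y' i" and j: "1 \<le> j" "j \<le> n"
  shows "induced_order_stat x y n j = induced_order_stat x' y' n j"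
proof -
  have eq: "sort_key x [1..<Suc n] = sort_key x' [1..<Suc n]"
    by (rule sort_key_cong) (use assms(1) in auto)
  have "sort_key x' [1..<Suc n] ! (j - 1) \<in> set (sort_key x' [1..<Suc n])"
    using j by (intro nth_mem) auto
  then have "1 \<le> sort_key x' [1..<Suc n] ! (j - 1)" by (simp only: set_sort set_upt atLeastLessThan_iff)
  then show ?thesis unfolding induced_order_stat_def eq by (rule assms(2))
qed

lemma induced_sum_process_cong:
  assumes "\<And>i. 1 \<le> i \<Longrightarrow> X i \<omega> = X' i \<omega>" "\<And>i. 1 \<le> i \<Longrightarrow> Y i \<omega> = Y' i \<omega>" and t: "0 \<le> t" "t \<le> 1"
  shows "induced_sum_process X Y n \<omega> t = induced_sum_process X' Y' n \<omega> t"
proof -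
  have "j \<le> n" if "j \<in> {1..nat \<lfloor>real n * t\<rfloor>}" for j using that step_index[OF t, of n] by simp
  then show ?thesis unfolding induced_sum_process_def vec_eq_iff
    using assms(1,2) by (auto intro!: sum.cong induced_order_stat_cong arg_cong[where f="\<lambda>v. v $ _"])
qed

context regression_model
begin

text \<open>On the cube, the two half-space conditions together say that \<open>X\<close> lies below
  the minimum of the two corners; this is the source of the box in the kernel.\<close>

lemma Phi_product_kernel:
  assumes t1: "0 \<le> t1" "t1 \<le> 1" and t2: "0 \<le> t2" "t2 \<le> 1"
  shows "(LINT z|law. Phi t1 z $ k1 $ i * Phi t2 z $ k2 $ j) =
    (LINT v:cbox 0 (inf (corner k1 t1) (corner k2 t2))|lborel. c v *\<^sub>R sigma2 v) $ i $ j"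
proof -
  let ?u = "inf (corner k1 t1) (corner k2 t2) :: real^'d1"
  have u: "?u \<in> cbox 0 1"
    using corner_cbox[OF t1, of k1] corner_cbox[OF t2, of k2] by (auto simp: mem_box_cart inf_vec_def intro: le_infI1)
  have meas: "(\<lambda>z :: (real^'d1) \<times> (real^'d2). Phi t1 z $ k1 $ i * Phi t2 z $ k2 $ j) \<in> borel_measurable borel"
    by measurable
  have "(LINT z|law. Phi t1 z $ k1 $ i * Phi t2 z $ k2 $ j) =
     expectation (\<lambda>\<omega>. Phi t1 (X \<omega>, Y \<omega>) $ k1 $ i * Phi t2 (X \<omega>, Y \<omega>) $ k2 $ j)"
    unfolding law_def by (rule integral_distr[OF rv_pair meas])
  also have "\<dots> = expectation (\<lambda>\<omega>. if X \<omega> \<le> ?u then Y \<omega> $ i * Y \<omega> $ j else 0)"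
  proof (rule Bochner_Integration.integral_cong[OF refl])
    fix \<omega> assume "\<omega> \<in> space N"
    from X_range[OF this] show "Phi t1 (X \<omega>, Y \<omega>) $ k1 $ i * Phi t2 (X \<omega>, Y \<omega>) $ k2 $ j = (if X \<omega> \<le> ?u then Y \<omega> $ i * Y \<omega> $ j else 0)"
      by (simp add: Phi_entry le_corner_iff)
  qed
  also have "\<dots> = (LINT v:cbox 0 ?u|lborel. c v *\<^sub>R sigma2 v) $ i $ j"
    by (rule covariance_kernel[OF u])
  finally show ?thesis .
qed

end

theorem lemma2:
  fixes N :: "'b measure" and X :: "'b \<Rightarrow> real^'d1" and Y :: "'b \<Rightarrow> real^'d2"
    and M :: "'a measure" and Xs :: "nat \<Rightarrow> 'a \<Rightarrow> real^'d1" and Ys :: "nat \<Rightarrow> 'a \<Rightarrow> real^'d2"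
    and C c :: "real^'d1 \<Rightarrow> real"
    and m :: "real^'d1 \<Rightarrow> real^'d2" and sigma2 :: "real^'d1 \<Rightarrow> real^'d2^'d2"
  assumes "prob_space N" and "X \<in> borel_measurable N" and "Y \<in> borel_measurable N"
    and "\<And>\<omega>. \<omega> \<in> space N \<Longrightarrow> X \<omega> \<in> cbox 0 1"
    and "\<And>u. C u = measure N {\<omega> \<in> space N. X \<omega> \<le> u}"
    and "is_copula C" and "has_density C c"
    and "prob_space M"
    and "prob_space.indep_vars M (\<lambda>_. borel) (\<lambda>i \<omega>. (Xs i \<omega>, Ys i \<omega>)) {1..}"
    and "\<And>i. 1 \<le> i \<Longrightarrow>
           distr M borel (\<lambda>\<omega>. (Xs i \<omega>, Ys i \<omega>)) = distr N borel (\<lambda>\<omega>. (X \<omega>, Y \<omega>))"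
    and "is_cond_exp_given N X Y m"
    and "is_cond_exp_given N X (\<lambda>\<omega>. row_outer (Y \<omega> - m (X \<omega>)) (Y \<omega> - m (X \<omega>))) sigma2"
    and "integrable N (\<lambda>\<omega>. (norm (Y \<omega>))\<^sup>2)"
    and "\<And>u. u \<in> cbox 0 1 \<Longrightarrow> m u = 0"
  shows "\<exists>(P :: (real \<Rightarrow> real^'d2^'d1) measure) Z.
           prob_space P \<and>
           gaussian_process P {0..1} Z \<and>
           centered_process P {0..1} Z \<and>
           (\<forall>t1\<in>{0..1}. \<forall>t2\<in>{0..1}. \<forall>k1 k2.
              integrable P (\<lambda>\<omega>. row_outer (Z \<omega> t1 $ k1) (Z \<omega> t2 $ k2)) \<and>
              (LINT \<omega>|P. row_outer (Z \<omega> t1 $ k1) (Z \<omega> t2 $ k2)) =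
                (LINT v:cbox 0 (inf (corner k1 t1) (corner k2 t2))|lborel. c v *\<^sub>R sigma2 v)) \<and>
           (AE \<omega> in P. continuous_on {0..1} (Z \<omega>)) \<and>
           weakly_converges_uniformly {0..1} M
             (\<lambda>n \<omega> t. (1 / sqrt (real n)) *\<^sub>R induced_sum_process Xs Ys n \<omega> t) P Z"
proof -
  interpret N: regression_model N X Y C c m sigma2
    using assms by (intro regression_model.intro regression_model_axioms.intro)
  interpret M: prob_space M by fact
  interpret law: mean_zero_law N.law by (rule N.mean_zero_law)
  \<comment> \<open>Nothing is assumed about the variables with index 0, not even measurability.\<close>
  define X' where "X' i = (if i = 0 then (\<lambda>_. 0) else Xs i)" for i :: nat
  define Y' where "Y' i = (if i = 0 then (\<lambda>_. 0) else Ys i)" for i :: nat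
  have same: "X' i = Xs i" "Y' i = Ys i" if "1 \<le> i" for i
    using that by (auto simp: X'_def Y'_def)
  have rv: "X' i \<in> borel_measurable M" "Y' i \<in> borel_measurable M" for i
  proof -
    have "(\<lambda>\<omega>. (Xs i \<omega>, Ys i \<omega>)) \<in> borel_measurable M" if "1 \<le> i"
      using assms(9) that unfolding M.indep_vars_def2 by auto
    from measurable_compose[OF this borel_measurable_fst] measurable_compose[OF this borel_measurable_snd]
    show "X' i \<in> borel_measurable M" "Y' i \<in> borel_measurable M"
      by (cases "i = 0"; simp add: X'_def Y'_def)+
  qed
  interpret S: copula_sample M N.law X' Y'
  proof (intro copula_sample.intro copula_sample_axioms.intro)
    show "M.indep_vars (\<lambda>_. borel) (\<lambda>i \<omega>. (X' i \<omega>, Y' i \<omega>)) {1..}"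
      using assms(9) by (subst M.indep_vars_cong[OF refl, where Y="\<lambda>i \<omega>. (Xs i \<omega>, Ys i \<omega>)" and N'="\<lambda>_. borel"]) (auto simp: same)
    show "distr M borel (\<lambda>\<omega>. (X' i \<omega>, Y' i \<omega>)) = N.law" if "1 \<le> i" for i
      using assms(10)[OF that] by (simp add: same[OF that] N.law_def)
  qed (fact | rule rv M.prob_space_axioms N.mean_zero_law)+
  \<comment> \<open>Any unit vector will do: it embeds the scalar normal variables into the value
    type on which the sample space of the limit is built.\<close>
  have "norm (axis undefined (axis undefined 1) :: real^'d2^'d1) = 1" by simp
  from ex_iid_std_normal[OF this]
  obtain P :: "(real \<Rightarrow> real^'d2^'d1) measure" and \<xi> where P: "prob_space P"
    "prob_space.indep_vars P (\<lambda>_. borel) \<xi> (UNIV :: nat set)" "\<And>n. distr P borel (\<xi> n) = std_normal_distribution"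
    by blast
  interpret G: gaussian_limit M N.law X' Y' P \<xi>
    using P by (intro gaussian_limit.intro gaussian_limit_axioms.intro S.copula_sample_axioms)
  have gauss: "gaussian_process P {0..1} G.Z"
    unfolding gaussian_process_def
  proof (intro allI impI)
    fix F :: "real set" and a :: "real \<Rightarrow> real^'d2^'d1" assume "finite F \<and> F \<subseteq> {0..1}"
    then show "normal_rv P (\<lambda>\<omega>. \<Sum>t\<in>F. a t \<bullet> G.Z \<omega> t)"
      by (intro G.Z_normal(1)) auto
  qed
  have entry: "integrable P (\<lambda>\<omega>. G.Z \<omega> t $ k $ a)" "(LINT \<omega>|P. G.Z \<omega> t $ k $ a) = 0" if "t \<in> {0..1}" for t k a
    using G.Z_normal(2,3)[of "{t}" "\<lambda>t. t" "\<lambda>_. axis k (axis a 1)"] that by (auto simp: inner_axis')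
  have centered: "centered_process P {0..1} G.Z"
    unfolding centered_process_def
  proof (intro ballI conjI)
    fix t :: real assume t: "t \<in> {0..1}"
    show "integrable P (\<lambda>\<omega>. G.Z \<omega> t)" by (rule integral_matrix(1)) (rule entry(1)[OF t])
    show "(LINT \<omega>|P. G.Z \<omega> t) = 0"
      unfolding vec_eq_iff
      by (intro allI) (subst integral_matrix(2)[OF entry(1)[OF t]], simp add: entry(2)[OF t])
  qed
  have cov: "integrable P (\<lambda>\<omega>. row_outer (G.Z \<omega> t1 $ k1) (G.Z \<omega> t2 $ k2)) \<and>
      (LINT \<omega>|P. row_outer (G.Z \<omega> t1 $ k1) (G.Z \<omega> t2 $ k2)) =
        (LINT v:cbox 0 (inf (corner k1 t1) (corner k2 t2))|lborel. c v *\<^sub>R sigma2 v)"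
    if t: "t1 \<in> {0..1}" "t2 \<in> {0..1}" for t1 t2 k1 k2
  proof -
    have tt: "0 \<le> t1" "t1 \<le> 1" "0 \<le> t2" "t2 \<le> 1" using t by auto
    have int: "integrable P (\<lambda>\<omega>. row_outer (G.Z \<omega> t1 $ k1) (G.Z \<omega> t2 $ k2) $ i $ j)"
      and eq: "(LINT \<omega>|P. row_outer (G.Z \<omega> t1 $ k1) (G.Z \<omega> t2 $ k2) $ i $ j) =
         (LINT v:cbox 0 (inf (corner k1 t1) (corner k2 t2))|lborel. c v *\<^sub>R sigma2 v) $ i $ j" for i j
      using G.Z_covariance[OF tt, of "axis k1 (axis i 1)" "axis k2 (axis j 1)"] N.Phi_product_kernel[OF tt, of k1 i k2 j]
      by (simp_all add: row_outer_entry inner_axis')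
    show ?thesis
      using integral_matrix[OF int] eq by (simp add: vec_eq_iff)
  qed
  have "weakly_converges_uniformly {0..1} M (\<lambda>n \<omega> t. (1 / sqrt (real n)) *\<^sub>R induced_sum_process Xs Ys n \<omega> t) P G.Z"
  proof -
    have "restrict (\<lambda>t. (1 / sqrt (real n)) *\<^sub>R induced_sum_process Xs Ys n \<omega> t) {0..1} = restrict (G.Zt n \<omega>) {0..1}" for n \<omega>
    proof (rule restrict_ext)
      fix t :: real assume "t \<in> {0..1}"
      then have "induced_sum_process X' Y' n \<omega> t = induced_sum_process Xs Ys n \<omega> t"
        by (intro induced_sum_process_cong) (auto simp: same)
      then show "(1 / sqrt (real n)) *\<^sub>R induced_sum_process Xs Ys n \<omega> t = G.Zt n \<omega> t"
        by (simp add: G.Zt_def)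
    qed
    then show ?thesis
      using G.weak_convergence unfolding weakly_converges_uniformly_def by simp
  qed
  moreover have "AE \<omega> in P. continuous_on {0..1} (G.Z \<omega>)"
    by (rule AE_I2) (rule G.Z_continuous)
  ultimately show ?thesis
    using P(1) gauss centered cov by (intro exI[of _ P] exI[of _ G.Z]) blast
qed

end
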